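(* Assume the Riemann Hypothesis. Let $k$ be a positive even integer. There is a number $\epsilon_0=\epsilon_0(k)>0$ such that the following holds for all real $\epsilon,\epsilon_1$ with $\epsilon_0>\epsilon>\epsilon_1>0$. If $$\int_{1}^{X} (\psi(x+\delta x) - \psi(x) - \delta x)^k\, dx = \frac{\mu_k}{\frac{k}{2}+1}\, X^{k/2+1} \delta^{k/2} \Bigl( \log\frac{1}{E\delta}\Bigr)^{k/2} + O_k\bigl(\delta^{k/2} X^{k/2+1-\epsilon_1}\bigr)$$ holds uniformly for $X^{-1+\epsilon} \leq \delta \leq X^{-\epsilon}$, then there exists $\epsilon_2>0$ such that $$\int_{1}^{X} (\psi(x+h)-\psi(x)-h)^k\, dx = \mu_k\, h^{k/2+1} \int_{E}^{X/h} \Bigl(\log\frac{x}{E}\Bigr)^{k/2} dx + O_k\bigl(h^{k/2} X^{1-\epsilon_2}\bigr)$$ holds uniformly for $X^{2\epsilon + \epsilon_1} \leq h \leq X^{1-(k/2+1)\epsilon - 2\epsilon_1}/2$.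
   Context: $\psi(x)=\sum_{n\le x}\Lambda(n)$, where $\Lambda$ is the von Mangoldt function. For even $k$, $\mu_k = 1\cdot 3\cdot 5\cdots (k-1)$. $E=2\pi e^{C_0-1}$, where $C_0$ is Euler's constant. The estimates are for large $X$; "uniformly" means that the implied constant in $O_k(\cdot)$ does not depend on $X$ nor on $h$ (respectively $\delta$) in the stated range. The integer $k$ and the numbers $\epsilon,\epsilon_1$ are regarded as fixed. *)

theory Defs
  imports "HOL-Complex_Analysis.Complex_Analysis" "HOL-Number_Theory.Prime_Powers"
begin

text \<open>
  Existence of the analytic continuation of the zeta function. Expand each term of the telescoping
  sum of (n+1)^(1-s) - n^(1-s) to order N in 1/n. This expresses (s-1) zeta(s) through the
  functions (s+j-2) zeta(s+j-1) for j = 2, ..., N, with polynomial coefficients, and a remainder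
  series that converges for Re s > 1 - N. Induction on N then covers the whole plane.
\<close>

lemma zeta_series_summable:
  fixes s :: complex
  assumes "Re s > 1"
  shows "summable (\<lambda>n. 1 / of_nat (Suc n) powr s)"
proof (rule summable_norm_cancel)
  have "norm (1 / of_nat (Suc n) powr s) = real (Suc n) powr (- Re s)" for n
    by (simp add: norm_divide norm_powr_real_powr powr_minus_divide del: of_nat_Suc)
  moreover have "summable (\<lambda>n. real (Suc n) powr (- Re s))"
    using assms summable_real_powr_iff[of "- Re s"] summable_Suc_iff[of "\<lambda>n. real n powr (- Re s)"]
    by simp
  ultimately show "summable (\<lambda>n. norm (1 / of_nat (Suc n) powr s))"
    by simp
qed

definition taylor_rem :: "nat \<Rightarrow> nat \<Rightarrow> complex \<Rightarrow> complex" where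
  "taylor_rem N n s = of_nat (Suc (Suc n)) powr (1 - s)
     - (\<Sum>j\<le>N. ((1 - s) gchoose j) * of_nat (Suc n) powr (1 - s - of_nat j))"

lemma taylor_rem_bound:
  assumes "Re s > 1 - real N" "N \<ge> 1"
  shows "norm (taylor_rem N n s)
     \<le> norm ((1 - s) gchoose (Suc N)) * fact (Suc N) * real (Suc n) powr (- Re s - real N)"
proof -
  define a where "a = 1 - s"
  define m where "m = Suc n"
  define S where "S = closed_segment (of_nat m) (of_nat (Suc m) :: complex)"
  define f where "f i z = fact i * (a gchoose i) * z powr (a - of_nat i)" for i and z :: complex
  define B where "B = norm (a gchoose (Suc N)) * fact (Suc N) * real m powr (- Re s - real N)"
  have S: "\<exists>x. z = of_real x \<and> real m \<le> x" if z: "z \<in> S" for z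
  proof -
    from z obtain u where u: "0 \<le> u" "u \<le> 1"
      "z = (1 - u) *\<^sub>R of_nat m + u *\<^sub>R of_nat (Suc m)"
      unfolding S_def closed_segment_def by auto
    have "z = of_real (real m + u)"
      using u(3) by (simp add: scaleR_conv_of_real algebra_simps)
    then show ?thesis using u(1) by (intro exI[of _ "real m + u"]) auto
  qed
  have m: "real m \<ge> 1" by (simp add: m_def)
  have B0: "B \<ge> 0" by (simp add: B_def)
  have "norm (f 0 (of_nat (Suc m)) - (\<Sum>i\<le>N. f i (of_nat m) * (of_nat (Suc m) - of_nat m) ^ i / fact i))
      \<le> B * norm (of_nat (Suc m) - of_nat m :: complex) ^ Suc N / fact N"
  proof (rule complex_Taylor[of S])
    show "convex S" by (simp add: S_def)
    show "of_nat m \<in> S" "of_nat (Suc m) \<in> S" by (simp_all add: S_def)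
  next
    fix i z assume z: "z \<in> S" "i \<le> N"
    then obtain x where x: "z = of_real x" "real m \<le> x" using S by blast
    have nz: "z \<notin> \<real>\<^sub>\<le>\<^sub>0" using x m by simp
    have "fact i * (a gchoose i) * (a - of_nat i) = fact (Suc i) * (a gchoose Suc i)"
      using gbinomial_mult_1[of a i] by (simp add: algebra_simps)
    moreover have "a - of_nat i - 1 = a - of_nat (Suc i)" by simp
    ultimately have e: "fact i * (a gchoose i) * ((a - of_nat i) * z powr (a - of_nat i - 1)) = f (Suc i) z"
      unfolding f_def by (metis mult.assoc)
    show "(f i has_field_derivative f (Suc i) z) (at z within S)"
      unfolding f_def [of i, abs_def] e[symmetric]
      by (intro DERIV_cmult has_field_derivative_at_within[OF has_field_derivative_powr] nz)
  next
    fix z assume z: "z \<in> S"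
    then obtain x where x: "z = of_real x" "real m \<le> x" using S by blast
    have "norm (z powr (a - of_nat (Suc N))) = x powr (- Re s - real N)"
      using x m by (simp add: norm_powr_real_powr a_def)
    also have "\<dots> \<le> real m powr (- Re s - real N)"
      using x m assms by (intro powr_mono2') auto
    finally show "norm (f (Suc N) z) \<le> B"
      unfolding f_def B_def norm_mult
      by (simp add: mult_left_mono mult.commute mult.left_commute del: fact_Suc)
  qed
  also have "\<dots> = B / fact N" by simp
  also have "\<dots> \<le> B" 
    using fact_ge_1[of N] B0 by (simp add: divide_le_eq mult_le_cancel_left1 del: fact_Suc)
  also have "f 0 (of_nat (Suc m)) - (\<Sum>i\<le>N. f i (of_nat m) * (of_nat (Suc m) - of_nat m) ^ i / fact i)
      = taylor_rem N n s"
    by (simp add: taylor_rem_def f_def a_def m_def algebra_simps)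
  finally show ?thesis by (simp add: B_def a_def m_def)
qed

lemma half_plane_open: "open {s::complex. Re s > c}"
  by (rule open_halfspace_Re_gt)

lemma holomorphic_suminf_half_plane:
  fixes f :: "nat \<Rightarrow> complex \<Rightarrow> complex"
  assumes hol: "\<And>n. f n holomorphic_on {s. Re s > c}"
  assumes bd: "\<And>n s. Re s > c \<Longrightarrow> norm (f n s) \<le> g s * real (Suc n) powr (c - 1 - Re s)"
  assumes g: "continuous_on UNIV g"
  shows "(\<lambda>s. \<Sum>n. f n s) holomorphic_on {s. Re s > c}"
proof (rule holomorphic_uniform_sequence[where f = "\<lambda>N s. \<Sum>n<N. f n s"])
  show "open {s. Re s > c}" by (rule half_plane_open)
  show "(\<lambda>s. \<Sum>n<N. f n s) holomorphic_on {s. Re s > c}" for N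
    by (intro holomorphic_on_sum hol)
  fix x assume x: "x \<in> {s. Re s > c}"
  define d where "d = (Re x - c) / 2"
  have d: "d > 0" using x by (simp add: d_def)
  have sub: "Re s \<ge> c + d" if "s \<in> cball x d" for s
  proof -
    have "\<bar>Re (x - s)\<bar> \<le> d" using that abs_Re_le_cmod[of "x - s"] by (simp add: dist_norm)
    then show ?thesis by (simp add: d_def abs_le_iff) argo
  qed
  obtain K where K: "\<And>s. s \<in> cball x d \<Longrightarrow> norm (g s) \<le> K"
    using compact_imp_bounded[OF compact_continuous_image[OF continuous_on_subset[OF g] compact_cball[of x d]]]
    unfolding bounded_iff by blast
  have "uniform_limit (cball x d) (\<lambda>N s. \<Sum>n<N. f n s) (\<lambda>s. \<Sum>n. f n s) sequentially"
  proof (rule Weierstrass_m_test)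
    show "summable (\<lambda>n. K * real (Suc n) powr (-1 - d))"
      using d summable_real_powr_iff[of "-1 - d"] summable_Suc_iff[of "\<lambda>n. real n powr (-1 - d)"]
      by (intro summable_mult) simp
    fix n s assume s: "s \<in> cball x d"
    have "norm (f n s) \<le> g s * real (Suc n) powr (c - 1 - Re s)"
      using sub[OF s] d by (intro bd) auto
    also have "\<dots> \<le> K * real (Suc n) powr (-1 - d)"
      using K[OF s] sub[OF s] order_trans[OF norm_ge_zero K[OF s]]
      by (intro mult_mono powr_mono) auto
    finally show "norm (f n s) \<le> K * real (Suc n) powr (-1 - d)" .
  qed
  then show "\<exists>d>0. cball x d \<subseteq> {s. Re s > c} \<and>
      uniform_limit (cball x d) (\<lambda>N s. \<Sum>n<N. f n s) (\<lambda>s. \<Sum>n. f n s) sequentially"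
    using d sub by (intro exI[of _ d]) force
qed

lemma gchoose_holomorphic [holomorphic_intros]:
  assumes "f holomorphic_on A"
  shows "(\<lambda>s. f s gchoose k) holomorphic_on A"
  unfolding gbinomial_prod_rev by (intro holomorphic_intros assms) auto

lemma taylor_rem_sum_holomorphic:
  assumes "N \<ge> 1"
  shows "(\<lambda>s. \<Sum>n. taylor_rem N n s) holomorphic_on {s. Re s > 1 - real N}"
proof (rule holomorphic_suminf_half_plane[where g = "\<lambda>s. norm ((1 - s) gchoose (Suc N)) * fact (Suc N)"])
  show "taylor_rem N n holomorphic_on {s. Re s > 1 - real N}" for n
    unfolding taylor_rem_def[abs_def] by (intro holomorphic_intros)
  show "norm (taylor_rem N n s) \<le> norm ((1 - s) gchoose (Suc N)) * fact (Suc N) *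
      real (Suc n) powr (1 - real N - 1 - Re s)" if "Re s > 1 - real N" for n s
  proof -
    have "- Re s - real N = 1 - real N - 1 - Re s" by simp
    then show ?thesis using taylor_rem_bound[OF that assms, of n] by (simp only:)
  qed
  show "continuous_on UNIV (\<lambda>s::complex. norm ((1 - s) gchoose (Suc N)) * fact (Suc N))"
    by (intro continuous_on_mult continuous_on_norm continuous_on_const
          holomorphic_on_imp_continuous_on holomorphic_intros)
qed

lemma taylor_rem_summable:
  assumes "N \<ge> 1" "Re s > 1 - real N"
  shows "summable (\<lambda>n. taylor_rem N n s)"
proof (rule summable_comparison_test')
  show "summable (\<lambda>n. norm ((1 - s) gchoose (Suc N)) * fact (Suc N) * real (Suc n) powr (- Re s - real N))"
    using assms summable_real_powr_iff[of "- Re s - real N"]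
      summable_Suc_iff[of "\<lambda>n. real n powr (- Re s - real N)"]
    by (intro summable_mult) simp
  show "norm (taylor_rem N n s)
      \<le> norm ((1 - s) gchoose (Suc N)) * fact (Suc N) * real (Suc n) powr (- Re s - real N)" for n
    using taylor_rem_bound assms by blast
qed

lemma zeta_series_identity:
  assumes s: "Re s > 1" and N: "N \<ge> 1"
  shows "(s - 1) * (\<Sum>n. 1 / of_nat (Suc n) powr s) =
    1 - (\<Sum>j\<in>{2..N}. ((1 - s) gchoose (j - 1)) / of_nat j *
          ((s + of_nat (j - 1) - 1) * (\<Sum>n. 1 / of_nat (Suc n) powr (s + of_nat (j - 1)))))
      + (\<Sum>n. taylor_rem N n s)"
proof -
  define Z where "Z t = (\<Sum>n. 1 / of_nat (Suc n) powr t)" for t :: complex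
  have Z: "(\<lambda>n. of_nat (Suc n) powr (1 - s - of_nat j)) sums Z (s + of_nat (j - 1))" if "j \<ge> 1" for j
  proof -
    have "1 - s - of_nat j = - (s + of_nat (j - 1))"
      using that by (simp add: of_nat_diff)
    then have "of_nat (Suc n) powr (1 - s - of_nat j) = 1 / of_nat (Suc n) powr (s + of_nat (j - 1))" for n
      using powr_minus_divide by metis
    moreover have "summable (\<lambda>n. 1 / of_nat (Suc n) powr (s + of_nat (j - 1)))"
      using s by (intro zeta_series_summable) simp
    ultimately show ?thesis unfolding Z_def by (simp add: summable_sums)
  qed
  have R: "(\<lambda>n. taylor_rem N n s) sums (\<Sum>n. taylor_rem N n s)"
    using s N by (intro summable_sums taylor_rem_summable) auto
  have sums1: "(\<lambda>n. (\<Sum>j\<in>{1..N}. ((1 - s) gchoose j) * of_nat (Suc n) powr (1 - s - of_nat j)) + taylor_rem N n s)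
     sums ((\<Sum>j\<in>{1..N}. ((1 - s) gchoose j) * Z (s + of_nat (j - 1))) + (\<Sum>n. taylor_rem N n s))"
    by (intro sums_add sums_sum sums_mult Z R) auto
  have "{..N} = insert 0 {1..N}" by auto
  then have e: "(\<Sum>j\<in>{1..N}. ((1 - s) gchoose j) * of_nat (Suc n) powr (1 - s - of_nat j)) + taylor_rem N n s
     = of_nat (Suc (Suc n)) powr (1 - s) - of_nat (Suc n) powr (1 - s)" for n
    unfolding taylor_rem_def by (simp del: of_nat_Suc)
  have "(\<lambda>n. of_nat (Suc n) powr (1 - s) :: complex) \<longlonglongrightarrow> 0"
  proof (rule tendsto_norm_zero_cancel)
    have "(\<lambda>n. real (Suc n) powr (1 - Re s)) \<longlonglongrightarrow> 0"
      using s by (intro tendsto_neg_powr filterlim_compose[OF filterlim_real_sequentially filterlim_Suc]) auto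
    then show "(\<lambda>n. norm (of_nat (Suc n) powr (1 - s) :: complex)) \<longlonglongrightarrow> 0"
      by (simp add: norm_powr_real_powr del: of_nat_Suc)
  qed
  from telescope_sums[OF this]
  have sums2: "(\<lambda>n. of_nat (Suc (Suc n)) powr (1 - s) - of_nat (Suc n) powr (1 - s)) sums (-1 :: complex)"
    by simp
  have eq: "(\<Sum>j\<in>{1..N}. ((1 - s) gchoose j) * Z (s + of_nat (j - 1))) + (\<Sum>n. taylor_rem N n s) = -1"
    using sums_unique2[OF sums1[unfolded e] sums2] .
  have "{1..N} = insert 1 {2..N}" using N by auto
  then have eq2: "(1 - s) * Z s + (\<Sum>j\<in>{2..N}. ((1 - s) gchoose j) * Z (s + of_nat (j - 1)))
      + (\<Sum>n. taylor_rem N n s) = -1"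
    using eq by simp
  have "((1 - s) gchoose j) * Z (s + of_nat (j - 1)) = - (((1 - s) gchoose (j - 1)) / of_nat j *
          ((s + of_nat (j - 1) - 1) * Z (s + of_nat (j - 1))))" if j: "j \<in> {2..N}" for j
  proof -
    obtain i where i: "j = Suc i" using j by (cases j) auto
    have "of_nat (Suc i) * ((1 - s) gchoose Suc i) = ((1 - s) gchoose i) * (1 - s - of_nat i)"
      using gbinomial_mult_1[of "1 - s" i] by (simp add: algebra_simps)
    then have "((1 - s) gchoose Suc i) = ((1 - s) gchoose i) * (1 - s - of_nat i) / of_nat (Suc i)"
      by (simp add: field_simps del: of_nat_Suc)
    then have "((1 - s) gchoose Suc i) = - (((1 - s) gchoose i) / of_nat (Suc i) * (s + of_nat i - 1))"
      by (simp add: algebra_simps add_divide_distrib diff_divide_distrib del: of_nat_Suc)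
    then show ?thesis unfolding i by (simp add: mult.assoc del: of_nat_Suc)
  qed
  then have "(\<Sum>j\<in>{2..N}. ((1 - s) gchoose j) * Z (s + of_nat (j - 1))) =
     - (\<Sum>j\<in>{2..N}. ((1 - s) gchoose (j - 1)) / of_nat j *
          ((s + of_nat (j - 1) - 1) * Z (s + of_nat (j - 1))))"
    by (simp add: sum_negf)
  with eq2 show ?thesis unfolding Z_def[symmetric] by (simp add: algebra_simps)
qed

lemma zeta_continuation_half_plane:
  "\<exists>G. G holomorphic_on {s. Re s > 1 - real m} \<and>
       (\<forall>s. Re s > 1 \<longrightarrow> G s = (s - 1) * (\<Sum>n. 1 / of_nat (Suc n) powr s))"
proof (induction m)
  case 0
  have "(\<lambda>s::complex. \<Sum>n. 1 / of_nat (Suc n) powr s) holomorphic_on {s. Re s > 1}"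
  proof (rule holomorphic_suminf_half_plane[where g = "\<lambda>_. 1"])
    show "(\<lambda>s::complex. 1 / of_nat (Suc n) powr s) holomorphic_on {s. Re s > 1}" for n
      by (intro holomorphic_intros) (auto simp del: of_nat_Suc)
    show "norm (1 / of_nat (Suc n) powr s) \<le> 1 * real (Suc n) powr (1 - 1 - Re s)" for n and s :: complex
      by (simp add: norm_divide norm_powr_real_powr powr_minus_divide del: of_nat_Suc)
  qed auto
  then show ?case
    by (intro exI[of _ "\<lambda>s. (s - 1) * (\<Sum>n. 1 / of_nat (Suc n) powr s)"])
       (auto intro!: holomorphic_intros)
next
  case (Suc m)
  then obtain G where G: "G holomorphic_on {s. Re s > 1 - real m}"
    "\<And>s. Re s > 1 \<Longrightarrow> G s = (s - 1) * (\<Sum>n. 1 / of_nat (Suc n) powr s)" by blast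
  define H where "H s = 1 - (\<Sum>j\<in>{2..Suc m}. ((1 - s) gchoose (j - 1)) / of_nat j * G (s + of_nat (j - 1)))
      + (\<Sum>n. taylor_rem (Suc m) n s)" for s
  have "(\<lambda>s. G (s + of_nat (j - 1))) holomorphic_on {s. Re s > 1 - real (Suc m)}" if "j \<in> {2..Suc m}" for j
    using that
    by (intro holomorphic_on_compose_gen[OF _ G(1), unfolded o_def] holomorphic_intros) auto
  then have "H holomorphic_on {s. Re s > 1 - real (Suc m)}"
    unfolding H_def[abs_def]
    by (intro holomorphic_intros taylor_rem_sum_holomorphic) auto
  moreover have "H s = (s - 1) * (\<Sum>n. 1 / of_nat (Suc n) powr s)" if s: "Re s > 1" for s
  proof -
    have "G (s + of_nat (j - 1)) = (s + of_nat (j - 1) - 1) *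
        (\<Sum>n. 1 / of_nat (Suc n) powr (s + of_nat (j - 1)))" for j
      using s by (intro G(2)) simp
    then show ?thesis
      unfolding H_def by (simp only: zeta_series_identity[OF s, of "Suc m", OF le_add1[of 1 m, unfolded plus_1_eq_Suc]])
  qed
  ultimately show ?case by blast
qed

theorem zeta_continuation_exists:
  "\<exists>f. f holomorphic_on - {1} \<and>
       (\<forall>s. Re s > 1 \<longrightarrow> f s = (\<Sum>n. 1 / of_nat (Suc n) powr s))"
proof -
  define D where "D m = {s::complex. Re s > 1 - real m}" for m
  from zeta_continuation_half_plane obtain F where
    F: "\<And>m. F m holomorphic_on D m"
       "\<And>m s. Re s > 1 \<Longrightarrow> F m s = (s - 1) * (\<Sum>n. 1 / of_nat (Suc n) powr s)"
    unfolding D_def by metis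
  have opD: "open (D m)" for m unfolding D_def by (rule half_plane_open)
  have agree: "F l s = F m s" if lm: "l \<le> m" "s \<in> D l" for l m s
  proof (rule analytic_continuation_open[where s = "{s. Re s > 1}" and s' = "D l" and f = "F l" and g = "F m"])
    show "open {s. Re s > 1}" "open (D l)" by (auto simp: half_plane_open opD)
    have "2 \<in> {s. Re s > 1}" by simp
    then show "{s. Re s > 1} \<noteq> {}" by blast
    show "connected (D l)" unfolding D_def
      by (intro convex_connected convex_halfspace_Re_gt[of "1 - real l"])
    show "{s. Re s > 1} \<subseteq> D l" unfolding D_def by auto
    show "F l holomorphic_on D l" by (rule F(1))
    show "F m holomorphic_on D l" using lm
      by (intro holomorphic_on_subset[OF F(1)]) (auto simp: D_def)
  qed (use F(2) lm in auto)
  define G where "G s = F (LEAST m. s \<in> D m) s" for s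
  have GF: "G s = F m s" if "s \<in> D m" for s m
    unfolding G_def
    using agree[OF Least_le[of "\<lambda>m. s \<in> D m", OF that] LeastI[of "\<lambda>m. s \<in> D m", OF that]] .
  have "G holomorphic_on D m" for m
    using F(1)[of m] GF holomorphic_cong by blast
  then have "G holomorphic_on (\<Union>m. D m)"
    using opD by (intro holomorphic_on_UN_open) auto
  moreover have "(\<Union>m. D m) = UNIV"
  proof -
    have "\<exists>m. s \<in> D m" for s
      using reals_Archimedean2[of "1 - Re s"] by (auto simp: D_def algebra_simps)
    then show ?thesis by auto
  qed
  ultimately have "G holomorphic_on UNIV" by simp
  then have "(\<lambda>s. G s / (s - 1)) holomorphic_on - {1}"
    by (intro holomorphic_intros) (auto intro: holomorphic_on_subset)
  moreover have "G s / (s - 1) = (\<Sum>n. 1 / of_nat (Suc n) powr s)" if "Re s > 1" for s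
  proof -
    have "s \<noteq> 1" using that by auto
    then show ?thesis using GF[of s 0] F(2)[of s 0] that by (simp add: D_def)
  qed
  ultimately show ?thesis by blast
qed

text \<open>
  The two conditions determine a function on the complement of 1 (by the identity theorem and the
  existence result above); the value at the pole 1 is left arbitrary.
\<close>
definition riemann_zeta :: "complex \<Rightarrow> complex" where
  "riemann_zeta = (SOME f. f holomorphic_on - {1} \<and>
     (\<forall>s. Re s > 1 \<longrightarrow> f s = (\<Sum>n. 1 / of_nat (Suc n) powr s)))"

lemma riemann_zeta_holomorphic: "riemann_zeta holomorphic_on - {1}"
  and riemann_zeta_series: "Re s > 1 \<Longrightarrow> riemann_zeta s = (\<Sum>n. 1 / of_nat (Suc n) powr s)"
  using someI_ex[OF zeta_continuation_exists] unfolding riemann_zeta_def by blast+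

definition Riemann_Hypothesis :: bool where
  "Riemann_Hypothesis \<longleftrightarrow>
     (\<forall>s. riemann_zeta s = 0 \<and> 0 < Re s \<and> Re s < 1 \<longrightarrow> Re s = 1 / 2)"

definition chebyshev_psi :: "real \<Rightarrow> real" where
  "chebyshev_psi x = (\<Sum>n | 0 < n \<and> real n \<le> x. mangoldt n)"

definition gauss_moment :: "nat \<Rightarrow> nat" where
  "gauss_moment k = (\<Prod>i = 1..k div 2. 2 * i - 1)"

definition E_const :: real where
  "E_const = 2 * pi * exp (euler_mascheroni - 1)"

end

theory Submission
  imports Defs "HOL-Real_Asymp.Real_Asymp"
begin

text \<open>
  Put \<open>R x = chebyshev_psi x - x\<close> and \<open>k = 2 p\<close>. The hypothesis concerns \<open>R (x + h) - R x\<close> along the rays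
  \<open>h = \<delta> x\<close> of the \<open>(x, h)\<close>-plane, the conclusion concerns the lines \<open>h = const\<close>. The two are linked by the
  method of Saffari and Vaughan. Average the moment over \<open>h\<close> in a short interval \<open>[H, q H]\<close> with respect
  to \<open>dh / h\<close>; in the coordinate \<open>u = x / h\<close> the resulting double integral becomes an integral over
  \<open>du / u\<close> of differences of dilation moments with \<open>\<delta> = 1 / u\<close> (\<open>log_average_shift_moment\<close>,
  \<open>sector_average_estimate\<close>), and the main terms of the hypothesis integrate exactly to a multiple of the
  integral of \<open>ln (u / E) ^ p\<close>.

  Returning from the average to the single shift \<open>H\<close> costs the increments \<open>R (x + h) - R (x + H)\<close>, whose length
  is at most \<open>(q - 1) H\<close>. Their moments are bounded by the same device: the hypothesis as an upper bound on
  rays when the shift exceeds \<open>X powr e\<close>, the trivial bound below that (\<open>remainder_bound\<close>). Convexity of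
  \<open>t ^ k\<close> takes the place of the inequality of Minkowski (\<open>shift_moment_average_compare\<close>). With \<open>q - 1\<close> a
  small negative power of \<open>X\<close> this yields the asymptotic formula over \<open>[a, X]\<close>, where
  \<open>a = 4 H X powr e\<close> (\<open>principal_range\<close>, \<open>principal_asymptotic\<close>).

  For \<open>x < a\<close> the quotient \<open>h / x\<close> is too large for the hypothesis, and an upper bound of order
  \<open>H ^ p X powr (1 - e1)\<close> is needed. A large dilation is a chain of small ones
  (\<open>dil_moment_bound_extend\<close>), which loses a factor \<open>Y powr (p e)\<close> but covers all \<open>\<delta> \<le> 1\<close>; averaging as
  before treats \<open>2 H \<le> x \<le> a\<close>. Finally, the dilation by 2 and a doubling argument bound the mean value of
  \<open>R ^ k\<close> itself (\<open>power_integral_le\<close>), which is enough for \<open>x \<le> 2 H\<close>. The upper bound on \<open>h\<close> in the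
  theorem is the condition under which these losses are affordable (\<open>initial_range\<close>).
\<close>

section \<open>Moments of increments over shifts and dilations\<close>

text \<open>
  The integrands are nonnegative for even \<open>k\<close>; with values in \<^typ>\<open>ennreal\<close> the order of
  integration can be exchanged without any integrability condition.
\<close>
definition shift_moment :: "(real \<Rightarrow> real) \<Rightarrow> nat \<Rightarrow> real \<Rightarrow> real \<Rightarrow> real \<Rightarrow> ennreal" where
  "shift_moment R k a b h = (\<integral>\<^sup>+x\<in>{a..b}. ennreal ((R (x + h) - R x) ^ k) \<partial>lborel)"

definition dil_moment :: "(real \<Rightarrow> real) \<Rightarrow> nat \<Rightarrow> real \<Rightarrow> real \<Rightarrow> ennreal" where
  "dil_moment R k Y d = (\<integral>\<^sup>+x\<in>{1..Y}. ennreal ((R (x + d * x) - R x) ^ k) \<partial>lborel)"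

text \<open>
  Both sides are the integral of \<open>g (h u) h\<close> over the quadrant \<open>h, u > 0\<close>: substitute \<open>x = h u\<close>,
  once at fixed \<open>h\<close> and once at fixed \<open>u\<close>. Along a ray \<open>x = h u\<close> the shift \<open>x + h\<close> is the dilation
  \<open>x + x / u\<close>, so this exchanges averages over fixed shifts and averages over dilations.
\<close>
lemma hyperbolic_swap:
  fixes g :: "real \<Rightarrow> real \<Rightarrow> ennreal"
  assumes [measurable]: "case_prod g \<in> borel_measurable (borel \<Otimes>\<^sub>M borel)"
  shows "(\<integral>\<^sup>+h\<in>{0<..}. ennreal (1 / h) * (\<integral>\<^sup>+x\<in>{0<..}. g x h \<partial>lborel) \<partial>lborel) =
         (\<integral>\<^sup>+u\<in>{0<..}. ennreal (1 / u) * (\<integral>\<^sup>+x\<in>{0<..}. g x (x / u) \<partial>lborel) \<partial>lborel)"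
proof -
  have 1: "ennreal (1 / h) * (\<integral>\<^sup>+x\<in>{0<..}. g x h \<partial>lborel) * indicator {0<..} h =
      (\<integral>\<^sup>+u. g (h * u) h * indicator {0<..} u * indicator {0<..} h \<partial>lborel)" for h :: real
  proof (cases "h > 0")
    case True
    have "(\<integral>\<^sup>+x\<in>{0<..}. g x h \<partial>lborel) =
        ennreal h * (\<integral>\<^sup>+u. g (h * u) h * indicator {0<..} (h * u) \<partial>lborel)"
      using True by (subst nn_integral_real_affine[where c = h and t = 0]) auto
    also have "(\<lambda>u. indicator {0<..} (h * u) :: ennreal) = indicator {0<..}"
      using True by (auto simp: indicator_def zero_less_mult_iff fun_eq_iff)
    finally show ?thesis using True
      by (simp add: ennreal_mult[symmetric] mult.assoc[symmetric])
  qed auto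
  have 2: "ennreal (1 / u) * (\<integral>\<^sup>+x\<in>{0<..}. g x (x / u) \<partial>lborel) * indicator {0<..} u =
      (\<integral>\<^sup>+h. g (h * u) h * indicator {0<..} u * indicator {0<..} h \<partial>lborel)" for u :: real
  proof (cases "u > 0")
    case True
    have "(\<integral>\<^sup>+x\<in>{0<..}. g x (x / u) \<partial>lborel) =
        ennreal u * (\<integral>\<^sup>+h. g (u * h) h * indicator {0<..} (u * h) \<partial>lborel)"
      using True by (subst nn_integral_real_affine[where c = u and t = 0]) auto
    also have "(\<lambda>h. indicator {0<..} (u * h) :: ennreal) = indicator {0<..}"
      using True by (auto simp: indicator_def zero_less_mult_iff fun_eq_iff)
    finally show ?thesis using True
      by (simp add: ennreal_mult[symmetric] mult.assoc[symmetric] mult.commute[of u])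
  qed auto
  show ?thesis unfolding 1 2
    by (rule lborel_pair.Fubini') measurable
qed

text \<open>
  The weight \<open>dh / h\<close> is scale invariant. With it the dilated integrand acquires no factor \<open>x\<close>, which
  would otherwise have to be removed by partial summation.
\<close>
lemma log_average_shift_moment:
  assumes [measurable]: "R \<in> borel_measurable borel" and pos: "0 < W1" "0 < Z1"
  shows "(\<integral>\<^sup>+h\<in>{W1..W2}. ennreal (1 / h) * shift_moment R k Z1 Z2 h \<partial>lborel) =
    (\<integral>\<^sup>+u\<in>{0<..}. ennreal (1 / u) *
       (\<integral>\<^sup>+x\<in>{max Z1 (W1 * u)..min Z2 (W2 * u)}. ennreal ((R (x + x / u) - R x) ^ k) \<partial>lborel) \<partial>lborel)"
proof -
  define g :: "real \<Rightarrow> real \<Rightarrow> ennreal" where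
    "g x h = ennreal ((R (x + h) - R x) ^ k) * indicator {Z1..Z2} x * indicator {W1..W2} h" for x h
  have [measurable]: "case_prod g \<in> borel_measurable (borel \<Otimes>\<^sub>M borel)"
    unfolding g_def by measurable
  have "(\<integral>\<^sup>+h\<in>{W1..W2}. ennreal (1 / h) * shift_moment R k Z1 Z2 h \<partial>lborel) =
      (\<integral>\<^sup>+h\<in>{0<..}. ennreal (1 / h) * (\<integral>\<^sup>+x\<in>{0<..}. g x h \<partial>lborel) \<partial>lborel)"
  proof (intro nn_integral_cong)
    fix h :: real
    have "(\<integral>\<^sup>+x\<in>{0<..}. g x h \<partial>lborel) = shift_moment R k Z1 Z2 h" if "h \<in> {W1..W2}"
      unfolding shift_moment_def g_def using pos that
      by (intro nn_integral_cong) (auto simp: indicator_def)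
    moreover have "(\<integral>\<^sup>+x\<in>{0<..}. g x h \<partial>lborel) = 0" if "h \<notin> {W1..W2}"
    proof -
      have "(\<lambda>x. g x h * indicator {0<..} x) = (\<lambda>x. 0)"
        unfolding g_def using that by (simp add: indicator_def del: atLeastAtMost_iff)
      then show ?thesis by (simp only: nn_integral_const mult_zero_left)
    qed
    ultimately show "ennreal (1 / h) * shift_moment R k Z1 Z2 h * indicator {W1..W2} h =
        ennreal (1 / h) * (\<integral>\<^sup>+x\<in>{0<..}. g x h \<partial>lborel) * indicator {0<..} h"
      using pos by (cases "h \<in> {W1..W2}") auto
  qed
  also have "\<dots> = (\<integral>\<^sup>+u\<in>{0<..}. ennreal (1 / u) * (\<integral>\<^sup>+x\<in>{0<..}. g x (x / u) \<partial>lborel) \<partial>lborel)"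
    by (rule hyperbolic_swap) measurable
  also have "\<dots> = (\<integral>\<^sup>+u\<in>{0<..}. ennreal (1 / u) *
       (\<integral>\<^sup>+x\<in>{max Z1 (W1 * u)..min Z2 (W2 * u)}. ennreal ((R (x + x / u) - R x) ^ k) \<partial>lborel) \<partial>lborel)"
  proof (intro nn_integral_cong)
    fix u :: real
    have "(\<integral>\<^sup>+x\<in>{0<..}. g x (x / u) \<partial>lborel) =
       (\<integral>\<^sup>+x\<in>{max Z1 (W1 * u)..min Z2 (W2 * u)}. ennreal ((R (x + x / u) - R x) ^ k) \<partial>lborel)" if "u > 0"
      unfolding g_def using pos that
      by (intro nn_integral_cong) (auto simp: indicator_def field_simps)
    then show "ennreal (1 / u) * (\<integral>\<^sup>+x\<in>{0<..}. g x (x / u) \<partial>lborel) * indicator {0<..} u =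
      ennreal (1 / u) *
       (\<integral>\<^sup>+x\<in>{max Z1 (W1 * u)..min Z2 (W2 * u)}. ennreal ((R (x + x / u) - R x) ^ k) \<partial>lborel) * indicator {0<..} u"
      by (cases "u > 0") auto
  qed
  finally show ?thesis .
qed

lemma nn_integral_over_identity:
  assumes "0 < a" "a \<le> b" "c \<ge> 0"
  shows "(\<integral>\<^sup>+u\<in>{a..b}. ennreal (c / u) \<partial>lborel) = ennreal (c * ln (b / a))"
proof -
  have "(\<integral>\<^sup>+u\<in>{a..b}. ennreal (c / u) \<partial>lborel) = ennreal (c * ln b - c * ln a)"
    using assms by (intro nn_integral_FTC_Icc) (auto intro!: derivative_eq_intros)
  also have "c * ln b - c * ln a = c * ln (b / a)"
    using assms by (simp add: ln_div right_diff_distrib)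
  finally show ?thesis .
qed

text \<open>
  On a ray the variable \<open>x\<close> stays below both \<open>Z2\<close> and \<open>W2 u\<close>. Spending the power \<open>p\<close> of the bound on
  \<open>W2 u\<close> and one power on \<open>Z2\<close> cancels \<open>(1 / u) ^ p\<close> exactly; only the integral of \<open>1 / u\<close> remains,
  at the cost of a logarithm.
\<close>
lemma log_average_shift_moment_le:
  assumes R: "R \<in> borel_measurable borel" and pos: "0 < W1" "W1 \<le> W2" "1 \<le> Z1" "Z1 \<le> Z2" "0 \<le> K"
    and bd: "\<And>u. Z1 / W2 \<le> u \<Longrightarrow> u \<le> Z2 / W1 \<Longrightarrow>
       dil_moment R k (min Z2 (W2 * u)) (1 / u) \<le> ennreal (K * (1 / u) ^ p * min Z2 (W2 * u) ^ (p + 1))"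
  shows "(\<integral>\<^sup>+h\<in>{W1..W2}. ennreal (1 / h) * shift_moment R k Z1 Z2 h \<partial>lborel)
     \<le> ennreal (K * W2 ^ p * Z2 * ln ((Z2 * W2) / (Z1 * W1)))"
proof -
  have "(\<integral>\<^sup>+h\<in>{W1..W2}. ennreal (1 / h) * shift_moment R k Z1 Z2 h \<partial>lborel) =
    (\<integral>\<^sup>+u\<in>{0<..}. ennreal (1 / u) *
       (\<integral>\<^sup>+x\<in>{max Z1 (W1 * u)..min Z2 (W2 * u)}. ennreal ((R (x + x / u) - R x) ^ k) \<partial>lborel) \<partial>lborel)"
    using pos by (intro log_average_shift_moment R) auto
  also have "\<dots> \<le> (\<integral>\<^sup>+u\<in>{Z1/W2..Z2/W1}. ennreal (K * W2 ^ p * Z2 / u) \<partial>lborel)"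
  proof (intro nn_integral_mono)
    fix u :: real
    let ?I = "\<integral>\<^sup>+x\<in>{max Z1 (W1 * u)..min Z2 (W2 * u)}. ennreal ((R (x + x / u) - R x) ^ k) \<partial>lborel"
    show "ennreal (1 / u) * ?I * indicator {0<..} u \<le> ennreal (K * W2 ^ p * Z2 / u) * indicator {Z1/W2..Z2/W1} u"
    proof (cases "u > 0 \<and> max Z1 (W1 * u) \<le> min Z2 (W2 * u)")
      case False
      then have "u \<le> 0 \<or> {max Z1 (W1 * u)..min Z2 (W2 * u)} = {}" by (simp add: not_less not_le)
      then have "?I = 0 \<or> u \<le> 0" by (elim disjE) simp_all
      then show ?thesis by (elim disjE) simp_all
    next
      case True
      then have u: "u > 0" "Z1 / W2 \<le> u" "u \<le> Z2 / W1" using pos by (auto simp: field_simps)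
      let ?Y = "min Z2 (W2 * u)"
      have Y: "0 \<le> ?Y" using pos u by auto
      have "?I \<le> dil_moment R k ?Y (1 / u)"
        unfolding dil_moment_def using pos
        by (intro nn_integral_mono) (auto simp: indicator_def)
      also have "\<dots> \<le> ennreal (K * (1 / u) ^ p * ?Y ^ (p + 1))" by (rule bd) (use u in auto)
      also have "\<dots> \<le> ennreal (K * (1 / u) ^ p * ((W2 * u) ^ p * Z2))"
      proof (intro ennreal_leI mult_left_mono)
        have "?Y ^ p * ?Y \<le> (W2 * u) ^ p * Z2"
          using Y pos u by (intro mult_mono power_mono) auto
        then show "?Y ^ (p + 1) \<le> (W2 * u) ^ p * Z2" by (simp only: power_add power_one_right)
      qed (use pos u in auto)
      also have "K * (1 / u) ^ p * ((W2 * u) ^ p * Z2) = K * W2 ^ p * Z2"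
        using u by (simp add: power_mult_distrib power_divide)
      finally have "ennreal (1 / u) * ?I \<le> ennreal (1 / u) * ennreal (K * W2 ^ p * Z2)"
        by (intro mult_left_mono) auto
      also have "\<dots> = ennreal (K * W2 ^ p * Z2 / u)"
        using u pos by (subst ennreal_mult[symmetric]) auto
      finally show ?thesis using u by (auto simp: indicator_def)
    qed
  qed
  also have "\<dots> = ennreal (K * W2 ^ p * Z2 * ln ((Z2 / W1) / (Z1 / W2)))"
  proof (intro nn_integral_over_identity)
    show "Z1 / W2 \<le> Z2 / W1" using pos by (intro frac_le) auto
  qed (use pos in auto)
  also have "(Z2 / W1) / (Z1 / W2) = (Z2 * W2) / (Z1 * W1)" by simp
  finally show ?thesis .
qed

section \<open>Convexity and nearby shifts\<close>

text \<open>
  Convexity of \<open>t ^ k\<close>, applied to \<open>x / (1 - l)\<close> and \<open>y / l\<close> with weights \<open>1 - l\<close> and \<open>l\<close>. This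
  replaces the inequality of Minkowski: for small \<open>l\<close> the coefficient of \<open>x ^ k\<close> is close to 1, and
  the large coefficient falls on \<open>y ^ k\<close>, which will be a small remainder.
\<close>
lemma even_power_add_le:
  fixes x y l :: real
  assumes "even k" "0 < k" "0 < l" "l < 1"
  shows "(x + y) ^ k \<le> (1 / (1 - l) ^ (k - 1)) * x ^ k + (1 / l ^ (k - 1)) * y ^ k"
proof -
  have "((1 - l) *\<^sub>R (x / (1 - l)) + l *\<^sub>R (y / l)) ^ k \<le> (1 - l) * (x / (1 - l)) ^ k + l * (y / l) ^ k"
    using convex_onD[OF convex_power_even[OF assms(1)], of l "x / (1 - l)" "y / l"] assms by auto
  moreover have "k = Suc (k - 1)" using assms by simp
  then have e: "a ^ k = a * a ^ (k - 1)" for a :: real by (metis power_Suc)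
  have "(1 - l) * (x / (1 - l)) ^ k = (1 / (1 - l) ^ (k - 1)) * x ^ k"
    unfolding power_divide e[of "1 - l"] using assms by (simp add: field_simps)
  moreover have "l * (y / l) ^ k = (1 / l ^ (k - 1)) * y ^ k"
    unfolding power_divide e[of l] using assms by (simp add: field_simps)
  ultimately show ?thesis using assms by simp
qed

lemma shift_moment_measurable [measurable]:
  assumes [measurable]: "R \<in> borel_measurable borel"
  shows "shift_moment R k a b \<in> borel_measurable borel"
  unfolding shift_moment_def by measurable

text \<open>
  The increments of \<open>R\<close> over \<open>[x, x + H]\<close> and \<open>[x, x + h]\<close> differ by the increment of length \<open>h - H\<close>
  that starts at \<open>x + H\<close>.
\<close>
lemma shift_moment_compare:
  assumes [measurable]: "R \<in> borel_measurable borel" and k: "even k" "0 < k" and l: "0 < l" "l < 1"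
  shows "shift_moment R k a b H \<le> ennreal (1 / (1 - l) ^ (k - 1)) * shift_moment R k a b h
           + ennreal (1 / l ^ (k - 1)) * shift_moment R k (a + H) (b + H) (h - H)"
    and "shift_moment R k a b h \<le> ennreal (1 / (1 - l) ^ (k - 1)) * shift_moment R k a b H
           + ennreal (1 / l ^ (k - 1)) * shift_moment R k (a + H) (b + H) (h - H)"
proof -
  have k0: "x ^ k \<ge> 0" for x :: real using k by (rule_tac zero_le_even_power)
  have e: "shift_moment R k (a + H) (b + H) (h - H) =
      (\<integral>\<^sup>+x\<in>{a..b}. ennreal ((R (x + h) - R (x + H)) ^ k) \<partial>lborel)"
    unfolding shift_moment_def
    by (subst nn_integral_real_affine[where c = 1 and t = H])
       (auto intro!: nn_integral_cong simp: indicator_def algebra_simps)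
  have *: "(\<integral>\<^sup>+x\<in>{a..b}. ennreal (f x ^ k) \<partial>lborel) \<le>
      ennreal (1 / (1 - l) ^ (k - 1)) * (\<integral>\<^sup>+x\<in>{a..b}. ennreal (g x ^ k) \<partial>lborel)
      + ennreal (1 / l ^ (k - 1)) * (\<integral>\<^sup>+x\<in>{a..b}. ennreal (d x ^ k) \<partial>lborel)"
    if [measurable]: "g \<in> borel_measurable borel" "d \<in> borel_measurable borel"
      and "\<And>x. f x ^ k = (g x + d x) ^ k \<or> f x ^ k = (g x + - d x) ^ k" for f g d :: "real \<Rightarrow> real"
  proof -
    have "(\<integral>\<^sup>+x\<in>{a..b}. ennreal (f x ^ k) \<partial>lborel) \<le>
      (\<integral>\<^sup>+x. ennreal (1 / (1 - l) ^ (k - 1)) * (ennreal (g x ^ k) * indicator {a..b} x)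
      + ennreal (1 / l ^ (k - 1)) * (ennreal (d x ^ k) * indicator {a..b} x) \<partial>lborel)"
    proof (intro nn_integral_mono)
      fix x
      have "f x ^ k \<le> (1 / (1 - l) ^ (k - 1)) * g x ^ k + (1 / l ^ (k - 1)) * d x ^ k"
        using that(3)[of x] even_power_add_le[OF k l, of "g x" "d x"] even_power_add_le[OF k l, of "g x" "- d x"] k
        by auto
      then have "ennreal (f x ^ k) \<le> ennreal (1 / (1 - l) ^ (k - 1)) * ennreal (g x ^ k)
           + ennreal (1 / l ^ (k - 1)) * ennreal (d x ^ k)"
        using l k0 by (simp add: ennreal_mult[symmetric] ennreal_plus[symmetric] ennreal_leI
                        del: ennreal_plus)
      then show "ennreal (f x ^ k) * indicator {a..b} x \<le> 
        ennreal (1 / (1 - l) ^ (k - 1)) * (ennreal (g x ^ k) * indicator {a..b} x)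
      + ennreal (1 / l ^ (k - 1)) * (ennreal (d x ^ k) * indicator {a..b} x)"
        by (auto simp: indicator_def)
    qed
    also have "\<dots> = ennreal (1 / (1 - l) ^ (k - 1)) * (\<integral>\<^sup>+x\<in>{a..b}. ennreal (g x ^ k) \<partial>lborel)
      + ennreal (1 / l ^ (k - 1)) * (\<integral>\<^sup>+x\<in>{a..b}. ennreal (d x ^ k) \<partial>lborel)"
      by (simp add: nn_integral_add nn_integral_cmult)
    finally show ?thesis .
  qed
  show "shift_moment R k a b H \<le> ennreal (1 / (1 - l) ^ (k - 1)) * shift_moment R k a b h
           + ennreal (1 / l ^ (k - 1)) * shift_moment R k (a + H) (b + H) (h - H)"
    unfolding e unfolding shift_moment_def by (rule *) (simp_all add: algebra_simps)
  show "shift_moment R k a b h \<le> ennreal (1 / (1 - l) ^ (k - 1)) * shift_moment R k a b H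
           + ennreal (1 / l ^ (k - 1)) * shift_moment R k (a + H) (b + H) (h - H)"
    unfolding e unfolding shift_moment_def by (rule *) (simp_all add: algebra_simps)
qed

text \<open>
  Averaging the comparison over \<open>H \<le> h \<le> q H\<close> with the weight \<open>dh / h\<close>. Only shifts shorter than
  \<open>(q - 1) H\<close> enter the remainder, which is therefore small when \<open>q\<close> is close to 1.
\<close>
lemma shift_moment_average_compare:
  fixes a b :: real
  assumes [measurable]: "R \<in> borel_measurable borel" and k: "even k" "0 < k" and l: "0 < l" "l < 1"
    and H: "0 < H" and q: "1 < q"
  defines "A \<equiv> (\<integral>\<^sup>+h\<in>{H..q * H}. ennreal (1 / h) * shift_moment R k a b h \<partial>lborel)"
    and "D \<equiv> (\<integral>\<^sup>+w\<in>{0..(q - 1) * H}. shift_moment R k (a + H) (b + H) w \<partial>lborel)"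
  shows "ennreal (ln q) * shift_moment R k a b H
      \<le> ennreal (1 / (1 - l) ^ (k - 1)) * A + ennreal (1 / l ^ (k - 1) / H) * D"
    and "A \<le> ennreal (1 / (1 - l) ^ (k - 1) * ln q) * shift_moment R k a b H
        + ennreal (1 / l ^ (k - 1) / H) * D"
proof -
  define c1 c2 where "c1 = ennreal (1 / (1 - l) ^ (k - 1))" and "c2 = ennreal (1 / l ^ (k - 1))"
  define B where "B = shift_moment R k a b H"
  define D' where "D' = (\<integral>\<^sup>+h\<in>{H..q * H}. ennreal (1 / h) * shift_moment R k (a + H) (b + H) (h - H) \<partial>lborel)"
  have D: "D' \<le> ennreal (1 / H) * D"
  proof -
    have "D' \<le> (\<integral>\<^sup>+h. ennreal (1 / H) * (shift_moment R k (a + H) (b + H) (h - H) * indicator {H..q * H} h) \<partial>lborel)"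
      unfolding D'_def
    proof (intro nn_integral_mono)
      fix h
      have "ennreal (1 / h) * y \<le> ennreal (1 / H) * y" if "h \<ge> H" for y
        using that H by (intro mult_right_mono ennreal_leI) (auto simp: frac_le)
      then show "ennreal (1 / h) * shift_moment R k (a + H) (b + H) (h - H) * indicator {H..q * H} h
         \<le> ennreal (1 / H) * (shift_moment R k (a + H) (b + H) (h - H) * indicator {H..q * H} h)"
        by (auto simp: indicator_def)
    qed
    also have "\<dots> = ennreal (1 / H) * (\<integral>\<^sup>+h\<in>{H..q * H}. shift_moment R k (a + H) (b + H) (h - H) \<partial>lborel)"
      by (simp add: nn_integral_cmult)
    also have "(\<integral>\<^sup>+h\<in>{H..q * H}. shift_moment R k (a + H) (b + H) (h - H) \<partial>lborel) = D"
      unfolding D_def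
      by (subst nn_integral_real_affine[where c = 1 and t = H])
         (auto intro!: nn_integral_cong simp: indicator_def algebra_simps)
    finally show ?thesis .
  qed
  have c2D: "c2 * D' \<le> ennreal (1 / l ^ (k - 1) / H) * D"
  proof -
    have "c2 * D' \<le> c2 * (ennreal (1 / H) * D)" by (intro mult_left_mono D) auto
    also have "\<dots> = ennreal (1 / l ^ (k - 1) / H) * D"
      unfolding c2_def using l H by (simp add: mult.assoc[symmetric] ennreal_mult[symmetric])
    finally show ?thesis .
  qed
  have const: "(\<integral>\<^sup>+h\<in>{H..q * H}. ennreal (1 / h) * y \<partial>lborel) = ennreal (ln q) * y" for y
  proof -
    have "(\<integral>\<^sup>+h\<in>{H..q * H}. ennreal (1 / h) * y \<partial>lborel) = (\<integral>\<^sup>+h. y * (ennreal (1 / h) * indicator {H..q * H} h) \<partial>lborel)"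
      by (intro nn_integral_cong) (simp add: ac_simps)
    also have "\<dots> = y * ennreal (1 * ln (q * H / H))"
      using H q by (subst nn_integral_cmult) (auto simp: nn_integral_over_identity)
    finally show ?thesis using H by (simp add: mult.commute)
  qed
  have comb: "(\<integral>\<^sup>+h\<in>{H..q * H}. ennreal (1 / h) * (c1 * f h + c2 * shift_moment R k (a + H) (b + H) (h - H)) \<partial>lborel)
     = c1 * (\<integral>\<^sup>+h\<in>{H..q * H}. ennreal (1 / h) * f h \<partial>lborel) + c2 * D'"
    if [measurable]: "f \<in> borel_measurable borel" for f
  proof -
    have "(\<integral>\<^sup>+h\<in>{H..q * H}. ennreal (1 / h) * (c1 * f h + c2 * shift_moment R k (a + H) (b + H) (h - H)) \<partial>lborel)
      = (\<integral>\<^sup>+h. c1 * (ennreal (1 / h) * f h * indicator {H..q * H} h) +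
          c2 * (ennreal (1 / h) * shift_moment R k (a + H) (b + H) (h - H) * indicator {H..q * H} h) \<partial>lborel)"
      by (intro nn_integral_cong) (simp add: distrib_left distrib_right ac_simps)
    also have "\<dots> = c1 * (\<integral>\<^sup>+h\<in>{H..q * H}. ennreal (1 / h) * f h \<partial>lborel) + c2 * D'"
      unfolding D'_def by (simp add: nn_integral_add nn_integral_cmult)
    finally show ?thesis .
  qed
  have "ennreal (ln q) * B = (\<integral>\<^sup>+h\<in>{H..q * H}. ennreal (1 / h) * B \<partial>lborel)" by (simp add: const)
  also have "\<dots> \<le> (\<integral>\<^sup>+h\<in>{H..q * H}. ennreal (1 / h) * (c1 * shift_moment R k a b h
      + c2 * shift_moment R k (a + H) (b + H) (h - H)) \<partial>lborel)"
    unfolding B_def c1_def c2_def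
    by (intro nn_integral_mono mult_right_mono mult_left_mono shift_moment_compare k l assms(1)) auto
  also have "\<dots> = c1 * A + c2 * D'" unfolding A_def by (rule comb) measurable
  also have "\<dots> \<le> c1 * A + ennreal (1 / l ^ (k - 1) / H) * D" by (intro add_left_mono c2D)
  finally show "ennreal (ln q) * shift_moment R k a b H
      \<le> ennreal (1 / (1 - l) ^ (k - 1)) * A + ennreal (1 / l ^ (k - 1) / H) * D"
    unfolding B_def c1_def .
  have "A \<le> (\<integral>\<^sup>+h\<in>{H..q * H}. ennreal (1 / h) * (c1 * B
      + c2 * shift_moment R k (a + H) (b + H) (h - H)) \<partial>lborel)"
    unfolding A_def B_def c1_def c2_def
    by (intro nn_integral_mono mult_right_mono mult_left_mono shift_moment_compare k l assms(1)) auto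
  also have "\<dots> = c1 * (ennreal (ln q) * B) + c2 * D'" by (subst comb) (auto simp: const)
  also have "\<dots> \<le> c1 * (ennreal (ln q) * B) + ennreal (1 / l ^ (k - 1) / H) * D" by (intro add_left_mono c2D)
  also have "c1 * (ennreal (ln q) * B) = ennreal (1 / (1 - l) ^ (k - 1) * ln q) * B"
    unfolding c1_def using l q by (simp add: mult.assoc[symmetric] ennreal_mult[symmetric])
  finally show "A \<le> ennreal (1 / (1 - l) ^ (k - 1) * ln q) * shift_moment R k a b H
        + ennreal (1 / l ^ (k - 1) / H) * D"
    unfolding B_def .
qed

section \<open>Chaining dilations\<close>

lemma ennreal_linear_combination:
  assumes "0 \<le> a" "0 \<le> x" "0 \<le> b" "0 \<le> y"
  shows "ennreal (a * x + b * y) = ennreal a * ennreal x + ennreal b * ennreal y"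
  using assms by (simp add: ennreal_mult)

lemma even_power_sum_le:
  fixes f :: "nat \<Rightarrow> real"
  assumes "even k" "0 < k"
  shows "(\<Sum>j<J. f j) ^ k \<le> real J ^ (k - 1) * (\<Sum>j<J. f j ^ k)"
proof (cases "J = 0")
  case True then show ?thesis using assms by (simp add: power_0_left)
next
  case False
  have "(\<Sum>j<J. (1 / real J) *\<^sub>R f j) ^ k \<le> (\<Sum>j<J. (1 / real J) * f j ^ k)"
    using False convex_on_sum[OF _ _ convex_power_even[OF assms(1)], of "{..<J}" "\<lambda>_. 1 / real J" f]
    by auto
  then have "(\<Sum>j<J. f j) ^ k / real J ^ k \<le> (\<Sum>j<J. f j ^ k) / real J"
    by (simp add: sum_divide_distrib[symmetric] power_divide)
  moreover have "k = Suc (k - 1)" using assms by simp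
  then have "real J ^ k = real J * real J ^ (k - 1)" by (metis power_Suc)
  ultimately show ?thesis using False by (simp add: field_simps)
qed

text \<open>
  The dilation by \<open>1 + d\<close> is the composition of \<open>J\<close> dilations by \<open>1 + d'\<close>. The increment telescopes
  into \<open>J\<close> increments, and each is brought back to the standard form by a change of variables whose
  Jacobian is at least 1 and hence harmless for an upper bound.
\<close>
lemma dil_moment_chain:
  assumes [measurable]: "R \<in> borel_measurable borel" and k: "even k" "0 < k"
    and d: "0 \<le> d'" "(1 + d') ^ J = 1 + d"
  shows "dil_moment R k Y d \<le> ennreal (real J ^ k) * dil_moment R k ((1 + d) * Y) d'"
proof (cases "J = 0")
  case True
  then have "d = 0" using d by simp
  then show ?thesis using k by (simp add: dil_moment_def power_0_left)
next
  case False
  define t where "t j = (1 + d') ^ j" for j :: nat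
  have t: "1 \<le> t j" "t j \<le> 1 + d" if "j \<le> J" for j
    using d that power_increasing[of j J "1 + d'"] by (auto simp: t_def one_le_power)
  define F where "F x = ennreal ((R (x + d' * x) - R x) ^ k)" for x
  have [measurable]: "F \<in> borel_measurable borel" unfolding F_def by measurable
  have k0: "x ^ k \<ge> 0" for x :: real using k by (rule_tac zero_le_even_power)
  have pt: "ennreal ((R (x + d * x) - R x) ^ k) \<le> (\<Sum>j<J. ennreal (real J ^ (k - 1)) * F (t j * x))" for x
  proof -
    have "R (x + d * x) - R x = (\<Sum>j<J. R (t (Suc j) * x) - R (t j * x))"
      by (subst sum_lessThan_telescope) (simp add: t_def d algebra_simps)
    also have "\<dots> ^ k \<le> real J ^ (k - 1) * (\<Sum>j<J. (R (t (Suc j) * x) - R (t j * x)) ^ k)"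
      by (rule even_power_sum_le[OF k])
    also have "\<dots> = (\<Sum>j<J. real J ^ (k - 1) * (R (t j * x + d' * (t j * x)) - R (t j * x)) ^ k)"
      by (simp add: sum_distrib_left t_def algebra_simps)
    finally have "ennreal ((R (x + d * x) - R x) ^ k) \<le>
       ennreal (\<Sum>j<J. real J ^ (k - 1) * (R (t j * x + d' * (t j * x)) - R (t j * x)) ^ k)"
      by (rule ennreal_leI)
    also have "\<dots> = (\<Sum>j<J. ennreal (real J ^ (k - 1)) * F (t j * x))"
      unfolding F_def by (subst sum_ennreal[symmetric]) (auto simp: k0 ennreal_mult)
    finally show ?thesis .
  qed
  have piece: "(\<integral>\<^sup>+x\<in>{1..Y}. F (t j * x) \<partial>lborel) \<le> dil_moment R k ((1 + d) * Y) d'" if j: "j < J" for j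
  proof -
    have tj: "1 \<le> t j" "t j \<le> 1 + d" using t[of j] j by auto
    have "(\<integral>\<^sup>+x\<in>{1..Y}. F (t j * x) \<partial>lborel) \<le>
        (\<integral>\<^sup>+x. F (t j * x) * indicator {1..(1 + d) * Y} (t j * x) \<partial>lborel)"
    proof (intro nn_integral_mono)
      fix x
      have "1 \<le> t j * x \<and> t j * x \<le> (1 + d) * Y" if "x \<in> {1..Y}"
      proof
        show "1 \<le> t j * x" using tj that mult_mono[of 1 "t j" 1 x] by auto
        show "t j * x \<le> (1 + d) * Y" using tj that by (intro mult_mono) auto
      qed
      then show "F (t j * x) * indicator {1..Y} x \<le> F (t j * x) * indicator {1..(1 + d) * Y} (t j * x)"
        by (auto simp: indicator_def)
    qed
    also have "\<dots> = 1 * \<dots>" by simp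
    also have "\<dots> \<le> ennreal (t j) * (\<integral>\<^sup>+x. F (t j * x) * indicator {1..(1 + d) * Y} (t j * x) \<partial>lborel)"
      using tj by (intro mult_right_mono) auto
    also have "\<dots> = dil_moment R k ((1 + d) * Y) d'"
      unfolding dil_moment_def F_def[symmetric] using tj
      by (subst (2) nn_integral_real_affine[where c = "t j" and t = 0]) auto
    finally show ?thesis .
  qed
  have "dil_moment R k Y d \<le> (\<integral>\<^sup>+x. (\<Sum>j<J. ennreal (real J ^ (k - 1)) * (F (t j * x) * indicator {1..Y} x)) \<partial>lborel)"
    unfolding dil_moment_def
  proof (intro nn_integral_mono)
    fix x :: real
    show "ennreal ((R (x + d * x) - R x) ^ k) * indicator {1..Y} x
       \<le> (\<Sum>j<J. ennreal (real J ^ (k - 1)) * (F (t j * x) * indicator {1..Y} x))"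
      using pt[of x] by (auto simp: indicator_def)
  qed
  also have "\<dots> = (\<Sum>j<J. ennreal (real J ^ (k - 1)) * (\<integral>\<^sup>+x\<in>{1..Y}. F (t j * x) \<partial>lborel))"
    by (simp add: nn_integral_sum nn_integral_cmult)
  also have "\<dots> \<le> (\<Sum>j<J. ennreal (real J ^ (k - 1)) * dil_moment R k ((1 + d) * Y) d')"
    by (intro sum_mono mult_left_mono piece) auto
  also have "\<dots> = ennreal (real J * real J ^ (k - 1)) * dil_moment R k ((1 + d) * Y) d'"
    by (simp add: ennreal_mult mult.assoc ennreal_of_nat_eq_real_of_nat)
  also have "real J * real J ^ (k - 1) = real J ^ k"
    using k by (metis Suc_diff_1 power_Suc)
  finally show ?thesis .
qed

text \<open>
  Dilations with \<open>d > Y powr (-e)\<close> lie outside the range of the hypothesis. They are chained from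
  about \<open>2 d Y powr e\<close> small dilations, which lie just inside; the price is the factor
  \<open>Y powr (p e)\<close>.
\<close>
lemma dil_moment_bound_extend:
  assumes R: "R \<in> borel_measurable borel" and p: "0 < p"
    and e: "0 < e" "e \<le> 1 / 4" and s: "0 \<le> s" "s \<le> 1" and K: "0 \<le> K" and Y0: "36 \<le> Y0"
    and bd: "\<And>Y d. Y0 \<le> Y \<Longrightarrow> Y powr (-1 + e) \<le> d \<Longrightarrow> d \<le> Y powr (-e) \<Longrightarrow>
        dil_moment R (2 * p) Y d \<le> ennreal (K * d ^ p * Y ^ (p + 1) * Y powr s)"
    and Y: "Y0 \<le> Y" and d: "Y powr (-1 + e) \<le> d" "d \<le> 1"
  shows "dil_moment R (2 * p) Y d
     \<le> ennreal (K * 9 ^ p * 2 ^ (p + 2) * d ^ p * Y ^ (p + 1) * Y powr (real p * e + s))"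
proof (cases "d \<le> Y powr (-e)")
  case True
  have Y1: "1 \<le> Y" using Y Y0 by simp
  have d0: "0 \<le> d" using d(1) powr_ge_zero[of Y "-1 + e"] by linarith
  have "dil_moment R (2 * p) Y d \<le> ennreal (K * d ^ p * Y ^ (p + 1) * Y powr s)"
    using bd Y d True by blast
  also have "\<dots> \<le> ennreal (K * 9 ^ p * 2 ^ (p + 2) * d ^ p * Y ^ (p + 1) * Y powr (real p * e + s))"
  proof (intro ennreal_leI mult_mono)
    have "K * 1 \<le> K * (9 ^ p * 2 ^ (p + 2))"
      using K by (intro mult_left_mono mult_ge1_I one_le_power) auto
    then show "K \<le> K * 9 ^ p * 2 ^ (p + 2)" by (simp add: mult.assoc)
    show "Y powr s \<le> Y powr (real p * e + s)" using Y1 e by (intro powr_mono) auto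
  qed (use K Y1 d0 in auto)
  finally show ?thesis .
next
  case False
  have Y1: "36 \<le> Y" using Y Y0 by simp
  define L where "L = Y powr e"
  have L: "L > 0" "Y powr (-e) = 1 / L" using Y1 by (auto simp: L_def powr_minus_divide)
  have dL: "1 / L < d" using False L by simp
  then have d0: "d > 0" using L(1) by (meson less_trans zero_less_divide_1_iff)
  have dL1: "1 < d * L" using dL L(1) by (simp add: field_simps)
  \<comment> \<open>The factor 2 leaves room for the larger endpoint \<open>(1 + d) Y\<close>, at most \<open>2 Y\<close>, at which the bound for
    the small dilation \<open>d'\<close> is used.\<close>
  define J where "J = nat \<lceil>2 * d * L\<rceil>"
  have Jlo: "2 * d * L \<le> real J" unfolding J_def by linarith
  have Jhi: "real J \<le> 3 * d * L" unfolding J_def using dL1 by linarith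
  have J0: "real J > 0" using Jlo dL1 by linarith
  define d' where "d' = (1 + d) powr (1 / real J) - 1"
  have d'0: "0 \<le> d'" unfolding d'_def using d0 J0 by (simp add: ge_one_powr_ge_zero)
  have d'J: "(1 + d') ^ J = 1 + d"
    using d0 J0 unfolding d'_def by (simp add: powr_realpow[symmetric] powr_powr)
  have "d' \<le> d / real J"
  proof -
    have "(1 + d') ^ J \<le> (1 + d / real J) ^ J"
      using Bernoulli_inequality[of "d / real J" J] d'J d0 J0
      by (simp add: order_trans[of _ 0])
    then have "1 + d' \<le> 1 + d / real J"
      using d0 J0 power_mono_iff[of "1 + d'" "1 + d / real J" J] d'0 by simp
    then show ?thesis by simp
  qed
  also have "\<dots> \<le> d / (2 * d * L)" using Jlo d0 L(1) J0 by (intro divide_left_mono mult_pos_pos) auto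
  finally have d'hi: "d' \<le> 1 / (2 * L)" using d0 by simp
  have "1 / (6 * L) = (d / 2) / (3 * d * L)" using d0 by simp
  also have "\<dots> \<le> (d / 2) / real J" using Jhi d0 J0 L(1) by (intro divide_left_mono) auto
  also have "\<dots> \<le> ln (1 + d) / real J"
  proof (intro divide_right_mono)
    have "ln (1 / (1 + d)) \<le> 1 / (1 + d) - 1" using d0 by (intro ln_le_minus_one) auto
    moreover have "1 / (1 + d) - 1 = - (d / (1 + d))" using d0 by (simp add: field_simps)
    moreover have "d / 2 \<le> d / (1 + d)" using d0 d(2) by (intro divide_left_mono) auto
    moreover have "ln (1 / (1 + d)) = - ln (1 + d)" using d0 by (simp add: ln_div)
    ultimately show "d / 2 \<le> ln (1 + d)" by linarith
  qed auto
  also have "\<dots> \<le> exp (ln (1 + d) / real J) - 1"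
    using exp_ge_add_one_self[of "ln (1 + d) / real J"] by linarith
  also have "\<dots> = d'" using d0 unfolding d'_def by (simp add: powr_def)
  finally have d'lo: "1 / (6 * L) \<le> d'" .
  define Z where "Z = (1 + d) * Y"
  have Z: "Y \<le> Z" "Z \<le> 2 * Y" using d0 d(2) Y1 by (auto simp: Z_def)
  have b1: "Z powr (-1 + e) \<le> d'"
  proof -
    have "Z powr (-1 + e) \<le> Y powr (-1 + e)" using Z Y1 e by (intro powr_mono2') auto
    also have "\<dots> \<le> 1 / (6 * L)"
    proof -
      have "6 = (36::real) powr (1/2)" by (simp add: powr_half_sqrt)
      also have "\<dots> \<le> Y powr (1 / 2)" using Y1 by (intro powr_mono2) auto
      also have "\<dots> \<le> Y powr (1 - 2 * e)" using Y1 e by (intro powr_mono) auto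
      finally have "6 * (L * Y powr (-1 + e)) \<le> Y powr (1 - 2 * e) * (L * Y powr (-1 + e))"
        using L by (intro mult_right_mono) auto
      also have "\<dots> = 1" using Y1 unfolding L_def by (simp add: powr_add[symmetric])
      finally show ?thesis using L by (simp add: field_simps)
    qed
    finally show ?thesis using d'lo by simp
  qed
  have b2: "d' \<le> Z powr (-e)"
  proof -
    have "1 / (2 * L) = (1 / 2) * Y powr (-e)" using L by simp
    also have "\<dots> = 2 powr (-1) * Y powr (-e)" by (simp add: powr_minus)
    also have "\<dots> \<le> 2 powr (-e) * Y powr (-e)" using e by (intro mult_right_mono powr_mono) auto
    also have "\<dots> = (2 * Y) powr (-e)" using Y1 by (simp add: powr_mult)
    also have "\<dots> \<le> Z powr (-e)" using Z Y1 e by (intro powr_mono2') auto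
    finally show ?thesis using d'hi by simp
  qed
  have "dil_moment R (2 * p) Y d \<le> ennreal (real J ^ (2 * p)) * dil_moment R (2 * p) Z d'"
    unfolding Z_def using p by (intro dil_moment_chain R d'0 d'J) auto
  also have "\<dots> \<le> ennreal (real J ^ (2 * p)) * ennreal (K * d' ^ p * Z ^ (p + 1) * Z powr s)"
    using Z Y by (intro mult_left_mono bd b1 b2) auto
  also have "\<dots> = ennreal (real J ^ (2 * p) * (K * d' ^ p * Z ^ (p + 1) * Z powr s))"
    using K d'0 Z Y1 by (intro ennreal_mult[symmetric]) auto
  also have "\<dots> \<le> ennreal ((3 * d * L) ^ (2 * p) * (K * (1 / L) ^ p * (2 * Y) ^ (p + 1) * (2 * Y powr s)))"
  proof (intro ennreal_leI mult_mono power_mono Jhi)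
    show "d' \<le> 1 / L" using d'hi L(1) by (intro order_trans[OF d'hi]) (simp add: field_simps)
    have "Z powr s \<le> (2 * Y) powr s" using Z Y1 s by (intro powr_mono2) auto
    also have "\<dots> = 2 powr s * Y powr s" using Y1 by (simp add: powr_mult)
    also have "\<dots> \<le> 2 powr 1 * Y powr s" using s by (intro mult_right_mono powr_mono) auto
    finally show "Z powr s \<le> 2 * Y powr s" by simp
  qed (use K d'0 Z Y1 d0 L in auto)
  also have "(3 * d * L) ^ (2 * p) * (K * (1 / L) ^ p * (2 * Y) ^ (p + 1) * (2 * Y powr s)) =
     K * 9 ^ p * 2 ^ (p + 2) * (d ^ p * d ^ p) * Y ^ (p + 1) * (L ^ p * Y powr s)"
    using L(1) by (simp add: power_mult_distrib power_mult power_divide power2_eq_square)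
  also have "L ^ p * Y powr s = Y powr (real p * e + s)"
    unfolding L_def using Y1 by (simp add: powr_power powr_add mult.commute)
  also have "ennreal (K * 9 ^ p * 2 ^ (p + 2) * (d ^ p * d ^ p) * Y ^ (p + 1) * Y powr (real p * e + s))
     \<le> ennreal (K * 9 ^ p * 2 ^ (p + 2) * d ^ p * Y ^ (p + 1) * Y powr (real p * e + s))"
  proof (intro ennreal_leI mult_right_mono mult_left_mono)
    show "d ^ p * d ^ p \<le> d ^ p" using d0 d(2) by (simp add: mult_left_le power_le_one)
  qed (use K Y1 in auto)
  finally show ?thesis .
qed

section \<open>Upper bounds for functions of moderate growth\<close>

text \<open>
  The growth condition is the trivial bound for the increments of \<open>psi x - x\<close>, coming from
  \<open>mangoldt n \<le> ln n\<close>. It serves for shifts that are too short for any information on dilations.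
\<close>
locale log_growth =
  fixes R :: "real \<Rightarrow> real"
  assumes measurable_R [measurable]: "R \<in> borel_measurable borel"
    and growth: "\<And>x w. 1 \<le> x \<Longrightarrow> 0 \<le> w \<Longrightarrow> \<bar>R (x + w) - R x\<bar> \<le> (w + 1) * (1 + ln (x + w))"
begin

lemma shift_moment_trivial:
  assumes "even k" "1 \<le> Z1" "Z1 \<le> Z2" "0 \<le> w" "w \<le> V"
  shows "shift_moment R k Z1 Z2 w \<le> ennreal (Z2 * ((V + 1) * (1 + ln (Z2 + V))) ^ k)"
proof -
  let ?c = "((V + 1) * (1 + ln (Z2 + V))) ^ k"
  have "shift_moment R k Z1 Z2 w \<le> (\<integral>\<^sup>+x. ennreal ?c * indicator {Z1..Z2} x \<partial>lborel)"
    unfolding shift_moment_def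
  proof (intro nn_integral_mono)
    fix x
    have "ennreal ((R (x + w) - R x) ^ k) \<le> ennreal ?c" if x: "x \<in> {Z1..Z2}"
    proof (intro ennreal_leI)
      have "\<bar>R (x + w) - R x\<bar> \<le> (w + 1) * (1 + ln (x + w))" using x assms by (intro growth) auto
      also have "\<dots> \<le> (V + 1) * (1 + ln (Z2 + V))"
        using x assms by (intro mult_mono add_left_mono ln_mono) auto
      finally have "\<bar>R (x + w) - R x\<bar> ^ k \<le> ?c" by (intro power_mono) auto
      then show "(R (x + w) - R x) ^ k \<le> ?c" using assms by (simp add: power_even_abs)
    qed
    then show "ennreal ((R (x + w) - R x) ^ k) * indicator {Z1..Z2} x \<le> ennreal ?c * indicator {Z1..Z2} x"
      by (auto simp: indicator_def)
  qed
  also have "\<dots> = ennreal ?c * ennreal (Z2 - Z1)" using assms by (simp add: nn_integral_cmult_indicator)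
  also have "\<dots> \<le> ennreal ?c * ennreal Z2" using assms by (intro mult_left_mono ennreal_leI) auto
  also have "\<dots> = ennreal (Z2 * ?c)" using assms by (subst ennreal_mult[symmetric]) (auto simp: mult.commute)
  finally show ?thesis .
qed

text \<open>
  Shifts below \<open>V\<close> are estimated trivially; for the others the weight \<open>1\<close> is replaced by the larger
  weight \<open>W / w\<close> so that the logarithmic average applies.
\<close>
lemma shift_moment_integral_le:
  assumes k: "even k" and V: "1 \<le> V" "V \<le> W" and Z: "W \<le> Z1" "Z1 \<le> Z2" and K: "0 \<le> K"
    and bd: "\<And>u. Z1 / W \<le> u \<Longrightarrow> u \<le> Z2 / V \<Longrightarrow>
       dil_moment R k (min Z2 (W * u)) (1 / u) \<le> ennreal (K * (1 / u) ^ p * min Z2 (W * u) ^ (p + 1))"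
  shows "(\<integral>\<^sup>+w\<in>{0..W}. shift_moment R k Z1 Z2 w \<partial>lborel) \<le>
    ennreal (V * (Z2 * ((V + 1) * (1 + ln (Z2 + V))) ^ k) + W * (K * W ^ p * Z2 * ln Z2))"
proof -
  let ?c = "Z2 * ((V + 1) * (1 + ln (Z2 + V))) ^ k"
  have c0: "?c \<ge> 0" using k V Z by (intro mult_nonneg_nonneg zero_le_even_power) auto
  have "(\<integral>\<^sup>+w\<in>{0..W}. shift_moment R k Z1 Z2 w \<partial>lborel) \<le>
     (\<integral>\<^sup>+w. ennreal ?c * indicator {0..V} w + ennreal W * (ennreal (1 / w) * shift_moment R k Z1 Z2 w * indicator {V..W} w) \<partial>lborel)"
  proof (intro nn_integral_mono)
    fix w
    consider "w \<in> {0..V}" | "w \<in> {V<..W}" | "w \<notin> {0..W}" using V by force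
    then show "shift_moment R k Z1 Z2 w * indicator {0..W} w \<le> ennreal ?c * indicator {0..V} w
       + ennreal W * (ennreal (1 / w) * shift_moment R k Z1 Z2 w * indicator {V..W} w)"
    proof cases
      case 1
      then have "shift_moment R k Z1 Z2 w \<le> ennreal ?c" using V Z by (intro shift_moment_trivial k) auto
      then show ?thesis using 1 V by (auto simp: indicator_def intro: add_increasing2)
    next
      case 2
      have "shift_moment R k Z1 Z2 w * 1 \<le> shift_moment R k Z1 Z2 w * ennreal (W * (1 / w))"
        using 2 V by (intro mult_left_mono) (auto simp: ennreal_1[symmetric] simp del: ennreal_1 intro!: ennreal_leI)
      also have "ennreal (W * (1 / w)) = ennreal W * ennreal (1 / w)"
        using 2 V by (intro ennreal_mult) auto
      finally show ?thesis using 2 V by (auto simp: indicator_def ac_simps)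
    qed auto
  qed
  also have "\<dots> = ennreal ?c * ennreal V + ennreal W * (\<integral>\<^sup>+w\<in>{V..W}. ennreal (1 / w) * shift_moment R k Z1 Z2 w \<partial>lborel)"
    using V by (simp add: nn_integral_add nn_integral_cmult)
  also have "\<dots> \<le> ennreal ?c * ennreal V + ennreal W * ennreal (K * W ^ p * Z2 * ln ((Z2 * W) / (Z1 * V)))"
    using V Z K by (intro add_left_mono mult_left_mono log_average_shift_moment_le bd) auto
  also have "\<dots> \<le> ennreal ?c * ennreal V + ennreal W * ennreal (K * W ^ p * Z2 * ln Z2)"
  proof (intro add_left_mono mult_left_mono ennreal_leI ln_mono)
    have "Z2 * W \<le> Z2 * (Z1 * V)" using V Z mult_mono[of W Z1 1 V] by (intro mult_left_mono) auto
    then show "Z2 * W / (Z1 * V) \<le> Z2" using V Z by (simp add: field_simps)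
  qed (use V Z K in auto)
  also have "\<dots> = ennreal (V * ?c + W * (K * W ^ p * Z2 * ln Z2))"
    using V Z K c0 by (simp add: ennreal_mult[symmetric] ennreal_plus[symmetric] mult.commute del: ennreal_plus)
  finally show ?thesis .
qed

lemma power_integral_finite:
  assumes "even k"
  shows "(\<integral>\<^sup>+x\<in>{1..Y}. ennreal (R x ^ k) \<partial>lborel) < \<infinity>"
proof -
  let ?c = "(\<bar>R 1\<bar> + Y * (1 + ln Y)) ^ k"
  have "(\<integral>\<^sup>+x\<in>{1..Y}. ennreal (R x ^ k) \<partial>lborel) \<le> (\<integral>\<^sup>+x. ennreal ?c * indicator {1..Y} x \<partial>lborel)"
  proof (intro nn_integral_mono)
    fix x
    have "ennreal (R x ^ k) \<le> ennreal ?c" if x: "x \<in> {1..Y}"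
    proof (intro ennreal_leI)
      have "\<bar>R (1 + (x - 1)) - R 1\<bar> \<le> ((x - 1) + 1) * (1 + ln (1 + (x - 1)))"
        using x by (intro growth) auto
      also have "\<dots> \<le> Y * (1 + ln Y)" using x by (intro mult_mono) auto
      finally have "\<bar>R x\<bar> \<le> \<bar>R 1\<bar> + Y * (1 + ln Y)" by simp
      then have "\<bar>R x\<bar> ^ k \<le> ?c" by (intro power_mono) auto
      then show "R x ^ k \<le> ?c" using assms by (simp add: power_even_abs)
    qed
    then show "ennreal (R x ^ k) * indicator {1..Y} x \<le> ennreal ?c * indicator {1..Y} x"
      by (auto simp: indicator_def)
  qed
  also have "\<dots> < \<infinity>" by (cases "1 \<le> Y") (simp_all add: nn_integral_cmult_indicator ennreal_mult_less_top)
  finally show ?thesis .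
qed

text \<open>
  Write \<open>R (2 x) = R x + (R (2 x) - R x)\<close>; the second term is a dilation by the factor 2. Passing from
  \<open>Y\<close> to \<open>2 Y\<close> multiplies the integral of \<open>R ^ k\<close> by at most \<open>2 * (3 / 2) = 3\<close>, where the 2 is the
  Jacobian and \<open>3 / 2\<close> the coefficient from convexity with \<open>l = 1 / (3 k)\<close>, while the claimed bound
  grows by \<open>2 powr \<alpha> \<ge> 4\<close>. Hence the estimate propagates by doubling.
\<close>
lemma power_integral_le:
  assumes k: "even k" "0 < k" and \<alpha>: "2 \<le> \<alpha>" and K: "0 \<le> K"
    and bd: "\<And>Y. Y0 \<le> Y \<Longrightarrow> dil_moment R k Y 1 \<le> ennreal (K * Y powr \<alpha>)"
  obtains C where "0 \<le> C" "\<And>Y. 1 \<le> Y \<Longrightarrow> (\<integral>\<^sup>+x\<in>{1..Y}. ennreal (R x ^ k) \<partial>lborel) \<le> ennreal (C * Y powr \<alpha>)"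
proof -
  define N where "N Y = (\<integral>\<^sup>+x\<in>{1..Y}. ennreal (R x ^ k) \<partial>lborel)" for Y
  define l where "l = 1 / (3 * real k)"
  have l: "0 < l" "l < 1" using k by (auto simp: l_def field_simps)
  define c where "c = 1 / l ^ (k - 1)"
  have c0: "0 \<le> c" using l by (simp add: c_def)
  have l32: "1 / (1 - l) ^ (k - 1) \<le> 3 / 2"
  proof -
    have "2 / 3 \<le> 1 + real (k - 1) * (- l)" using k by (simp add: l_def field_simps)
    also have "\<dots> \<le> (1 + (- l)) ^ (k - 1)" using l by (intro Bernoulli_inequality) auto
    finally have "2 / 3 \<le> (1 - l) ^ (k - 1)" by simp
    then show ?thesis by (simp add: field_simps)
  qed
  have Nmono: "N Y \<le> N Y'" if "Y \<le> Y'" for Y Y'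
    unfolding N_def using that by (intro nn_integral_mono) (auto simp: indicator_def)
  \<comment> \<open>The induction starts from \<open>2 * Y1\<close>, not \<open>Y1\<close>, so that halving never leaves the range \<open>y \<ge> Y1\<close>
    where the hypothesis applies.\<close>
  define Y1 where "Y1 = max 2 Y0"
  obtain n1 where n1: "N (2 * Y1) = ennreal n1" "0 \<le> n1"
    using power_integral_finite[OF k(1), of "2 * Y1"] unfolding N_def
    by (cases "N (2 * Y1)") (auto simp: N_def)
  define C where "C = n1 + 2 * c * K"
  have C0: "0 \<le> C" using n1 c0 K by (simp add: C_def)
  have double: "N (2 * Y) \<le> N (2 * Y1) + (ennreal 3 * N Y + ennreal (2 * c * K * Y powr \<alpha>))" if Y: "Y1 \<le> Y" for Y
  proof -
    have "N (2 * Y) \<le> (\<integral>\<^sup>+x. ennreal (R x ^ k) * indicator {1..2} x + ennreal (R x ^ k) * indicator {2..2 * Y} x \<partial>lborel)"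
      unfolding N_def by (intro nn_integral_mono) (auto simp: indicator_def)
    also have "\<dots> = N 2 + (\<integral>\<^sup>+x\<in>{2..2 * Y}. ennreal (R x ^ k) \<partial>lborel)"
      unfolding N_def by (simp add: nn_integral_add)
    also have "(\<integral>\<^sup>+x\<in>{2..2 * Y}. ennreal (R x ^ k) \<partial>lborel) = 2 * (\<integral>\<^sup>+x\<in>{1..Y}. ennreal (R (2 * x) ^ k) \<partial>lborel)"
    proof -
      have "(\<lambda>x. ennreal (R (0 + 2 * x) ^ k) * indicator {2..2 * Y} (0 + 2 * x)) =
          (\<lambda>x. ennreal (R (2 * x) ^ k) * indicator {1..Y} x)"
        by (auto simp: indicator_def fun_eq_iff)
      then show ?thesis
        using nn_integral_real_affine[of "\<lambda>x. ennreal (R x ^ k) * indicator {2..2 * Y} x" 2 0] by simp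
    qed
    also have "(\<integral>\<^sup>+x\<in>{1..Y}. ennreal (R (2 * x) ^ k) \<partial>lborel) \<le>
       (\<integral>\<^sup>+x. ennreal (3 / 2) * (ennreal (R x ^ k) * indicator {1..Y} x) +
         ennreal c * (ennreal ((R (x + 1 * x) - R x) ^ k) * indicator {1..Y} x) \<partial>lborel)"
    proof (intro nn_integral_mono)
      fix x
      have k0: "y ^ k \<ge> 0" for y :: real using k by (rule_tac zero_le_even_power)
      have "R (2 * x) ^ k = (R x + (R (x + 1 * x) - R x)) ^ k" by simp
      also have "\<dots> \<le> (1 / (1 - l) ^ (k - 1)) * R x ^ k + c * (R (x + 1 * x) - R x) ^ k"
        unfolding c_def by (rule even_power_add_le[OF k l])
      also have "\<dots> \<le> 3 / 2 * R x ^ k + c * (R (x + 1 * x) - R x) ^ k"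
        by (intro add_right_mono mult_right_mono l32 k0)
      finally have "ennreal (R (2 * x) ^ k) \<le> ennreal (3 / 2 * R x ^ k + c * (R (x + 1 * x) - R x) ^ k)"
        by (rule ennreal_leI)
      also have "\<dots> = ennreal (3 / 2) * ennreal (R x ^ k) + ennreal c * ennreal ((R (x + 1 * x) - R x) ^ k)"
        using k0 c0 by (intro ennreal_linear_combination) auto
      finally show "ennreal (R (2 * x) ^ k) * indicator {1..Y} x \<le> ennreal (3 / 2) * (ennreal (R x ^ k) * indicator {1..Y} x) +
         ennreal c * (ennreal ((R (x + 1 * x) - R x) ^ k) * indicator {1..Y} x)"
        by (auto simp: indicator_def)
    qed
    also have "\<dots> = ennreal (3 / 2) * N Y + ennreal c * dil_moment R k Y 1"
      unfolding N_def dil_moment_def by (simp add: nn_integral_add nn_integral_cmult)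
    also have "\<dots> \<le> ennreal (3 / 2) * N Y + ennreal c * ennreal (K * Y powr \<alpha>)"
      using Y by (intro add_left_mono mult_left_mono bd) (auto simp: Y1_def)
    also have "2 * (ennreal (3 / 2) * N Y + ennreal c * ennreal (K * Y powr \<alpha>)) =
        (ennreal 2 * ennreal (3 / 2)) * N Y + ennreal 2 * (ennreal c * ennreal (K * Y powr \<alpha>))"
      by (simp only: distrib_left mult.assoc ennreal_numeral)
    also have "ennreal 2 * ennreal (3 / 2) = ennreal 3"
      by (subst ennreal_mult[symmetric]) auto
    also have "ennreal 2 * (ennreal c * ennreal (K * Y powr \<alpha>)) = ennreal (2 * c * K * Y powr \<alpha>)"
      using c0 K by (simp add: ennreal_mult mult.assoc)
    finally have "N (2 * Y) \<le> N 2 + (ennreal 3 * N Y + ennreal (2 * c * K * Y powr \<alpha>))"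
      by (simp add: add_left_mono mult_left_mono)
    also have "\<dots> \<le> N (2 * Y1) + (ennreal 3 * N Y + ennreal (2 * c * K * Y powr \<alpha>))"
      by (intro add_right_mono Nmono) (simp add: Y1_def)
    finally show ?thesis .
  qed
  have main: "N Y \<le> ennreal (C * Y powr \<alpha>)" if "1 \<le> Y" "Y \<le> 2 ^ n * (2 * Y1)" for Y n
    using that
  proof (induction n arbitrary: Y)
    case 0
    then have "N Y \<le> ennreal n1" using Nmono n1 by (metis mult_1 power_0)
    also have "n1 * 1 \<le> C * Y powr \<alpha>"
      using n1 c0 K 0 \<alpha> unfolding C_def by (intro mult_mono) (auto simp: ge_one_powr_ge_zero)
    then have "ennreal n1 \<le> ennreal (C * Y powr \<alpha>)" by (simp add: ennreal_leI)
    finally show ?case .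
  next
    case (Suc n)
    show ?case
    proof (cases "Y \<le> 2 ^ n * (2 * Y1)")
      case True then show ?thesis using Suc by blast
    next
      case False
      define y where "y = Y / 2"
      have Y1: "Y1 \<ge> 2" by (simp add: Y1_def)
      have "1 * (2 * Y1) \<le> 2 ^ n * (2 * Y1)" using Y1 by (intro mult_right_mono) auto
      then have "Y1 \<le> y" using False by (simp add: y_def)
      show ?thesis
      proof -
        have y1: "1 \<le> y" using \<open>Y1 \<le> y\<close> Y1 by simp
        have IH: "N y \<le> ennreal (C * y powr \<alpha>)"
          using Suc.IH[of y] Suc.prems y1 by (simp add: y_def)
        have "N Y = N (2 * y)" by (simp add: y_def)
        also have "\<dots> \<le> N (2 * Y1) + (ennreal 3 * N y + ennreal (2 * c * K * y powr \<alpha>))" by (rule double) fact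
        also have "\<dots> \<le> ennreal n1 + (ennreal 3 * ennreal (C * y powr \<alpha>) + ennreal (2 * c * K * y powr \<alpha>))"
          using IH n1 by (intro add_mono mult_left_mono) auto
        also have "\<dots> = ennreal (n1 + (3 * (C * y powr \<alpha>) + 2 * c * K * y powr \<alpha>))"
          using n1 C0 c0 K by (simp add: ennreal_mult)
        also have "\<dots> \<le> ennreal (C * Y powr \<alpha>)"
        proof (intro ennreal_leI)
          have "1 \<le> y powr \<alpha>" using y1 \<alpha> by (simp add: ge_one_powr_ge_zero)
          then have "n1 * 1 \<le> n1 * y powr \<alpha>" using n1 by (intro mult_left_mono)
          then have "n1 + (3 * (C * y powr \<alpha>) + 2 * c * K * y powr \<alpha>) \<le> C * (4 * y powr \<alpha>)"
            by (simp add: C_def algebra_simps)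
          also have "\<dots> \<le> C * (2 powr \<alpha> * y powr \<alpha>)"
            using C0 \<alpha> powr_mono[of 2 \<alpha> 2] by (intro mult_left_mono mult_right_mono) auto
          also have "2 powr \<alpha> * y powr \<alpha> = Y powr \<alpha>" using y1 by (subst powr_mult[symmetric]) (auto simp: y_def)
          finally show "n1 + (3 * (C * y powr \<alpha>) + 2 * c * K * y powr \<alpha>) \<le> C * Y powr \<alpha>" .
        qed
        finally show ?thesis .
      qed
    qed
  qed
  have "N Y \<le> ennreal (C * Y powr \<alpha>)" if "1 \<le> Y" for Y
  proof -
    obtain n where "Y < 2 ^ n" using real_arch_pow[of 2 Y] by auto
    moreover have "(2::real) ^ n * 1 \<le> 2 ^ n * (2 * Y1)" by (intro mult_left_mono) (auto simp: Y1_def)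
    ultimately have "Y \<le> 2 ^ n * (2 * Y1)" by linarith
    then show ?thesis using main that by blast
  qed
  then show ?thesis using C0 that unfolding N_def by blast
qed

text \<open>
  For \<open>x\<close> up to \<open>2 H\<close> the shift is at least of the order of \<open>x\<close>, and nothing is gained from the
  difference: the two values of \<open>R\<close> are estimated separately.
\<close>
lemma shift_moment_initial_le:
  assumes k: "even k" "0 < k" and H: "1 \<le> H" and C: "0 \<le> C" and \<alpha>: "0 \<le> \<alpha>"
    and bd: "\<And>Y. 1 \<le> Y \<Longrightarrow> (\<integral>\<^sup>+x\<in>{1..Y}. ennreal (R x ^ k) \<partial>lborel) \<le> ennreal (C * Y powr \<alpha>)"
  shows "shift_moment R k 1 (2 * H) H \<le> ennreal (2 ^ k * C * (3 * H) powr \<alpha>)"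
proof -
  define N where "N Y = (\<integral>\<^sup>+x\<in>{1..Y}. ennreal (R x ^ k) \<partial>lborel)" for Y
  define c where "c = (2::real) ^ (k - 1)"
  have c: "c \<ge> 0" "2 * c = 2 ^ k" using k by (cases k; simp add: c_def)+
  have k0: "y ^ k \<ge> 0" for y :: real using k by (rule_tac zero_le_even_power)
  have "shift_moment R k 1 (2 * H) H \<le>
     (\<integral>\<^sup>+x. ennreal c * (ennreal (R (H + 1 * x) ^ k) * indicator {1..3 * H} (H + 1 * x)) +
        ennreal c * (ennreal (R x ^ k) * indicator {1..3 * H} x) \<partial>lborel)"
    unfolding shift_moment_def
  proof (intro nn_integral_mono)
    fix x
    have "(R (x + H) - R x) ^ k = (R (H + 1 * x) + - R x) ^ k" by (simp add: add.commute)
    also have "\<dots> \<le> c * R (H + 1 * x) ^ k + c * (- R x) ^ k"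
      using even_power_add_le[OF k, of "1/2" "R (H + 1 * x)" "- R x"] by (simp add: c_def power_divide)
    also have "(- R x) ^ k = R x ^ k" using k by simp
    finally have "ennreal ((R (x + H) - R x) ^ k) \<le> ennreal (c * R (H + 1 * x) ^ k + c * R x ^ k)"
      by (rule ennreal_leI)
    also have "\<dots> = ennreal c * ennreal (R (H + 1 * x) ^ k) + ennreal c * ennreal (R x ^ k)"
      using k0 c(1) by (intro ennreal_linear_combination) auto
    finally show "ennreal ((R (x + H) - R x) ^ k) * indicator {1..2 * H} x \<le>
      ennreal c * (ennreal (R (H + 1 * x) ^ k) * indicator {1..3 * H} (H + 1 * x)) +
        ennreal c * (ennreal (R x ^ k) * indicator {1..3 * H} x)"
      using H by (auto simp: indicator_def)
  qed
  also have "\<dots> = ennreal c * (\<integral>\<^sup>+x. ennreal (R (H + 1 * x) ^ k) * indicator {1..3 * H} (H + 1 * x) \<partial>lborel)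
       + ennreal c * N (3 * H)"
    unfolding N_def by (simp add: nn_integral_add nn_integral_cmult)
  also have "(\<integral>\<^sup>+x. ennreal (R (H + 1 * x) ^ k) * indicator {1..3 * H} (H + 1 * x) \<partial>lborel) = N (3 * H)"
    unfolding N_def by (subst (2) nn_integral_real_affine[where c = 1 and t = H]) auto
  also have "ennreal c * N (3 * H) + ennreal c * N (3 * H) \<le>
     ennreal c * ennreal (C * (3 * H) powr \<alpha>) + ennreal c * ennreal (C * (3 * H) powr \<alpha>)"
    unfolding N_def using H by (intro add_mono mult_left_mono bd) auto
  also have "\<dots> = ennreal (2 ^ k * C * (3 * H) powr \<alpha>)"
    using c C by (simp add: ennreal_mult[symmetric] ennreal_plus[symmetric] c(2)[symmetric] del: ennreal_plus)
  finally show ?thesis .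
qed

end

lemma set_nn_integral_eq_integral:
  fixes G :: "real \<Rightarrow> real"
  assumes [measurable]: "G \<in> borel_measurable borel" "A \<in> sets borel" and nn: "\<And>x. 0 \<le> G x"
    and fin: "(\<integral>\<^sup>+x\<in>A. ennreal (G x) \<partial>lborel) < \<infinity>"
  shows "(\<integral>\<^sup>+x\<in>A. ennreal (G x) \<partial>lborel) = ennreal (integral A G)"
proof -
  obtain r where r: "(\<integral>\<^sup>+x\<in>A. ennreal (G x) \<partial>lborel) = ennreal r" "0 \<le> r"
    using fin by (cases "\<integral>\<^sup>+x\<in>A. ennreal (G x) \<partial>lborel") auto
  have "(\<integral>\<^sup>+x. ennreal (G x * indicator A x) \<partial>lborel) = ennreal r"
    unfolding r(1)[symmetric] by (intro nn_integral_cong) (auto simp: indicator_def)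
  then have "((\<lambda>x. G x * indicator A x) has_integral r) UNIV"
    using nn r(2) by (intro nn_integral_has_integral) auto
  also have "(\<lambda>x. G x * indicator A x) = (\<lambda>x. if x \<in> A then G x else 0)"
    by (auto simp: indicator_def)
  finally have "(G has_integral r) A" by (simp only: has_integral_restrict_UNIV)
  then show ?thesis using r by (simp add: integral_unique)
qed

lemma powr_minus_one_add:
  fixes y :: real
  shows "0 < y \<Longrightarrow> y powr (-1 + e) = y powr e / y"
  by (simp add: powr_diff)

lemma shift_moment_mono:
  assumes "a' \<le> a" "b \<le> b'"
  shows "shift_moment R k a b h \<le> shift_moment R k a' b' h"
  unfolding shift_moment_def using assms by (intro nn_integral_mono) (auto simp: indicator_def)

context log_growth
begin

lemma shift_moment_eq_integral:
  assumes k: "even k" and X: "1 \<le> a" "0 \<le> h"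
  shows "shift_moment R k a b h = ennreal (integral {a..b} (\<lambda>x. (R (x + h) - R x) ^ k))"
proof (cases "a \<le> b")
  case True
  have "shift_moment R k a b h < \<infinity>"
    using shift_moment_trivial[OF k X(1) True X(2) order_refl] by (rule order.strict_trans1) simp
  then show ?thesis unfolding shift_moment_def using k
    by (intro set_nn_integral_eq_integral) (auto intro: zero_le_even_power)
qed (simp add: shift_moment_def)

lemma dil_moment_eq_integral:
  assumes k: "even k" and d: "0 \<le> d"
  shows "dil_moment R k Y d = ennreal (integral {1..Y} (\<lambda>x. (R (x + d * x) - R x) ^ k))"
proof -
  let ?c = "((d * Y + 1) * (1 + ln (Y + d * Y))) ^ k"
  have "dil_moment R k Y d \<le> (\<integral>\<^sup>+x. ennreal ?c * indicator {1..Y} x \<partial>lborel)"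
    unfolding dil_moment_def
  proof (intro nn_integral_mono)
    fix x
    have "ennreal ((R (x + d * x) - R x) ^ k) \<le> ennreal ?c" if x: "x \<in> {1..Y}"
    proof (intro ennreal_leI)
      have dx: "d * x \<le> d * Y" using x d by (intro mult_left_mono) auto
      have d0: "0 \<le> d * x" using x d by simp
      have "\<bar>R (x + d * x) - R x\<bar> \<le> (d * x + 1) * (1 + ln (x + d * x))" using x d0 by (intro growth) auto
      also have "\<dots> \<le> (d * Y + 1) * (1 + ln (Y + d * Y))"
        using x dx d0 by (intro mult_mono add_left_mono ln_mono) auto
      finally have "\<bar>R (x + d * x) - R x\<bar> ^ k \<le> ?c" by (intro power_mono) auto
      then show "(R (x + d * x) - R x) ^ k \<le> ?c" using k by (simp add: power_even_abs)
    qed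
    then show "ennreal ((R (x + d * x) - R x) ^ k) * indicator {1..Y} x \<le> ennreal ?c * indicator {1..Y} x"
      by (auto simp: indicator_def)
  qed
  also have "\<dots> < \<infinity>"
    by (cases "1 \<le> Y") (simp_all add: nn_integral_cmult_indicator ennreal_mult_less_top)
  finally show ?thesis unfolding dil_moment_def using k
    by (intro set_nn_integral_eq_integral) (auto intro: zero_le_even_power)
qed

text \<open>
  The cut \<open>V = Z2 powr e\<close> is the length at which a shift near \<open>Z2\<close> becomes an admissible dilation.
  Since \<open>V\<^sup>2 \<le> W\<close>, the trivial bound below the cut has the same order \<open>W ^ (p + 1) * Z2\<close> as the
  contribution above it.
\<close>
lemma remainder_bound:
  assumes e: "0 < e" "e < 1" and W: "1 \<le> Z2" "Z2 powr (2 * e) \<le> W" "W \<le> Z1" "Z1 \<le> Z2" and K: "0 \<le> K"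
    and bd: "\<And>Y d. Z1 \<le> Y \<Longrightarrow> Y \<le> Z2 \<Longrightarrow> Y powr (-1 + e) \<le> d \<Longrightarrow> d \<le> W / Z1 \<Longrightarrow>
       dil_moment R (2 * p) Y d \<le> ennreal (K * d ^ p * Y ^ (p + 1))"
  shows "(\<integral>\<^sup>+w\<in>{0..W}. shift_moment R (2 * p) Z1 Z2 w \<partial>lborel) \<le>
    ennreal (W ^ (p + 1) * Z2 * (4 ^ p * (1 + ln (2 * Z2)) ^ (2 * p) + K * ln Z2))"
proof -
  define V where "V = Z2 powr e"
  have V1: "1 \<le> V" unfolding V_def using W e by (simp add: ge_one_powr_ge_zero)
  have V2: "V ^ 2 \<le> W" using W unfolding V_def by (simp add: powr_power mult.commute)
  have "V * 1 \<le> V * V" using V1 by (intro mult_left_mono) auto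
  then have VW: "V \<le> W" using V2 by (simp add: power2_eq_square)
  have VZ: "V \<le> Z2" using VW W by linarith
  have "(\<integral>\<^sup>+w\<in>{0..W}. shift_moment R (2 * p) Z1 Z2 w \<partial>lborel) \<le>
    ennreal (V * (Z2 * ((V + 1) * (1 + ln (Z2 + V))) ^ (2 * p)) + W * (K * W ^ p * Z2 * ln Z2))"
  proof (intro shift_moment_integral_le)
    fix u assume u: "Z1 / W \<le> u" "u \<le> Z2 / V"
    have W0: "W > 0" "Z1 > 0" using V1 VW W by auto
    have u0: "u > 0" using u W0 by (meson divide_pos_pos less_le_trans)
    let ?Y = "min Z2 (W * u)"
    have Y: "Z1 \<le> ?Y" "?Y \<le> Z2" using u W W0 by (auto simp: field_simps)
    show "dil_moment R (2 * p) ?Y (1 / u) \<le> ennreal (K * (1 / u) ^ p * ?Y ^ (p + 1))"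
    proof (rule bd[OF Y])
      have "u * V \<le> ?Y"
        using u V1 VW u0 mult_right_mono[OF VW, of u] by (auto simp: field_simps)
      moreover have "?Y powr e \<le> V" unfolding V_def using Y W0 e by (intro powr_mono2) auto
      ultimately have "u * ?Y powr e \<le> ?Y" using u0 mult_left_mono[of "?Y powr e" V u] by linarith
      then have "?Y powr e / ?Y \<le> 1 / u" using u0 W0 Y by (simp add: field_simps)
      then show "?Y powr (-1 + e) \<le> 1 / u" using Y W0 powr_minus_one_add[of ?Y e] by simp
      show "1 / u \<le> W / Z1" using u u0 W0 by (simp add: field_simps)
    qed
  qed (use V1 VW W K in auto)
  also have "\<dots> \<le> ennreal (W ^ (p + 1) * Z2 * (4 ^ p * (1 + ln (2 * Z2)) ^ (2 * p) + K * ln Z2))"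
  proof (intro ennreal_leI)
    have "((V + 1) * (1 + ln (Z2 + V))) ^ (2 * p) \<le> ((2 * V) * (1 + ln (2 * Z2))) ^ (2 * p)"
      using V1 VZ by (intro power_mono mult_mono add_left_mono ln_mono) auto
    also have "\<dots> = (V ^ 2) ^ p * (4 ^ p * (1 + ln (2 * Z2)) ^ (2 * p))"
      by (simp add: power_mult_distrib power_mult)
    also have "\<dots> \<le> W ^ p * (4 ^ p * (1 + ln (2 * Z2)) ^ (2 * p))"
      using V2 W by (intro mult_right_mono power_mono) auto
    finally have "V * (Z2 * ((V + 1) * (1 + ln (Z2 + V))) ^ (2 * p)) \<le> W * (Z2 * (W ^ p * (4 ^ p * (1 + ln (2 * Z2)) ^ (2 * p))))"
      using V1 VW VZ W by (intro mult_mono) auto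
    then show "V * (Z2 * ((V + 1) * (1 + ln (Z2 + V))) ^ (2 * p)) + W * (K * W ^ p * Z2 * ln Z2)
      \<le> W ^ (p + 1) * Z2 * (4 ^ p * (1 + ln (2 * Z2)) ^ (2 * p) + K * ln Z2)"
      by (simp add: algebra_simps)
  qed
  finally show ?thesis .
qed

text \<open>
  In this range only the order of magnitude matters, so the average is taken over the whole of
  \<open>[H, 2 H]\<close> and the comparison is made with \<open>l = 1 / 2\<close>.
\<close>
lemma shift_moment_middle:
  assumes p: "0 < p" and e: "0 < e" "e < 1" and H: "1 \<le> H" "(2 * a) powr (2 * e) \<le> H" "2 * H \<le> a" and K: "0 \<le> K"
    and bd: "\<And>Y d. 2 * H \<le> Y \<Longrightarrow> Y \<le> 2 * a \<Longrightarrow> Y powr (-1 + e) \<le> d \<Longrightarrow> d \<le> 1 \<Longrightarrow>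
       dil_moment R (2 * p) Y d \<le> ennreal (K * d ^ p * Y ^ (p + 1))"
  shows "shift_moment R (2 * p) (2 * H) a H \<le>
    ennreal (4 ^ p * (2 ^ p + 2) * H ^ p * a * (4 ^ p * (1 + ln (4 * a)) ^ (2 * p) + K * ln (2 * a)))"
proof -
  define B where "B = 4 ^ p * (1 + ln (4 * a)) ^ (2 * p) + K * ln (2 * a)"
  define A where "A = (\<integral>\<^sup>+h\<in>{H..2 * H}. ennreal (1 / h) * shift_moment R (2 * p) (2 * H) a h \<partial>lborel)"
  define D where "D = (\<integral>\<^sup>+w\<in>{0..(2 - 1) * H}. shift_moment R (2 * p) (2 * H + H) (a + H) w \<partial>lborel)"
  have a1: "a \<ge> 2" using H by linarith
  have B0: "0 \<le> B" using a1 K unfolding B_def by (intro add_nonneg_nonneg mult_nonneg_nonneg) auto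
  have KB: "K * ln (2 * a) \<le> B" using a1 unfolding B_def by simp
  have A: "A \<le> ennreal (K * (2 * H) ^ p * a * ln ((a * (2 * H)) / (2 * H * H)))"
    unfolding A_def
  proof (intro log_average_shift_moment_le measurable_R)
    fix u assume u: "2 * H / (2 * H) \<le> u" "u \<le> a / H"
    let ?Y = "min a (2 * H * u)"
    have u1: "1 \<le> u" using u H by simp
    have Y: "2 * H \<le> ?Y" "?Y \<le> 2 * a" using u1 H by auto
    have "u * H \<le> ?Y" using u u1 H by (auto simp: field_simps)
    moreover have "?Y powr e \<le> H"
    proof -
      have "?Y powr e \<le> (2 * a) powr e" using Y H e by (intro powr_mono2) auto
      also have "\<dots> \<le> (2 * a) powr (2 * e)" using a1 e by (intro powr_mono) auto
      finally show ?thesis using H by simp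
    qed
    ultimately have "u * ?Y powr e \<le> ?Y" using u1 mult_left_mono[of "?Y powr e" H u] by linarith
    then have *: "?Y powr e / ?Y \<le> 1 / u" using u1 Y H by (simp add: field_simps)
    have "dil_moment R (2 * p) ?Y (1 / u) \<le> ennreal (K * (1 / u) ^ p * ?Y ^ (p + 1))"
    proof (rule bd[OF Y])
      show "?Y powr (-1 + e) \<le> 1 / u" using * Y H powr_minus_one_add[of ?Y e] by simp
    qed (use u1 in auto)
    then show "dil_moment R (2 * p) ?Y (1 / u) \<le> ennreal (K * (1 / u) ^ p * ?Y ^ (p + 1))" .
  qed (use H K in auto)
  also have "\<dots> \<le> ennreal (2 ^ p * H ^ p * a * B)"
  proof (intro ennreal_leI)
    have "ln ((a * (2 * H)) / (2 * H * H)) \<le> ln (2 * a)"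
    proof (intro ln_mono)
      have "a * 1 \<le> a * (2 * H)" using a1 H by (intro mult_left_mono) auto
      then show "(a * (2 * H)) / (2 * H * H) \<le> 2 * a" using H by (simp add: field_simps)
    qed (use H a1 in auto)
    then have "K * ln ((a * (2 * H)) / (2 * H * H)) \<le> B" using KB K mult_left_mono by (meson order_trans)
    then have "(2 * H) ^ p * a * (K * ln ((a * (2 * H)) / (2 * H * H))) \<le> (2 * H) ^ p * a * B"
      using H a1 by (intro mult_left_mono) auto
    then show "K * (2 * H) ^ p * a * ln ((a * (2 * H)) / (2 * H * H)) \<le> 2 ^ p * H ^ p * a * B"
      by (simp add: power_mult_distrib ac_simps)
  qed
  finally have A: "A \<le> ennreal (2 ^ p * H ^ p * a * B)" .
  have "D \<le> (\<integral>\<^sup>+w\<in>{0..H}. shift_moment R (2 * p) (2 * H) (2 * a) w \<partial>lborel)"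
    unfolding D_def using H
    by (intro nn_integral_mono mult_mono shift_moment_mono) (auto simp: indicator_def)
  also have "\<dots> \<le> ennreal (H ^ (p + 1) * (2 * a) * (4 ^ p * (1 + ln (2 * (2 * a))) ^ (2 * p) + K * ln (2 * a)))"
  proof (rule remainder_bound[OF e])
    fix Y d assume "2 * H \<le> Y" "Y \<le> 2 * a" "Y powr (-1 + e) \<le> d" "d \<le> H / (2 * H)"
    then show "dil_moment R (2 * p) Y d \<le> ennreal (K * d ^ p * Y ^ (p + 1))"
      using H by (intro bd) auto
  qed (use H a1 K in auto)
  also have "\<dots> = ennreal (H ^ (p + 1) * (2 * a) * B)" by (simp add: B_def)
  finally have D: "D \<le> ennreal (H ^ (p + 1) * (2 * a) * B)" .
  define s where "s = integral {2 * H..a} (\<lambda>x. (R (x + H) - R x) ^ (2 * p))"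
  have s: "shift_moment R (2 * p) (2 * H) a H = ennreal s"
    unfolding s_def using H by (intro shift_moment_eq_integral) auto
  have s0: "0 \<le> s" unfolding s_def by (cases "(\<lambda>x. (R (x + H) - R x) ^ (2 * p)) integrable_on {2 * H..a}")
      (auto intro!: integral_nonneg simp: not_integrable_integral)
  have "ennreal (ln 2) * ennreal s \<le> ennreal (1 / (1 - 1 / 2) ^ (2 * p - 1)) * A + ennreal (1 / (1 / 2) ^ (2 * p - 1) / H) * D"
    unfolding s[symmetric] A_def D_def using H p by (intro shift_moment_average_compare measurable_R) auto
  also have "\<dots> \<le> ennreal (2 ^ (2 * p - 1)) * ennreal (2 ^ p * H ^ p * a * B) 
     + ennreal (2 ^ (2 * p - 1) / H) * ennreal (H ^ (p + 1) * (2 * a) * B)"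
    by (intro add_mono mult_mono A D) (auto simp: power_divide)
  also have "\<dots> = ennreal (2 ^ (2 * p - 1) * (2 ^ p * H ^ p * a * B) + 2 ^ (2 * p - 1) / H * (H ^ (p + 1) * (2 * a) * B))"
    using H a1 B0 by (intro ennreal_linear_combination[symmetric]) auto
  finally have "ennreal (ln 2 * s) \<le> ennreal (2 ^ (2 * p - 1) * (2 ^ p * H ^ p * a * B) + 2 ^ (2 * p - 1) / H * (H ^ (p + 1) * (2 * a) * B))"
    using s0 by (subst ennreal_mult) auto
  then have "ln 2 * s \<le> 2 ^ (2 * p - 1) * (2 ^ p * H ^ p * a * B) + 2 ^ (2 * p - 1) / H * (H ^ (p + 1) * (2 * a) * B)"
    by (rule ennreal_le_iff[THEN iffD1, rotated]) (use H a1 B0 in auto)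
  also have "\<dots> = (2 ^ (2 * p - 1)) * ((2 ^ p + 2) * H ^ p * a * B)"
    using H by (simp add: algebra_simps)
  finally have "ln 2 * s \<le> (2 ^ (2 * p - 1)) * ((2 ^ p + 2) * H ^ p * a * B)" .
  moreover have "(1 / 2) * s \<le> ln 2 * s" using s0 ln2_ge_two_thirds by (intro mult_right_mono) auto
  ultimately have "s \<le> 2 * 2 ^ (2 * p - 1) * ((2 ^ p + 2) * H ^ p * a * B)" by simp
  also have "2 * 2 ^ (2 * p - 1) = (2::real) ^ (2 * p)" using p by (metis One_nat_def Suc_pred mult_pos_pos pos2 power_Suc)
  also have "\<dots> = 4 ^ p" by (simp add: power_mult)
  finally show ?thesis unfolding s B_def by (intro ennreal_leI) (simp add: ac_simps)
qed

end

section \<open>Averages over sectors\<close>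

text \<open>
  The logarithmic average of the shift moments over the sector \<open>H \<le> h \<le> q H\<close>, \<open>u0 \<le> x / h \<le> u1\<close> of
  the \<open>(x, h)\<close>-plane, written in the coordinates \<open>(x, u)\<close>. On a sector the range of \<open>x\<close> at fixed \<open>u\<close>
  is a full interval \<open>[H u, q H u]\<close>, so the inner integral is a difference of two dilation moments.
\<close>
definition sector_average :: "(real \<Rightarrow> real) \<Rightarrow> nat \<Rightarrow> real \<Rightarrow> real \<Rightarrow> real \<Rightarrow> real \<Rightarrow> ennreal" where
  "sector_average R k H q u0 u1 = (\<integral>\<^sup>+u\<in>{u0..u1}. ennreal (1 / u) *
     (\<integral>\<^sup>+x\<in>{H * u..q * H * u}. ennreal ((R (x + x / u) - R x) ^ k) \<partial>lborel) \<partial>lborel)"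

text \<open>
  The rectangle \<open>a \<le> x \<le> X\<close>, \<open>H \<le> h \<le> q H\<close> lies between two sectors that differ only by factors
  \<open>q\<close> in the bounds for \<open>u\<close>. This and the next lemma are the two inclusions.
\<close>
lemma log_average_le_sector_average:
  assumes R: "R \<in> borel_measurable borel" and pos: "0 < H" "0 < a" "1 \<le> q"
  shows "(\<integral>\<^sup>+h\<in>{H..q * H}. ennreal (1 / h) * shift_moment R k a X h \<partial>lborel)
    \<le> sector_average R k H q (a / (q * H)) (X / H)"
  unfolding sector_average_def log_average_shift_moment[OF R pos(1,2)]
proof (intro nn_integral_mono)
  fix u
  let ?S = "{max a (H * u)..min X (q * H * u)}"
  let ?f = "\<lambda>x. ennreal ((R (x + x / u) - R x) ^ k)"
  show "ennreal (1 / u) * (\<integral>\<^sup>+x\<in>?S. ?f x \<partial>lborel) * indicator {0<..} u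
    \<le> ennreal (1 / u) * (\<integral>\<^sup>+x\<in>{H * u..q * H * u}. ?f x \<partial>lborel) * indicator {a / (q * H)..X / H} u"
  proof (cases "0 < u \<and> max a (H * u) \<le> min X (q * H * u)")
    case False
    then have "u \<le> 0 \<or> ?S = {}" by (simp add: not_less not_le)
    then show ?thesis by (elim disjE) simp_all
  next
    case True
    then have "u \<in> {a / (q * H)..X / H}" using pos by (simp add: field_simps)
    moreover have "(\<integral>\<^sup>+x\<in>?S. ?f x \<partial>lborel) \<le> (\<integral>\<^sup>+x\<in>{H * u..q * H * u}. ?f x \<partial>lborel)"
      by (intro nn_integral_mono) (auto simp: indicator_def)
    ultimately show ?thesis by (auto simp: indicator_def intro: mult_left_mono)
  qed
qed

lemma sector_average_le_log_average:
  assumes R: "R \<in> borel_measurable borel" and pos: "0 < H" "0 < a" "1 \<le> q"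
  shows "sector_average R k H q (a / H) (X / (q * H))
    \<le> (\<integral>\<^sup>+h\<in>{H..q * H}. ennreal (1 / h) * shift_moment R k a X h \<partial>lborel)"
  unfolding sector_average_def log_average_shift_moment[OF R pos(1,2)]
proof (intro nn_integral_mono)
  fix u
  let ?S = "{max a (H * u)..min X (q * H * u)}"
  let ?f = "\<lambda>x. ennreal ((R (x + x / u) - R x) ^ k)"
  show "ennreal (1 / u) * (\<integral>\<^sup>+x\<in>{H * u..q * H * u}. ?f x \<partial>lborel) * indicator {a / H..X / (q * H)} u
    \<le> ennreal (1 / u) * (\<integral>\<^sup>+x\<in>?S. ?f x \<partial>lborel) * indicator {0<..} u"
  proof (cases "u \<in> {a / H..X / (q * H)}")
    case True
    then have "a \<le> H * u" "q * H * u \<le> X" using pos by (auto simp: field_simps)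
    moreover have "0 < a / H" using pos by simp
    then have "0 < u" using True by (simp only: atLeastAtMost_iff) linarith
    ultimately show ?thesis using True by (simp add: max_absorb2 min_absorb2)
  qed simp
qed

context log_growth
begin

text \<open>
  With \<open>Y = r H u\<close> the main term \<open>c Y ^ (p + 1) (1 / u) ^ p ln (u / E) ^ p\<close> equals
  \<open>c r ^ (p + 1) H ^ (p + 1) u ln (u / E) ^ p\<close>. Taking the difference for \<open>r = q\<close> and \<open>r = 1\<close> and
  dividing by \<open>u\<close> leaves a constant multiple of \<open>ln (u / E) ^ p\<close>, the integrand of the final main
  term. The two inequalities are stated separately because subtraction truncates in
  \<^typ>\<open>ennreal\<close>.
\<close>
lemma sector_average_estimate:
  assumes k: "even k" and u: "1 \<le> H * u0" "0 < H" "E \<le> u0" "u0 \<le> u1" and E: "0 < E" and q: "1 \<le> q" 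
    and c: "0 \<le> c" "0 \<le> B"
    and asy: "\<And>u Y. u0 \<le> u \<Longrightarrow> u \<le> u1 \<Longrightarrow> Y = H * u \<or> Y = q * H * u \<Longrightarrow>
      \<bar>integral {1..Y} (\<lambda>x. (R (x + 1 / u * x) - R x) ^ k) - c * Y ^ (p + 1) * (1 / u) ^ p * ln (u / E) ^ p\<bar>
        \<le> B * (1 / u) ^ p * Y ^ p"
  defines "m \<equiv> c * (q ^ (p + 1) - 1) * H ^ (p + 1) * integral {u0..u1} (\<lambda>u. ln (u / E) ^ p)"
    and "F \<equiv> 2 * B * (q * H) ^ p * ln (u1 / u0)"
  shows "sector_average R k H q u0 u1 \<le> ennreal (m + F)"
    and "ennreal m \<le> sector_average R k H q u0 u1 + ennreal F"
proof -
  define P where "P Y u = integral {1..Y} (\<lambda>x. (R (x + 1 / u * x) - R x) ^ k)" for Y u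
  define sec where "sec u = (\<integral>\<^sup>+x\<in>{H * u..q * H * u}. ennreal ((R (x + x / u) - R x) ^ k) \<partial>lborel)" for u
  define \<kappa> where "\<kappa> = c * (q ^ (p + 1) - 1) * H ^ (p + 1)"
  define F' where "F' = 2 * B * (q * H) ^ p"
  have u0: "0 < u0" using u E by linarith
  have \<kappa>0: "0 \<le> \<kappa>" unfolding \<kappa>_def using c u one_le_power[OF q, of "p + 1"] by (intro mult_nonneg_nonneg) auto
  have F'0: "0 \<le> F'" unfolding F'_def using c q u by (intro mult_nonneg_nonneg) auto
  have P0: "0 \<le> P Y u" for Y u
    unfolding P_def using k
    by (cases "(\<lambda>x. (R (x + 1 / u * x) - R x) ^ k) integrable_on {1..Y}")
       (auto intro!: integral_nonneg zero_le_even_power simp: not_integrable_integral)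
  have sec: "sec u = ennreal (P (q * H * u) u - P (H * u) u)" if uu: "u0 \<le> u" for u
  proof -
    have up: "0 < u" using u0 uu by linarith
    have "H * u0 \<le> H * u" using u uu by (intro mult_left_mono) auto
    then have Hu: "1 \<le> H * u" using u by linarith
    have qHu: "H * u \<le> q * H * u" using q u up by (simp add: mult_right_mono mult_le_cancel_right1)
    have "dil_moment R k (q * H * u) (1 / u) = (\<integral>\<^sup>+x. ennreal ((R (x + 1 / u * x) - R x) ^ k) * indicator {1..H * u} x
        + ennreal ((R (x + x / u) - R x) ^ k) * indicator {H * u..q * H * u} x \<partial>lborel)"
      unfolding dil_moment_def
    \<comment> \<open>The two closed intervals share the endpoint \<open>H u\<close>, a null set.\<close>
    proof (rule nn_integral_cong_AE)
      show "AE x in lborel. ennreal ((R (x + 1 / u * x) - R x) ^ k) * indicator {1..q * H * u} x =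
         ennreal ((R (x + 1 / u * x) - R x) ^ k) * indicator {1..H * u} x
        + ennreal ((R (x + x / u) - R x) ^ k) * indicator {H * u..q * H * u} x"
        using AE_lborel_singleton[of "H * u"]
      proof eventually_elim
        case (elim x)
        then show ?case using Hu qHu by (auto simp: indicator_def)
      qed
    qed
    also have "\<dots> = dil_moment R k (H * u) (1 / u) + sec u"
      unfolding dil_moment_def sec_def by (simp add: nn_integral_add)
    finally have "ennreal (P (q * H * u) u) = ennreal (P (H * u) u) + sec u"
      unfolding P_def using k up by (simp add: dil_moment_eq_integral)
    then have "sec u = ennreal (P (q * H * u) u) - ennreal (P (H * u) u)"
      by (simp add: ennreal_add_diff_cancel_left)
    then show ?thesis using P0 by (simp add: ennreal_minus)
  qed
  have est: "\<bar>(P (q * H * u) u - P (H * u) u) / u - \<kappa> * ln (u / E) ^ p\<bar> \<le> F' / u" if uu: "u0 \<le> u" "u \<le> u1" for u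
  proof -
    have up: "0 < u" using u0 uu by linarith
    let ?L = "ln (u / E) ^ p"
    have M: "c * Y ^ (p + 1) * (1 / u) ^ p * ?L = c * (r ^ (p + 1)) * H ^ (p + 1) * u * ?L" 
      if "Y = r * H * u" for Y r
      using up unfolding that by (simp add: power_mult_distrib power_divide)
    have 1: "\<bar>P (q * H * u) u - c * (q * H * u) ^ (p + 1) * (1 / u) ^ p * ?L\<bar> \<le> B * (1 / u) ^ p * (q * H * u) ^ p"
      unfolding P_def using uu by (intro asy) auto
    have 2: "\<bar>P (H * u) u - c * (H * u) ^ (p + 1) * (1 / u) ^ p * ?L\<bar> \<le> B * (1 / u) ^ p * (H * u) ^ p"
      unfolding P_def using uu by (intro asy) auto
    have e1: "B * (1 / u) ^ p * (q * H * u) ^ p = B * (q * H) ^ p"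
      using up by (simp add: power_mult_distrib power_divide)
    have "B * (1 / u) ^ p * (H * u) ^ p = B * H ^ p"
      using up by (simp add: power_mult_distrib power_divide)
    also have "\<dots> \<le> B * (q * H) ^ p" using c q u by (intro mult_left_mono power_mono) auto
    finally have e2: "B * (1 / u) ^ p * (H * u) ^ p \<le> B * (q * H) ^ p" .
    have "c * (q * H * u) ^ (p + 1) * (1 / u) ^ p * ?L - c * (H * u) ^ (p + 1) * (1 / u) ^ p * ?L
        = c * (q ^ (p + 1)) * H ^ (p + 1) * u * ?L - c * (1 ^ (p + 1)) * H ^ (p + 1) * u * ?L"
      by (subst M[of _ q], simp, subst M[of _ 1]) auto
    also have "\<dots> = u * (\<kappa> * ?L)" unfolding \<kappa>_def by (simp add: algebra_simps)
    finally have "\<bar>(P (q * H * u) u - P (H * u) u) - u * (\<kappa> * ?L)\<bar> \<le> F'"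
      using 1 2 e1 e2 unfolding F'_def by linarith
    then have "\<bar>(P (q * H * u) u - P (H * u) u) - u * (\<kappa> * ?L)\<bar> / u \<le> F' / u"
      using up by (intro divide_right_mono) auto
    also have "\<bar>(P (q * H * u) u - P (H * u) u) - u * (\<kappa> * ?L)\<bar> / u = \<bar>((P (q * H * u) u - P (H * u) u) - u * (\<kappa> * ?L)) / u\<bar>"
      using up by simp
    also have "((P (q * H * u) u - P (H * u) u) - u * (\<kappa> * ?L)) / u = (P (q * H * u) u - P (H * u) u) / u - \<kappa> * ?L"
      using up by (simp add: field_simps)
    finally show ?thesis .
  qed
  have lnn: "0 \<le> ln (u / E) ^ p" if "u0 \<le> u" for u
    using that u E u0 by (intro zero_le_power ln_ge_zero) auto
  have cont: "continuous_on {u0..u1} (\<lambda>u. ln (u / E) ^ p)"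
    using u0 E by (auto intro!: continuous_intros)
  have main: "(\<integral>\<^sup>+u\<in>{u0..u1}. ennreal (\<kappa> * ln (u / E) ^ p) \<partial>lborel) = ennreal m"
  proof -
    have "((\<lambda>u. \<kappa> * ln (u / E) ^ p) has_integral \<kappa> * integral {u0..u1} (\<lambda>u. ln (u / E) ^ p)) {u0..u1}"
      using integrable_continuous_real[OF cont] by (intro has_integral_mult_right) (simp add: has_integral_integral)
    then show ?thesis unfolding m_def \<kappa>_def[symmetric]
      using lnn \<kappa>0 by (intro nn_integral_has_integral_lebesgue') auto
  qed
  have m0: "0 \<le> m" unfolding m_def \<kappa>_def[symmetric]
    using \<kappa>0 lnn integrable_continuous_real[OF cont] by (intro mult_nonneg_nonneg integral_nonneg) auto
  have err: "(\<integral>\<^sup>+u\<in>{u0..u1}. ennreal (F' / u) \<partial>lborel) = ennreal F"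
    unfolding F_def F'_def[symmetric] by (rule nn_integral_over_identity[OF u0 u(4) F'0])
  have F0: "0 \<le> F" unfolding F_def F'_def[symmetric] using F'0 u0 u by (intro mult_nonneg_nonneg) auto
  have S: "sector_average R k H q u0 u1 = (\<integral>\<^sup>+u\<in>{u0..u1}. ennreal ((P (q * H * u) u - P (H * u) u) / u) \<partial>lborel)"
    unfolding sector_average_def sec_def[symmetric]
  proof (intro nn_integral_cong)
    fix u
    show "ennreal (1 / u) * sec u * indicator {u0..u1} u =
       ennreal ((P (q * H * u) u - P (H * u) u) / u) * indicator {u0..u1} u"
      using u0 sec[of u] by (auto simp: indicator_def ennreal_mult'[symmetric])
  qed
  have meas: "(\<lambda>u. ennreal (\<kappa> * ln (u / E) ^ p) * indicator {u0..u1} u) \<in> borel_measurable lborel" by measurable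
  have meas2: "(\<lambda>u. ennreal (F' / u) * indicator {u0..u1} u) \<in> borel_measurable lborel" by measurable
  have "sector_average R k H q u0 u1 \<le> (\<integral>\<^sup>+u. ennreal (\<kappa> * ln (u / E) ^ p) * indicator {u0..u1} u
        + ennreal (F' / u) * indicator {u0..u1} u \<partial>lborel)"
    unfolding S
  proof (intro nn_integral_mono)
    fix u
    have "ennreal ((P (q * H * u) u - P (H * u) u) / u) \<le> ennreal (\<kappa> * ln (u / E) ^ p) + ennreal (F' / u)" if "u \<in> {u0..u1}"
    proof -
      have "(P (q * H * u) u - P (H * u) u) / u \<le> \<kappa> * ln (u / E) ^ p + F' / u" using est[of u] that by simp
      then have "ennreal ((P (q * H * u) u - P (H * u) u) / u) \<le> ennreal (\<kappa> * ln (u / E) ^ p + F' / u)" by (rule ennreal_leI)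
      also have "\<dots> = ennreal (\<kappa> * ln (u / E) ^ p) + ennreal (F' / u)"
        using that lnn \<kappa>0 F'0 u0 by (intro ennreal_plus) auto
      finally show ?thesis .
    qed
    then show "ennreal ((P (q * H * u) u - P (H * u) u) / u) * indicator {u0..u1} u \<le>
       ennreal (\<kappa> * ln (u / E) ^ p) * indicator {u0..u1} u + ennreal (F' / u) * indicator {u0..u1} u"
      by (auto simp: indicator_def)
  qed
  also have "\<dots> = ennreal m + ennreal F"
    using main err by (subst nn_integral_add[OF meas meas2]) simp
  finally show "sector_average R k H q u0 u1 \<le> ennreal (m + F)" using m0 F0 by simp
  have "ennreal m \<le> (\<integral>\<^sup>+u. ennreal ((P (q * H * u) u - P (H * u) u) / u) * indicator {u0..u1} u
        + ennreal (F' / u) * indicator {u0..u1} u \<partial>lborel)"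
    unfolding main[symmetric]
  proof (intro nn_integral_mono)
    fix u
    have "ennreal (\<kappa> * ln (u / E) ^ p) \<le> ennreal ((P (q * H * u) u - P (H * u) u) / u) + ennreal (F' / u)" if "u \<in> {u0..u1}"
    proof -
      have "\<kappa> * ln (u / E) ^ p \<le> (P (q * H * u) u - P (H * u) u) / u + F' / u" using est[of u] that by simp
      \<comment> \<open>The maximum keeps the argument of \<open>ennreal\<close> additive; \<open>ennreal\<close> itself truncates at 0.\<close>
      also have "\<dots> \<le> max 0 ((P (q * H * u) u - P (H * u) u) / u) + F' / u" by simp
      finally have "ennreal (\<kappa> * ln (u / E) ^ p) \<le> ennreal (max 0 ((P (q * H * u) u - P (H * u) u) / u) + F' / u)" by (rule ennreal_leI)
      also have "\<dots> = ennreal (max 0 ((P (q * H * u) u - P (H * u) u) / u)) + ennreal (F' / u)"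
        using that F'0 u0 by (intro ennreal_plus) auto
      also have "ennreal (max 0 ((P (q * H * u) u - P (H * u) u) / u)) = ennreal ((P (q * H * u) u - P (H * u) u) / u)"
        by (simp add: ennreal_max_0)
      finally show ?thesis .
    qed
    then show "ennreal (\<kappa> * ln (u / E) ^ p) * indicator {u0..u1} u \<le>
       ennreal ((P (q * H * u) u - P (H * u) u) / u) * indicator {u0..u1} u + ennreal (F' / u) * indicator {u0..u1} u"
      by (auto simp: indicator_def)
  qed
  also have "\<dots> = sector_average R k H q u0 u1 + ennreal F"
  proof -
    have "(\<integral>\<^sup>+u. ennreal ((P (q * H * u) u - P (H * u) u) / u) * indicator {u0..u1} u
        + ennreal (F' / u) * indicator {u0..u1} u \<partial>lborel) =
       (\<integral>\<^sup>+u. (ennreal (1 / u) * sec u) * indicator {u0..u1} u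
        + ennreal (F' / u) * indicator {u0..u1} u \<partial>lborel)"
      using u0 sec by (intro nn_integral_cong) (auto simp: indicator_def ennreal_mult'[symmetric])
    also have "\<dots> = sector_average R k H q u0 u1 + ennreal F"
    proof (subst nn_integral_add[OF _ meas2])
      show "(\<lambda>u. ennreal (1 / u) * sec u * indicator {u0..u1} u) \<in> borel_measurable lborel"
      proof -
        define g where "g u x = ennreal ((R (x + x / u) - R x) ^ k) * (if H * u \<le> x \<and> x \<le> q * H * u then 1 else 0)" for u x
        have "sec u = (\<integral>\<^sup>+x. g u x \<partial>lborel)" for u
          unfolding sec_def g_def by (intro nn_integral_cong) (auto simp: indicator_def)
        moreover have "case_prod g \<in> borel_measurable (borel \<Otimes>\<^sub>M lborel)"
          unfolding g_def by measurable
        then have "(\<lambda>u. \<integral>\<^sup>+x. g u x \<partial>lborel) \<in> borel_measurable borel"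
          by (rule lborel.borel_measurable_nn_integral)
        ultimately have [measurable]: "sec \<in> borel_measurable borel" by (simp add: fun_eq_iff[symmetric] cong: measurable_cong)
        show ?thesis by measurable
      qed
    qed (simp add: err sector_average_def sec_def)
    finally show ?thesis .
  qed
  finally show "ennreal m \<le> sector_average R k H q u0 u1 + ennreal F" .
qed

end

section \<open>The range where the shift is a small dilation\<close>

text \<open>
  All the factors \<open>1 + O(l)\<close> that are lost when passing between a fixed shift and its average, collected
  into \<open>1 / (1 - l) ^ (3 p)\<close>.
\<close>
lemma inverse_power_bound:
  fixes l q :: real
  assumes l: "0 < l" "6 * real p * l \<le> 1" and q: "1 \<le> q" "q \<le> 1 + l" and p: "0 < p"
  shows "1 / (1 - l) ^ (2 * p - 1) * q ^ (p + 1) \<le> 1 + 6 * real p * l"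
    and "1 / (1 - l) ^ (2 * p - 1) \<le> 2" and "(1 - l) ^ (2 * p - 1) \<ge> 1 - 6 * real p * l"
proof -
  have "1 * l \<le> real p * l" using p l by (intro mult_right_mono) auto
  then have l1: "l < 1" using l by linarith
  have "1 - 3 * real p * l \<le> (1 - l) ^ (3 * p)"
    using Bernoulli_inequality[of "- l" "3 * p"] l1 by simp
  moreover have pl: "0 \<le> real p * l" using l by simp
  ultimately have half: "1 / 2 \<le> (1 - l) ^ (3 * p)" and lb: "1 - 3 * real p * l \<le> (1 - l) ^ (3 * p)" using l by auto
  have mono: "(1 - l) ^ (3 * p) \<le> (1 - l) ^ (2 * p - 1)" using l l1 by (intro power_decreasing) auto
  have pos: "0 < (1 - l) ^ (2 * p - 1)" "0 < (1 - l) ^ (3 * p)" using l1 by auto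
  show "1 / (1 - l) ^ (2 * p - 1) \<le> 2" using half mono pos by (simp add: field_simps)
  show "(1 - l) ^ (2 * p - 1) \<ge> 1 - 6 * real p * l" using lb mono pl by linarith
  have "q \<le> 1 / (1 - l)"
  proof -
    have "(1 + l) * (1 - l) \<le> 1" by (simp add: algebra_simps)
    then show ?thesis using q l1 by (intro order_trans[OF q(2)]) (simp add: field_simps)
  qed
  then have "q ^ (p + 1) \<le> (1 / (1 - l)) ^ (p + 1)" using q by (intro power_mono) auto
  then have "1 / (1 - l) ^ (2 * p - 1) * q ^ (p + 1) \<le> 1 / (1 - l) ^ (2 * p - 1) * (1 / (1 - l)) ^ (p + 1)"
    using pos by (intro mult_left_mono) auto
  also have "\<dots> = 1 / (1 - l) ^ (3 * p)"
  proof -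
    have "3 * p = (2 * p - 1) + (p + 1)" using p by simp
    then show ?thesis by (simp only: power_add power_divide power_one) simp
  qed
  also have "\<dots> \<le> 1 / (1 - 3 * real p * l)" using lb pos l pl by (intro divide_left_mono mult_pos_pos) auto
  also have "\<dots> \<le> 1 + 6 * real p * l"
  proof -
    define z where "z = 3 * real p * l"
    have z: "0 \<le> z" "2 * z \<le> 1" using l pl by (auto simp: z_def)
    have "0 \<le> z * (1 - 2 * z)" using z by (intro mult_nonneg_nonneg) auto
    then have "1 \<le> (1 + 2 * z) * (1 - z)" by (simp add: algebra_simps)
    then have "1 / (1 - z) \<le> 1 + 2 * z" using z by (simp add: field_simps)
    then show ?thesis by (simp add: z_def)
  qed
  finally show "1 / (1 - l) ^ (2 * p - 1) * q ^ (p + 1) \<le> 1 + 6 * real p * l" .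
qed

lemma power_log_bounds:
  fixes q :: real
  assumes q: "1 \<le> q"
  shows "real n * ln q \<le> q ^ n - 1" "q ^ n - 1 \<le> real n * ln q * q ^ n"
proof -
  have e: "q ^ n = exp (real n * ln q)" using q by (simp add: exp_of_nat_mult)
  show "real n * ln q \<le> q ^ n - 1" using exp_ge_add_one_self[of "real n * ln q"] unfolding e by linarith
  have "1 - real n * ln q \<le> exp (- (real n * ln q))" using exp_ge_add_one_self[of "- (real n * ln q)"] by linarith
  then have "(1 - real n * ln q) * exp (real n * ln q) \<le> exp (- (real n * ln q)) * exp (real n * ln q)"
    by (intro mult_right_mono) auto
  also have "\<dots> = 1" by (simp add: exp_minus)
  finally show "q ^ n - 1 \<le> real n * ln q * q ^ n" unfolding e by (simp add: algebra_simps)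
qed

context log_growth
begin

text \<open>
  The shift moment over \<open>[a, X]\<close> is compared with its average over \<open>H \<le> h \<le> (1 + \<eta>) H\<close>, the average
  with sectors, and the sectors are evaluated by the hypothesis. The three groups of error terms come
  from changing the domain of the main integral (\<open>a\<close> and \<open>\<eta> X\<close>), from convexity (\<open>6 p l X\<close>), and from
  the error of the hypothesis and the short shifts (\<open>B\<close> and \<open>G\<close>), the last group divided by the width
  \<open>\<eta>\<close> of the average.
\<close>
lemma principal_range:
  assumes p: "0 < p" and E: "1 \<le> E" and c: "0 \<le> c" "0 \<le> B" "0 \<le> G" and H: "1 \<le> H"
    and l: "0 < \<eta>" "\<eta> \<le> l" "6 * real p * l \<le> 1"
    and a: "2 * E * H \<le> a" "2 * a \<le> X"
    and asy: "\<And>u Y. a / ((1 + \<eta>) * H) \<le> u \<Longrightarrow> u \<le> X / H \<Longrightarrow> Y = H * u \<or> Y = (1 + \<eta>) * H * u \<Longrightarrow>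
      \<bar>integral {1..Y} (\<lambda>x. (R (x + 1 / u * x) - R x) ^ (2 * p)) - c * Y ^ (p + 1) * (1 / u) ^ p * ln (u / E) ^ p\<bar>
        \<le> B * (1 / u) ^ p * Y ^ p"
    and rem: "(\<integral>\<^sup>+w\<in>{0..\<eta> * H}. shift_moment R (2 * p) (a + H) (X + H) w \<partial>lborel) \<le> ennreal G"
  defines "M \<equiv> c * (real p + 1) * H ^ (p + 1) * integral {E..X / H} (\<lambda>x. ln (x / E) ^ p)"
  shows "\<bar>integral {a..X} (\<lambda>x. (R (x + H) - R x) ^ (2 * p)) - M\<bar> \<le>
    c * (real p + 1) * H ^ p * (a + \<eta> * X + 6 * real p * l * X) * ln X ^ p
     + 2 / \<eta> * (4 * B * (2 * H) ^ p * ln X + 1 / l ^ (2 * p - 1) * G / H)"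
proof -
  define q where "q = 1 + \<eta>"
  define c1 c2 where "c1 = 1 / (1 - l) ^ (2 * p - 1)" and "c2 = 1 / l ^ (2 * p - 1)"
  define b where "b = integral {a..X} (\<lambda>x. (R (x + H) - R x) ^ (2 * p))"
  define f where "f x = ln (x / E) ^ p" for x
  define I where "I u0 u1 = integral {u0..u1} f" for u0 u1
  define \<kappa> where "\<kappa> = c * (q ^ (p + 1) - 1) * H ^ (p + 1)"
  define F where "F = 2 * B * (2 * H) ^ p * ln X"
  define A where "A = (\<integral>\<^sup>+h\<in>{H..q * H}. ennreal (1 / h) * shift_moment R (2 * p) a X h \<partial>lborel)"
  define D where "D = (\<integral>\<^sup>+w\<in>{0..(q - 1) * H}. shift_moment R (2 * p) (a + H) (X + H) w \<partial>lborel)"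
  have l0: "0 < l" using l by linarith
  have "1 * l \<le> real p * l" using p l by (intro mult_right_mono) auto
  then have l1: "l < 1" "\<eta> < 1" using l by linarith+
  have q: "1 < q" "q \<le> 2" "q \<le> 1 + l" using l l1 by (auto simp: q_def)
  have EH: "1 \<le> E * H" using E H mult_mono[of 1 E 1 H] by simp
  have "1 * H \<le> E * H" using E H by (intro mult_right_mono) auto
  moreover have "2 * E * H = 2 * (E * H)" by simp
  ultimately have a2: "2 \<le> a" "H \<le> a" using a EH H by linarith+
  have X: "4 \<le> X" using a2 a by linarith
  have c1: "c1 * q ^ (p + 1) \<le> 1 + 6 * real p * l" "c1 \<le> 2" "1 - 6 * real p * l \<le> 1 / c1" "0 < c1" "1 \<le> c1"
    using inverse_power_bound[of l p q] l0 l q p l1 unfolding c1_def by (auto simp: power_le_one)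
  have c20: "0 < c2" using l0 by (simp add: c2_def)
  have F0: "0 \<le> F" using c H X unfolding F_def by (intro mult_nonneg_nonneg) auto
  have \<kappa>0: "0 \<le> \<kappa>" unfolding \<kappa>_def using c H q one_le_power[of q "p + 1"] by (intro mult_nonneg_nonneg) auto
  have sb: "shift_moment R (2 * p) a X H = ennreal b"
    unfolding b_def using a2 H by (intro shift_moment_eq_integral) auto
  have b0: "0 \<le> b" unfolding b_def by (cases "(\<lambda>x. (R (x + H) - R x) ^ (2 * p)) integrable_on {a..X}")
      (auto intro!: integral_nonneg simp: not_integrable_integral)
  have D: "D \<le> ennreal G" using rem by (simp add: D_def q_def)
  have lnq: "\<eta> / 2 \<le> ln q" "0 < ln q"
  proof -
    have "\<eta> / 2 \<le> \<eta> / (1 + \<eta>)" using l l1 by (intro divide_left_mono) auto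
    moreover have "ln (1 / (1 + \<eta>)) \<le> 1 / (1 + \<eta>) - 1" using l by (intro ln_le_minus_one) auto
    moreover have "ln (1 / (1 + \<eta>)) = - ln (1 + \<eta>)" using l by (simp add: ln_div)
    moreover have "1 / (1 + \<eta>) - 1 = - (\<eta> / (1 + \<eta>))" using l by (simp add: field_simps)
    ultimately show "\<eta> / 2 \<le> ln q" unfolding q_def by linarith
    then show "0 < ln q" using l by linarith
  qed
  have f0: "0 \<le> f x" if "E \<le> x" for x using that E unfolding f_def by (intro zero_le_power ln_ge_zero) auto
  have fX: "f x \<le> ln X ^ p" if "E \<le> x" "x \<le> X" for x
  proof -
    have "x / E \<le> X / 1" using that E by (intro frac_le) auto
    then show ?thesis using that E unfolding f_def by (intro power_mono ln_mono) auto
  qed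
  have fint: "f integrable_on {x..y}" if "E \<le> x" for x y
    using that E unfolding f_def by (intro integrable_continuous_real continuous_intros) auto
  have I0: "0 \<le> I x y" if "E \<le> x" for x y
    unfolding I_def using that f0 fint by (intro integral_nonneg) auto
  have Ilen: "I x y \<le> (y - x) * ln X ^ p" if "E \<le> x" "x \<le> y" "y \<le> X" for x y
  proof -
    have "I x y \<le> integral {x..y} (\<lambda>_. ln X ^ p)"
      unfolding I_def using that fX fint by (intro integral_le) auto
    then show ?thesis using that by simp
  qed
  have Isplit: "I x y = I x z + I z y" if "E \<le> x" "x \<le> z" "z \<le> y" for x y z
    unfolding I_def using that fint Henstock_Kurzweil_Integration.integral_combine[of x z y f] by simp
  have XH: "X / H \<le> X" using X H by (simp add: field_simps)
  define u0 u1 v0 v1 where "u0 = a / (q * H)" "u1 = X / H" "v0 = a / H" "v1 = X / (q * H)"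
  note uv = this
  have qH: "q * H \<le> 2 * H" "0 < q * H" using q H by auto
  have "a * q \<le> X" using mult_left_mono[OF q(2), of a] a2 a by linarith
  then have ord: "v0 \<le> v1" unfolding uv using q H by (simp add: field_simps)
  have "E * (q * H) \<le> E * (2 * H)" using qH E by (intro mult_left_mono) auto
  also have "\<dots> = 2 * E * H" by simp
  also note a(1)
  finally have Eu0: "E \<le> u0" unfolding uv using qH by (simp add: field_simps)
  have uv0: "u0 \<le> v0" unfolding uv using q H a2 by (simp add: field_simps)
  have uv1: "v1 \<le> u1" unfolding uv using q H X by (simp add: field_simps)
  have Hu0: "1 \<le> H * u0"
  proof -
    have "q \<le> a" using q a2 by linarith
    then show ?thesis unfolding uv using q H by (simp add: field_simps)
  qed
  have rat: "u1 / u0 \<le> X" "v1 / v0 \<le> X" "0 < u0"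
  proof -
    have "X * q \<le> X * a" using q a2 X by (intro mult_left_mono) auto
    then show "u1 / u0 \<le> X" unfolding uv using q H a2 by (simp add: field_simps)
    have "1 * 1 \<le> a * q" using q a2 by (intro mult_mono) auto
    then have "X * 1 \<le> X * (a * q)" using X by (intro mult_left_mono) auto
    then show "v1 / v0 \<le> X" unfolding uv using q H a2 by (simp add: field_simps)
    show "0 < u0" unfolding uv using q H a2 by simp
  qed
  have Fbound: "2 * B * (q * H) ^ p * ln r \<le> F" if "1 \<le> r" "r \<le> X" for r
    unfolding F_def using that q H c by (intro mult_mono power_mono ln_mono) auto
  have up: "sector_average R (2 * p) H q u0 u1 \<le> ennreal (\<kappa> * I u0 u1 + F)"
  proof -
    have "sector_average R (2 * p) H q u0 u1 \<le> ennreal (\<kappa> * I u0 u1 + 2 * B * (q * H) ^ p * ln (u1 / u0))"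
      unfolding \<kappa>_def I_def f_def[abs_def]
      using Hu0 H Eu0 uv0 uv1 ord E q c
      by (intro sector_average_estimate(1) asy) (auto simp: uv q_def)
    also have "\<dots> \<le> ennreal (\<kappa> * I u0 u1 + F)"
      using uv0 uv1 ord rat by (intro ennreal_leI add_left_mono Fbound) auto
    finally show ?thesis .
  qed
  have lo: "ennreal (\<kappa> * I v0 v1) \<le> sector_average R (2 * p) H q v0 v1 + ennreal F"
  proof -
    have Hv: "1 \<le> H * v0" using Hu0 uv0 H mult_left_mono[OF uv0, of H] by linarith
    have "ennreal (\<kappa> * I v0 v1) \<le> sector_average R (2 * p) H q v0 v1 + ennreal (2 * B * (q * H) ^ p * ln (v1 / v0))"
      unfolding \<kappa>_def I_def f_def[abs_def]
    proof (intro sector_average_estimate(2))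
      fix u Y assume *: "v0 \<le> u" "u \<le> v1" "Y = H * u \<or> Y = q * H * u"
      then have "u0 \<le> u" "u \<le> u1" using uv0 uv1 by auto
      then show "\<bar>integral {1..Y} (\<lambda>x. (R (x + 1 / u * x) - R x) ^ (2 * p)) - c * Y ^ (p + 1) * (1 / u) ^ p * ln (u / E) ^ p\<bar>
        \<le> B * (1 / u) ^ p * Y ^ p"
        using * by (intro asy) (auto simp: uv q_def)
    qed (use Hv H Eu0 uv0 uv1 ord E q c in auto)
    also have "\<dots> \<le> sector_average R (2 * p) H q v0 v1 + ennreal F"
      using uv0 uv1 ord rat by (intro ennreal_leI add_left_mono Fbound) auto
    finally show ?thesis .
  qed
  define T where "T = I E u1"
  have T0: "0 \<le> T" unfolding T_def by (rule I0) simp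
  have M: "M = c * (real p + 1) * H ^ (p + 1) * T" unfolding M_def T_def I_def uv f_def[abs_def] ..
  have cp0: "0 \<le> c * (real p + 1) * H ^ (p + 1)" using c H by (intro mult_nonneg_nonneg) auto
  have M0: "0 \<le> M" unfolding M by (rule mult_nonneg_nonneg[OF cp0 T0])
  have \<kappa>lo: "c * (real p + 1) * H ^ (p + 1) * ln q \<le> \<kappa>"
  proof -
    have "c * H ^ (p + 1) * (real (p + 1) * ln q) \<le> c * H ^ (p + 1) * (q ^ (p + 1) - 1)"
      using c H q by (intro mult_left_mono power_log_bounds) auto
    then show ?thesis unfolding \<kappa>_def by (simp add: algebra_simps)
  qed
  have \<kappa>hi: "\<kappa> \<le> c * (real p + 1) * H ^ (p + 1) * ln q * q ^ (p + 1)"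
  proof -
    have "c * H ^ (p + 1) * (q ^ (p + 1) - 1) \<le> c * H ^ (p + 1) * (real (p + 1) * ln q * q ^ (p + 1))"
      using c H q by (intro mult_left_mono power_log_bounds) auto
    then show ?thesis unfolding \<kappa>_def by (simp add: algebra_simps)
  qed
  have c2G: "0 \<le> c2 / H * G" using c20 H c by simp
  define Q where "Q = 2 / \<eta> * (2 * F + c2 * G / H)"
  have Q: "y / ln q \<le> Q" if "0 \<le> y" "y \<le> 2 * F + c2 / H * G" for y
  proof -
    have "y / ln q \<le> y / (\<eta> / 2)" using that lnq l by (intro divide_left_mono) auto
    also have "\<dots> \<le> (2 * F + c2 / H * G) / (\<eta> / 2)" using that l by (intro divide_right_mono) auto
    finally show ?thesis using l unfolding Q_def by (simp add: field_simps)
  qed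
  \<comment> \<open>The width \<open>ln q\<close> of the average cancels against \<open>\<kappa>\<close>, because \<open>q ^ (p + 1) - 1\<close> lies between
    \<open>(p + 1) ln q\<close> and \<open>(p + 1) ln q\<close> times \<open>q ^ (p + 1)\<close>.\<close>
  have "ennreal (ln q) * ennreal b \<le> ennreal c1 * A + ennreal (c2 / H) * D"
    unfolding sb[symmetric] A_def D_def c1_def c2_def
    using p l0 l1 H q by (intro shift_moment_average_compare(1) measurable_R) auto
  also have "\<dots> \<le> ennreal c1 * ennreal (\<kappa> * I u0 u1 + F) + ennreal (c2 / H) * ennreal G"
  proof (intro add_mono mult_left_mono D)
    have "A \<le> sector_average R (2 * p) H q u0 u1"
      unfolding A_def uv using H a2 q by (intro log_average_le_sector_average measurable_R) auto
    then show "A \<le> ennreal (\<kappa> * I u0 u1 + F)" using up by (rule order_trans)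
  qed auto
  also have "\<dots> = ennreal (c1 * (\<kappa> * I u0 u1 + F) + c2 / H * G)"
    using c1 c20 H c \<kappa>0 I0[OF Eu0] F0 by (intro ennreal_linear_combination[symmetric]) auto
  finally have "ennreal (ln q * b) \<le> ennreal (c1 * (\<kappa> * I u0 u1 + F) + c2 / H * G)"
    using lnq b0 by (subst ennreal_mult) auto
  then have "ln q * b \<le> c1 * (\<kappa> * I u0 u1 + F) + c2 / H * G"
    by (rule ennreal_le_iff[THEN iffD1, rotated])
       (rule add_nonneg_nonneg[OF mult_nonneg_nonneg c2G]; use c1 \<kappa>0 I0[OF Eu0] F0 in simp)
  also have "c1 * (\<kappa> * I u0 u1 + F) \<le> c1 * (\<kappa> * T) + 2 * F"
  proof -
    have "u0 \<le> u1" using uv0 uv1 ord by linarith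
    then have "T = I E u0 + I u0 u1" unfolding T_def using Eu0 by (intro Isplit) auto
    then have "I u0 u1 \<le> T" using I0[of E u0] by simp
    then have "c1 * (\<kappa> * I u0 u1) \<le> c1 * (\<kappa> * T)" using c1 \<kappa>0 by (intro mult_left_mono) auto
    moreover have "c1 * F \<le> 2 * F" using c1 F0 by (intro mult_right_mono)
    ultimately show ?thesis by (simp add: distrib_left)
  qed
  also have "c1 * (\<kappa> * T) \<le> c1 * ((c * (real p + 1) * H ^ (p + 1) * ln q * q ^ (p + 1)) * T)"
    using c1 T0 \<kappa>hi by (intro mult_left_mono mult_right_mono) auto
  also have "\<dots> = (c1 * q ^ (p + 1)) * (M * ln q)" unfolding M by simp
  also have "\<dots> \<le> (1 + 6 * real p * l) * (M * ln q)" using M0 lnq by (intro mult_right_mono c1) auto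
  finally have "ln q * b \<le> (1 + 6 * real p * l) * (M * ln q) + (2 * F + c2 / H * G)" by simp
  then have "b \<le> ((1 + 6 * real p * l) * (M * ln q) + (2 * F + c2 / H * G)) / ln q"
    using lnq by (simp add: pos_le_divide_eq mult.commute)
  also have "\<dots> = (1 + 6 * real p * l) * M + (2 * F + c2 / H * G) / ln q"
    using lnq by (simp add: add_divide_distrib)
  also have "\<dots> \<le> (1 + 6 * real p * l) * M + Q" using F0 c2G by (intro add_left_mono Q) auto
  finally have upper: "b - M \<le> 6 * real p * l * M + Q" by (simp add: algebra_simps)
  \<comment> \<open>For the lower bound the inner sector is used, and the parts of the main integral outside it are
    given away; they form the term \<open>N\<close> below.\<close>
  have "sector_average R (2 * p) H q v0 v1 \<le> A"
    unfolding A_def uv using H a2 q by (intro sector_average_le_log_average measurable_R) auto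
  also have "A \<le> ennreal (c1 * ln q) * ennreal b + ennreal (c2 / H) * D"
    unfolding sb[symmetric] A_def D_def c1_def c2_def
    using p l0 l1 H q by (intro shift_moment_average_compare(2) measurable_R) auto
  also have "\<dots> \<le> ennreal (c1 * ln q) * ennreal b + ennreal (c2 / H) * ennreal G"
    by (intro add_left_mono mult_left_mono D) auto
  finally have "ennreal (\<kappa> * I v0 v1) \<le> ennreal (c1 * ln q) * ennreal b + ennreal (c2 / H) * ennreal G + ennreal F"
    by (intro order_trans[OF lo] add_right_mono)
  also have "\<dots> = ennreal (c1 * ln q * b + c2 / H * G + F)"
    using c1 lnq c2G c20 H c b0 F0 by (subst ennreal_linear_combination[symmetric]) (auto simp: ennreal_plus[symmetric] simp del: ennreal_plus)
  finally have "\<kappa> * I v0 v1 \<le> c1 * ln q * b + c2 / H * G + F"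
    by (rule ennreal_le_iff[THEN iffD1, rotated])
       (rule add_nonneg_nonneg[OF add_nonneg_nonneg[OF _ c2G] F0]; use c1 lnq b0 in simp)
  moreover have "c * (real p + 1) * H ^ (p + 1) * ln q * I v0 v1 \<le> \<kappa> * I v0 v1"
    using \<kappa>lo I0[of v0 v1] Eu0 uv0 by (intro mult_right_mono) auto
  ultimately have "c * (real p + 1) * H ^ (p + 1) * I v0 v1 * ln q \<le> c1 * b * ln q + (F + c2 / H * G)"
    by (simp add: ac_simps)
  then have "c * (real p + 1) * H ^ (p + 1) * I v0 v1 \<le> (c1 * b * ln q + (F + c2 / H * G)) / ln q"
    using lnq by (simp add: pos_le_divide_eq)
  also have "\<dots> = c1 * b + (F + c2 / H * G) / ln q" using lnq by (simp add: add_divide_distrib)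
  also have "\<dots> \<le> c1 * b + Q" using F0 c2G by (intro add_left_mono Q) auto
  finally have low1: "c * (real p + 1) * H ^ (p + 1) * I v0 v1 \<le> c1 * b + Q" .
  define N where "N = c * (real p + 1) * H ^ p * (a + \<eta> * X) * ln X ^ p"
  have "T = I E v0 + (I v0 v1 + I v1 u1)"
    unfolding T_def using Eu0 uv0 uv1 ord by (subst Isplit[of E v0 u1], simp_all, subst Isplit[of v0 v1 u1]) auto
  also have "I E v0 \<le> (v0 - E) * ln X ^ p"
    using Eu0 uv0 uv1 ord XH by (intro Ilen) (auto simp: uv)
  also have "\<dots> \<le> v0 * ln X ^ p" using E X by (intro mult_right_mono) auto
  also have "I v1 u1 \<le> (u1 - v1) * ln X ^ p"
    using Eu0 uv0 uv1 ord XH by (intro Ilen) (auto simp: uv)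
  also have "\<dots> \<le> (\<eta> * X / H) * ln X ^ p"
  proof (intro mult_right_mono)
    have "1 - 1 / q = \<eta> / q" using q by (simp add: field_simps) (simp add: q_def)
    moreover have "u1 - v1 = (X / H) * (1 - 1 / q)" unfolding uv by (simp add: algebra_simps)
    ultimately have "u1 - v1 = \<eta> * X / H / q" by simp
    also have "\<dots> \<le> \<eta> * X / H / 1" using q H X l by (intro divide_left_mono) auto
    finally show "u1 - v1 \<le> \<eta> * X / H" by simp
  qed (use X in auto)
  finally have "T \<le> I v0 v1 + (v0 + \<eta> * X / H) * ln X ^ p" by (simp add: algebra_simps)
  then have "M \<le> c * (real p + 1) * H ^ (p + 1) * (I v0 v1 + (v0 + \<eta> * X / H) * ln X ^ p)"
    unfolding M using cp0 by (intro mult_left_mono)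
  also have "\<dots> = c * (real p + 1) * H ^ (p + 1) * I v0 v1 + N"
    unfolding N_def uv using H by (simp add: field_simps)
  finally have "M \<le> c1 * b + (Q + N)" using low1 by linarith
  then have "M / c1 \<le> b + (Q + N) / c1" using c1 by (simp add: field_simps)
  moreover have N0: "0 \<le> N" unfolding N_def using c H a2 X l by (intro mult_nonneg_nonneg add_nonneg_nonneg) auto
  have Q0: "0 \<le> Q" using Q[of 0] F0 c2G by simp
  have "(Q + N) / c1 \<le> (Q + N) / 1" using c1 N0 Q0 by (intro divide_left_mono) auto
  moreover have "(1 - 6 * real p * l) * M \<le> 1 / c1 * M" using c1 M0 by (intro mult_right_mono) auto
  ultimately have lower: "M - b \<le> 6 * real p * l * M + (Q + N)" by (simp add: algebra_simps)
  have "\<bar>b - M\<bar> \<le> 6 * real p * l * M + N + Q" using upper lower N0 by (simp add: abs_le_iff)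
  moreover have "M \<le> c * (real p + 1) * H ^ p * X * ln X ^ p"
  proof -
    have "u0 \<le> u1" using uv0 uv1 ord by linarith
    then have "T \<le> (u1 - E) * ln X ^ p" unfolding T_def using Eu0 XH by (intro Ilen) (auto simp: uv)
    also have "\<dots> \<le> u1 * ln X ^ p" using E X by (intro mult_right_mono) auto
    finally have "M \<le> c * (real p + 1) * H ^ (p + 1) * (u1 * ln X ^ p)"
      unfolding M using cp0 by (intro mult_left_mono)
    also have "\<dots> = c * (real p + 1) * H ^ p * X * ln X ^ p" using H by (simp add: uv)
    finally show ?thesis .
  qed
  then have "6 * real p * l * M \<le> 6 * real p * l * (c * (real p + 1) * H ^ p * X * ln X ^ p)"
    using l0 by (intro mult_left_mono) auto
  ultimately have "\<bar>b - M\<bar> \<le> 6 * real p * l * (c * (real p + 1) * H ^ p * X * ln X ^ p) + N + Q" by linarith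
  then show ?thesis unfolding b_def N_def Q_def F_def c2_def by (simp add: algebra_simps)
qed

end

section \<open>From dilations to fixed shifts\<close>

lemma log_power_le_powr:
  fixes a s :: real
  assumes "0 \<le> a" "0 < s"
  obtains C where "0 \<le> C" "\<And>x. 1 \<le> x \<Longrightarrow> (a + ln x) ^ n \<le> C * x powr s"
proof
  define t where "t = s / (real n + 1)"
  have t: "0 < t" "t * real n \<le> s" using assms by (auto simp: t_def field_simps)
  show "0 \<le> (a + 1 / t) ^ n" using assms t by simp
  fix x :: real assume x: "1 \<le> x"
  have "1 \<le> x powr t" using x t by (simp add: ge_one_powr_ge_zero)
  then have "a * 1 \<le> a * x powr t" using assms by (intro mult_left_mono)
  then have "a + ln x \<le> (a + 1 / t) * x powr t" using ln_powr_bound[OF x t(1)] by (simp add: algebra_simps)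
  then have "(a + ln x) ^ n \<le> ((a + 1 / t) * x powr t) ^ n" using assms x by (intro power_mono) auto
  also have "\<dots> = (a + 1 / t) ^ n * x powr (t * real n)" using x by (simp add: power_mult_distrib powr_power mult.commute)
  also have "\<dots> \<le> (a + 1 / t) ^ n * x powr s" using assms t x by (intro mult_left_mono powr_mono) auto
  finally show "(a + ln x) ^ n \<le> (a + 1 / t) ^ n * x powr s" .
qed

lemma eventually_powr_ge:
  fixes s :: real
  assumes "0 < s"
  shows "\<forall>\<^sub>F x in at_top. c \<le> x powr s"
proof -
  have "filterlim (\<lambda>x. x powr s) at_top at_top" using assms by real_asymp
  then show ?thesis by (simp add: filterlim_at_top)
qed

lemma shift_moment_split_le:
  assumes [measurable]: "R \<in> borel_measurable borel"
  shows "shift_moment R k a b h \<le> shift_moment R k a m h + shift_moment R k m b h"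
proof -
  have "shift_moment R k a b h \<le> (\<integral>\<^sup>+x. ennreal ((R (x + h) - R x) ^ k) * indicator {a..m} x
      + ennreal ((R (x + h) - R x) ^ k) * indicator {m..b} x \<partial>lborel)"
    unfolding shift_moment_def by (intro nn_integral_mono) (auto simp: indicator_def)
  also have "\<dots> = shift_moment R k a m h + shift_moment R k m b h"
    unfolding shift_moment_def by (simp add: nn_integral_add)
  finally show ?thesis .
qed

text \<open>
  The hypothesis of the theorem for a general function \<open>R\<close>, with \<open>k = 2 p\<close>. The lower bound for \<open>X0\<close>
  makes \<open>Y powr (1 / 2) \<ge> 6\<close>, which the chaining of dilations requires.
\<close>
locale dilation_asymptotics = log_growth +
  fixes p :: nat and e e1 c E C0 X0 :: real
  assumes p: "0 < p" and e: "0 < e1" "e1 < e" "e \<le> 1 / 4" and E: "1 \<le> E"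
    and c: "0 \<le> c" "0 \<le> C0" and X0: "36 \<le> X0"
    and asymptotic: "\<And>Y d. X0 \<le> Y \<Longrightarrow> Y powr (-1 + e) \<le> d \<Longrightarrow> d \<le> Y powr (-e) \<Longrightarrow>
      \<bar>integral {1..Y} (\<lambda>x. (R (x + d * x) - R x) ^ (2 * p))
         - c * Y ^ (p + 1) * d ^ p * ln (1 / (E * d)) ^ p\<bar> \<le> C0 * d ^ p * Y powr (real p + 1 - e1)"
begin

text \<open>
  In the range of the hypothesis \<open>ln (1 / (E d))\<close> is at most of order \<open>ln Y\<close>, which is absorbed into an
  arbitrarily small power of \<open>Y\<close>.
\<close>
lemma dil_moment_le:
  assumes s: "0 < s"
  obtains K where "0 \<le> K" "\<And>Y d. X0 \<le> Y \<Longrightarrow> Y powr (-1 + e) \<le> d \<Longrightarrow> d \<le> Y powr (-e) \<Longrightarrow>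
     dil_moment R (2 * p) Y d \<le> ennreal (K * d ^ p * Y ^ (p + 1) * Y powr s)"
proof -
  have "0 \<le> ln E" using E by simp
  from log_power_le_powr[OF this s, of p] obtain C where C: "0 \<le> C" "\<And>x. 1 \<le> x \<Longrightarrow> (ln E + ln x) ^ p \<le> C * x powr s"
    by blast
  show ?thesis
  proof (rule that[of "c * C + C0"])
    show "0 \<le> c * C + C0" using C c by simp
    fix Y d assume Y: "X0 \<le> Y" and d: "Y powr (-1 + e) \<le> d" "d \<le> Y powr (-e)"
    have Y1: "1 \<le> Y" using Y X0 by linarith
    have d0: "0 < d" using d(1) Y1 by (smt (verit) powr_gt_zero)
    have "d \<le> 1" using d(2) Y1 e powr_mono[of "-e" 0 Y] by simp
    then have lnd: "ln d \<le> 0" using d0 by simp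
    have "Y powr (-1) \<le> Y powr (-1 + e)" using Y1 e by (intro powr_mono) auto
    then have "inverse Y \<le> d" using d Y1 by (simp add: powr_minus)
    then have "ln (inverse Y) \<le> ln d" using Y1 by (intro ln_mono) auto
    then have lnd2: "- ln Y \<le> ln d" using Y1 by (simp add: ln_inverse)
    have "ln (1 / (E * d)) = - ln E - ln d" using E d0 by (simp add: ln_div ln_mult)
    then have "\<bar>ln (1 / (E * d))\<bar> \<le> ln E + ln Y" using lnd lnd2 \<open>0 \<le> ln E\<close> by linarith
    then have "\<bar>ln (1 / (E * d))\<bar> ^ p \<le> (ln E + ln Y) ^ p" by (intro power_mono) auto
    also have "\<dots> \<le> C * Y powr s" by (rule C(2)[OF Y1])
    finally have "ln (1 / (E * d)) ^ p \<le> C * Y powr s" by (metis abs_ge_self order_trans power_abs)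
    then have "c * Y ^ (p + 1) * d ^ p * ln (1 / (E * d)) ^ p \<le> c * Y ^ (p + 1) * d ^ p * (C * Y powr s)"
      using c Y1 d0 by (intro mult_left_mono) auto
    moreover have "C0 * d ^ p * Y powr (real p + 1 - e1) \<le> C0 * d ^ p * Y powr (real p + 1 + s)"
      using c d0 Y1 e s by (intro mult_left_mono powr_mono) auto
    moreover have "Y powr (real p + 1 + s) = Y ^ (p + 1) * Y powr s"
      using Y1 powr_realpow[of Y "p + 1"] by (simp add: powr_add add_ac)
    ultimately have "integral {1..Y} (\<lambda>x. (R (x + d * x) - R x) ^ (2 * p)) \<le> (c * C + C0) * d ^ p * Y ^ (p + 1) * Y powr s"
      using asymptotic[OF Y d] by (simp add: algebra_simps)
    then show "dil_moment R (2 * p) Y d \<le> ennreal ((c * C + C0) * d ^ p * Y ^ (p + 1) * Y powr s)"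
      using d0 by (subst dil_moment_eq_integral) (auto intro: ennreal_leI)
  qed
qed

lemma dil_moment_le_wide:
  assumes s: "0 < s" "s \<le> 1"
  obtains K where "0 \<le> K" "\<And>Y d. X0 \<le> Y \<Longrightarrow> Y powr (-1 + e) \<le> d \<Longrightarrow> d \<le> 1 \<Longrightarrow>
     dil_moment R (2 * p) Y d \<le> ennreal (K * d ^ p * Y ^ (p + 1) * Y powr (real p * e + s))"
proof -
  obtain K where K: "0 \<le> K" "\<And>Y d. X0 \<le> Y \<Longrightarrow> Y powr (-1 + e) \<le> d \<Longrightarrow> d \<le> Y powr (-e) \<Longrightarrow>
     dil_moment R (2 * p) Y d \<le> ennreal (K * d ^ p * Y ^ (p + 1) * Y powr s)"
    using dil_moment_le[OF s(1)] by blast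
  show ?thesis
  proof (rule that[of "K * 9 ^ p * 2 ^ (p + 2)"])
    fix Y d assume "X0 \<le> Y" "Y powr (-1 + e) \<le> d" "d \<le> 1"
    then show "dil_moment R (2 * p) Y d \<le> ennreal (K * 9 ^ p * 2 ^ (p + 2) * d ^ p * Y ^ (p + 1) * Y powr (real p * e + s))"
      using s e by (intro dil_moment_bound_extend[OF measurable_R p _ _ _ _ K(1) X0 K(2)]) auto
  qed (use K in simp)
qed

lemma mean_power_le:
  assumes s: "0 < s" "s \<le> 1"
  obtains C where "0 \<le> C" "\<And>Y. 1 \<le> Y \<Longrightarrow>
    (\<integral>\<^sup>+x\<in>{1..Y}. ennreal (R x ^ (2 * p)) \<partial>lborel) \<le> ennreal (C * Y powr (real p + 1 + real p * e + s))"
proof -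
  obtain K where K: "0 \<le> K" "\<And>Y d. X0 \<le> Y \<Longrightarrow> Y powr (-1 + e) \<le> d \<Longrightarrow> d \<le> 1 \<Longrightarrow>
     dil_moment R (2 * p) Y d \<le> ennreal (K * d ^ p * Y ^ (p + 1) * Y powr (real p * e + s))"
    using dil_moment_le_wide[OF s] by blast
  have "dil_moment R (2 * p) Y 1 \<le> ennreal (K * Y powr (real p + 1 + real p * e + s))" if Y: "X0 \<le> Y" for Y
  proof -
    have Y1: "1 \<le> Y" using Y X0 by linarith
    have "Y powr (-1 + e) \<le> Y powr 0" using Y1 e by (intro powr_mono) auto
    then have "dil_moment R (2 * p) Y 1 \<le> ennreal (K * 1 ^ p * Y ^ (p + 1) * Y powr (real p * e + s))"
      using Y1 by (intro K Y) auto
    also have "K * 1 ^ p * Y ^ (p + 1) * Y powr (real p * e + s) = K * Y powr (real p + 1 + real p * e + s)"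
      using Y1 powr_realpow[of Y "p + 1"] by (simp add: powr_add ac_simps)
    finally show ?thesis .
  qed
  moreover have "0 \<le> real p * e" "1 \<le> real p" using p e by auto
  then have "2 \<le> real p + 1 + real p * e + s" using s by linarith
  ultimately show ?thesis
    using power_integral_le[of "2 * p" "real p + 1 + real p * e + s" K X0] K(1) p that by auto
qed

text \<open>
  With \<open>a = 4 H X powr e\<close> and \<open>r = p e\<close>, both \<open>[1, 2 H]\<close> and \<open>[2 H, a]\<close> contribute at most
  \<open>H ^ p (2 a) powr (1 + r + 2 s)\<close>. The upper bound imposed on \<open>H\<close> says precisely that \<open>2 a\<close> is at most
  of order \<open>X powr (1 - r - 2 e1)\<close>, and \<open>(1 - r - 2 e1) (1 + r) \<le> 1 - 2 e1\<close>.
\<close>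
lemma initial_range:
  shows "\<exists>C\<ge>0. \<forall>\<^sub>F X in at_top. \<forall>H. X powr (2 * e + e1) \<le> H \<and> 
      H \<le> X powr (1 - (real p + 1) * e - 2 * e1) / 2 \<longrightarrow>
      shift_moment R (2 * p) 1 (4 * H * X powr e) H \<le> ennreal (C * H ^ p * X powr (1 - e1))"
proof -
  define s where "s = e1 / 4"
  define r where "r = real p * e"
  have s: "0 < s" "s \<le> 1" using e by (auto simp: s_def)
  have r: "0 \<le> r" using e by (simp add: r_def)
  obtain K where K: "0 \<le> K" "\<And>Y d. X0 \<le> Y \<Longrightarrow> Y powr (-1 + e) \<le> d \<Longrightarrow> d \<le> 1 \<Longrightarrow>
     dil_moment R (2 * p) Y d \<le> ennreal (K * d ^ p * Y ^ (p + 1) * Y powr (r + s))"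
    using dil_moment_le_wide[OF s] unfolding r_def by blast
  obtain C1 where C1: "0 \<le> C1" "\<And>Y. 1 \<le> Y \<Longrightarrow>
    (\<integral>\<^sup>+x\<in>{1..Y}. ennreal (R x ^ (2 * p)) \<partial>lborel) \<le> ennreal (C1 * Y powr (real p + 1 + r + s))"
    using mean_power_le[OF s] unfolding r_def by blast
  have "(0::real) \<le> 1 + ln 2" by simp
  from log_power_le_powr[OF this s(1), of "2 * p"] obtain C2 where C2: "0 \<le> C2"
    "\<And>x. 1 \<le> x \<Longrightarrow> (1 + ln 2 + ln x) ^ (2 * p) \<le> C2 * x powr s" by blast
  from log_power_le_powr[OF order_refl s(1), of 1] obtain C3 where C3: "0 \<le> C3"
    "\<And>x. 1 \<le> x \<Longrightarrow> (0 + ln x) ^ 1 \<le> C3 * x powr s" by blast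
  define A1 where "A1 = 2 ^ (2 * p) * C1 * 3 powr (real p + 1 + r + s)"
  define A2 where "A2 = 4 ^ p * (2 ^ p + 2) * (4 ^ p * C2 + K * C3)"
  define A3 where "A3 = 4 powr (1 + r + 2 * s)"
  have A0: "0 \<le> A1" "0 \<le> A2" "0 \<le> A3" unfolding A1_def A2_def A3_def using K C1 C2 C3 by auto
  have ev: "\<forall>\<^sub>F X in at_top. X0 \<le> X powr e \<and> 4 \<le> X powr (r + 2 * e1) \<and> 1 \<le> X"
    using e r by (intro eventually_conj eventually_powr_ge eventually_ge_at_top) auto
  show ?thesis
  proof (intro exI[of _ "(A1 + A2) * A3"] conjI eventually_mono[OF ev] allI impI)
    show "0 \<le> (A1 + A2) * A3" using A0 by simp
    fix X H assume X: "X0 \<le> X powr e \<and> 4 \<le> X powr (r + 2 * e1) \<and> 1 \<le> X"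
      and H: "X powr (2 * e + e1) \<le> H \<and> H \<le> X powr (1 - (real p + 1) * e - 2 * e1) / 2"
    define a where "a = 4 * H * X powr e"
    have Xe: "X0 \<le> X powr e" "1 \<le> X powr e" using X X0 by auto
    have H1: "1 \<le> H" using H X e ge_one_powr_ge_zero[of X "2 * e + e1"] by linarith
    have "4 * H * 1 \<le> a" unfolding a_def using H1 Xe by (intro mult_left_mono) auto
    then have aH: "4 * H \<le> a" by simp
    have "2 * a = (2 * H) * (4 * X powr e)" by (simp add: a_def)
    also have "\<dots> \<le> X powr (1 - (real p + 1) * e - 2 * e1) * (4 * X powr e)"
      using H by (intro mult_right_mono) auto
    also have "\<dots> = 4 * X powr (1 - r - 2 * e1)" by (simp add: powr_add[symmetric] r_def algebra_simps)
    finally have a2: "2 * a \<le> 4 * X powr (1 - r - 2 * e1)" .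
    also have "\<dots> \<le> X powr (r + 2 * e1) * X powr (1 - r - 2 * e1)" using X by (intro mult_right_mono) auto
    also have "\<dots> = X" using X by (simp add: powr_add[symmetric])
    finally have aX: "2 * a \<le> X" .
    have a1: "4 \<le> a" using aH H1 by linarith
    have a3: "(2 * a) powr (1 + r + 2 * s) \<le> A3 * X powr (1 - e1)"
    proof -
      have "(2 * a) powr (1 + r + 2 * s) \<le> (4 * X powr (1 - r - 2 * e1)) powr (1 + r + 2 * s)"
        using a2 a1 r s by (intro powr_mono2) auto
      also have "\<dots> = A3 * X powr ((1 - r - 2 * e1) * (1 + r + 2 * s))"
        unfolding A3_def by (simp add: powr_mult powr_powr)
      also have "\<dots> \<le> A3 * X powr (1 - e1)"
      proof (intro mult_left_mono powr_mono)
        have "(1 - r - 2 * e1) * (1 + r + 2 * s) = 1 - r ^ 2 - 2 * e1 + 2 * s - 2 * e1 * r - 2 * s * (r + 2 * e1)"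
          by (simp add: algebra_simps power2_eq_square)
        also have "\<dots> \<le> 1 - 2 * e1 + 2 * s" using r s e by (smt (verit) mult_nonneg_nonneg zero_le_power2)
        also have "\<dots> \<le> 1 - e1" using e by (simp add: s_def)
        finally show "(1 - r - 2 * e1) * (1 + r + 2 * s) \<le> 1 - e1" .
      qed (use X A0 in auto)
      finally show ?thesis .
    qed
    \<comment> \<open>Here \<open>x\<close> and \<open>H\<close> are of the same order or \<open>x\<close> is smaller, and the mean value of \<open>R ^ (2 p)\<close>
      suffices.\<close>
    have part1: "shift_moment R (2 * p) 1 (2 * H) H \<le> ennreal (A1 * H ^ p * (2 * a) powr (1 + r + 2 * s))"
    proof -
      have "shift_moment R (2 * p) 1 (2 * H) H \<le> ennreal (2 ^ (2 * p) * C1 * (3 * H) powr (real p + 1 + r + s))"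
        using p H1 C1 r s by (intro shift_moment_initial_le) auto
      also have "2 ^ (2 * p) * C1 * (3 * H) powr (real p + 1 + r + s) = A1 * (H ^ p * H powr (1 + r + s))"
        unfolding A1_def using H1 powr_realpow[of H p] by (simp add: powr_mult powr_add ac_simps)
      also have "\<dots> \<le> A1 * (H ^ p * (2 * a) powr (1 + r + 2 * s))"
      proof (intro mult_left_mono)
        have "H powr (1 + r + s) \<le> (2 * a) powr (1 + r + s)" using aH H1 r s by (intro powr_mono2) auto
        also have "\<dots> \<le> (2 * a) powr (1 + r + 2 * s)" using a1 s by (intro powr_mono) auto
        finally show "H powr (1 + r + s) \<le> (2 * a) powr (1 + r + 2 * s)" .
      qed (use A0 H1 in auto)
      finally show ?thesis by (simp add: mult.assoc ennreal_leI)
    qed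
    have part2: "shift_moment R (2 * p) (2 * H) a H \<le> ennreal (A2 * H ^ p * (2 * a) powr (1 + r + 2 * s))"
    proof -
      define K' where "K' = K * (2 * a) powr (r + s)"
      have "shift_moment R (2 * p) (2 * H) a H \<le>
        ennreal (4 ^ p * (2 ^ p + 2) * H ^ p * a * (4 ^ p * (1 + ln (4 * a)) ^ (2 * p) + K' * ln (2 * a)))"
      proof (rule shift_moment_middle[where e = e])
        have "(2 * a) powr (2 * e) \<le> X powr (2 * e)" using aX a1 e by (intro powr_mono2) auto
        also have "\<dots> \<le> X powr (2 * e + e1)" using X e by (intro powr_mono) auto
        finally show "(2 * a) powr (2 * e) \<le> H" using H by linarith
        show "0 \<le> K'" using K by (simp add: K'_def)
        fix Y d assume Y: "2 * H \<le> Y" "Y \<le> 2 * a" and d: "Y powr (-1 + e) \<le> d" "d \<le> 1"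
        have "X powr e \<le> X powr (2 * e + e1)" using X e by (intro powr_mono) auto
        then have "X0 \<le> Y" using Xe Y H H1 by linarith
        then have "dil_moment R (2 * p) Y d \<le> ennreal (K * d ^ p * Y ^ (p + 1) * Y powr (r + s))"
          by (intro K d)
        also have "\<dots> \<le> ennreal (K * d ^ p * Y ^ (p + 1) * (2 * a) powr (r + s))"
          using Y H1 r s K order_trans[OF powr_ge_zero d(1)] by (intro ennreal_leI mult_left_mono powr_mono2 mult_nonneg_nonneg) auto
        finally show "dil_moment R (2 * p) Y d \<le> ennreal (K' * d ^ p * Y ^ (p + 1))"
          by (simp add: K'_def ac_simps)
      qed (use p e H1 aH in auto)
      also have "\<dots> \<le> ennreal (A2 * H ^ p * (2 * a) powr (1 + r + 2 * s))"
      proof (intro ennreal_leI)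
        have "1 + ln (4 * a) = 1 + ln 2 + ln (2 * a)" using a1 ln_mult[of 2 "2 * a"] by simp
        then have "(1 + ln (4 * a)) ^ (2 * p) \<le> C2 * (2 * a) powr s" using C2(2)[of "2 * a"] a1 by (simp add: add.assoc)
        also have "\<dots> \<le> C2 * (2 * a) powr (r + 2 * s)" using a1 C2 r s by (intro mult_left_mono powr_mono) auto
        finally have b1: "(1 + ln (4 * a)) ^ (2 * p) \<le> C2 * (2 * a) powr (r + 2 * s)" .
        have "K' * ln (2 * a) \<le> K' * (C3 * (2 * a) powr s)"
          using C3(2)[of "2 * a"] a1 K by (intro mult_left_mono) (auto simp: K'_def)
        also have "\<dots> = K * C3 * (2 * a) powr (r + 2 * s)"
          unfolding K'_def using a1 by (simp add: powr_add[symmetric] algebra_simps)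
        finally have b2: "K' * ln (2 * a) \<le> K * C3 * (2 * a) powr (r + 2 * s)" .
        have "4 ^ p * (1 + ln (4 * a)) ^ (2 * p) + K' * ln (2 * a) \<le>
            4 ^ p * (C2 * (2 * a) powr (r + 2 * s)) + K * C3 * (2 * a) powr (r + 2 * s)"
          using b1 b2 by (intro add_mono mult_left_mono) auto
        also have "\<dots> = (4 ^ p * C2 + K * C3) * (2 * a) powr (r + 2 * s)" by (simp add: algebra_simps)
        finally have "4 ^ p * (2 ^ p + 2) * H ^ p * a * (4 ^ p * (1 + ln (4 * a)) ^ (2 * p) + K' * ln (2 * a)) \<le>
            4 ^ p * (2 ^ p + 2) * H ^ p * (2 * a) * ((4 ^ p * C2 + K * C3) * (2 * a) powr (r + 2 * s))"
          using a1 H1 K C2 C3 unfolding K'_def by (intro mult_mono mult_left_mono add_nonneg_nonneg mult_nonneg_nonneg) auto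
        also have "\<dots> = A2 * H ^ p * (2 * a) powr (1 + r + 2 * s)"
          unfolding A2_def using a1 by (simp add: powr_add ac_simps)
        finally show "4 ^ p * (2 ^ p + 2) * H ^ p * a * (4 ^ p * (1 + ln (4 * a)) ^ (2 * p) + K' * ln (2 * a))
          \<le> A2 * H ^ p * (2 * a) powr (1 + r + 2 * s)" .
      qed
      finally show ?thesis .
    qed
    have "shift_moment R (2 * p) 1 a H \<le> shift_moment R (2 * p) 1 (2 * H) H + shift_moment R (2 * p) (2 * H) a H"
      by (rule shift_moment_split_le) (rule measurable_R)
    also have "\<dots> \<le> ennreal (A1 * H ^ p * (2 * a) powr (1 + r + 2 * s)) + ennreal (A2 * H ^ p * (2 * a) powr (1 + r + 2 * s))"
      by (intro add_mono part1 part2)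
    also have "\<dots> = ennreal ((A1 + A2) * H ^ p * (2 * a) powr (1 + r + 2 * s))"
      using A0 H1 by (subst ennreal_plus[symmetric]) (auto simp: algebra_simps)
    also have "\<dots> \<le> ennreal ((A1 + A2) * H ^ p * (A3 * X powr (1 - e1)))"
      using A0 H1 a3 by (intro ennreal_leI mult_left_mono) auto
    finally show "shift_moment R (2 * p) 1 (4 * H * X powr e) H \<le> ennreal ((A1 + A2) * A3 * H ^ p * X powr (1 - e1))"
      by (simp add: a_def ac_simps)
  qed
qed

text \<open>
  The choice \<open>a = 4 H X powr e\<close> makes every dilation factor that occurs at most \<open>Y powr (-e)\<close>. Shifts are
  averaged over a relative width \<open>\<eta> = X powr (- e1 / 2)\<close>, which is still large enough for dividing the
  error \<open>X powr (1 - e1)\<close> by \<open>\<eta>\<close>, and for which the lower bound on \<open>H\<close> keeps \<open>\<eta> H\<close> above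
  \<open>(2 X) powr (2 e)\<close>. With \<open>l = X powr (- e1 / 8)\<close> the remainder \<open>\<eta> ^ p / l ^ (2 p - 1)\<close> is at most
  \<open>X powr (- e1 / 8)\<close>. The exponent \<open>s = e1 / 32\<close> absorbs the logarithms.
\<close>
lemma principal_asymptotic:
  shows "\<exists>C\<ge>0. \<forall>\<^sub>F X in at_top. \<forall>H. X powr (2 * e + e1) \<le> H \<and> 
      H \<le> X powr (1 - (real p + 1) * e - 2 * e1) / 2 \<longrightarrow>
      \<bar>integral {4 * H * X powr e..X} (\<lambda>x. (R (x + H) - R x) ^ (2 * p))
         - c * (real p + 1) * H ^ (p + 1) * integral {E..X / H} (\<lambda>x. ln (x / E) ^ p)\<bar>
      \<le> C * H ^ p * X powr (1 - e1 / 16)"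
proof -
  define s where "s = e1 / 32"
  define r where "r = real p * e"
  have s: "0 < s" "s \<le> 1" using e by (auto simp: s_def)
  have r: "0 \<le> r" using e by (simp add: r_def)
  obtain K where K: "0 \<le> K" "\<And>Y d. X0 \<le> Y \<Longrightarrow> Y powr (-1 + e) \<le> d \<Longrightarrow> d \<le> Y powr (-e) \<Longrightarrow>
     dil_moment R (2 * p) Y d \<le> ennreal (K * d ^ p * Y ^ (p + 1) * Y powr s)"
    using dil_moment_le[OF s(1)] by blast
  have "(0::real) \<le> 1 + ln 4" by simp
  from log_power_le_powr[OF this s(1), of "2 * p"] obtain C2 where C2: "0 \<le> C2"
    "\<And>x. 1 \<le> x \<Longrightarrow> (1 + ln 4 + ln x) ^ (2 * p) \<le> C2 * x powr s" by blast
  have "(0::real) \<le> ln 2" by simp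
  from log_power_le_powr[OF this s(1), of 1] obtain C3 where C3: "0 \<le> C3"
    "\<And>x. 1 \<le> x \<Longrightarrow> (ln 2 + ln x) ^ 1 \<le> C3 * x powr s" by blast
  from log_power_le_powr[OF order_refl s(1), of p] obtain C4 where C4: "0 \<le> C4"
    "\<And>x. 1 \<le> x \<Longrightarrow> (0 + ln x) ^ p \<le> C4 * x powr s" by blast
  define CG where "CG = 2 * (4 ^ p * C2 + 2 * K * C3)"
  define A1 where "A1 = c * (real p + 1) * (3 + 6 * real p) * C4"
  define A2 where "A2 = 16 * C0 * 2 ^ p * C3 + 2 * CG"
  have A0: "0 \<le> A1" "0 \<le> A2" "0 \<le> CG" unfolding A1_def A2_def CG_def using K C2 C3 C4 c by auto
  have ev: "\<forall>\<^sub>F X in at_top. max X0 E \<le> X powr e \<and> 4 \<le> X powr (r + 2 * e1) \<and> 6 * real p \<le> X powr (e1 / 8)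
      \<and> 2 \<le> X powr (e1 / 2) \<and> 1 \<le> X"
    using e r by (intro eventually_conj eventually_powr_ge eventually_ge_at_top) auto
  show ?thesis
  proof (intro exI[of _ "A1 + A2"] conjI eventually_mono[OF ev] allI impI)
    show "0 \<le> A1 + A2" using A0 by simp
    fix X H assume X: "max X0 E \<le> X powr e \<and> 4 \<le> X powr (r + 2 * e1) \<and> 6 * real p \<le> X powr (e1 / 8)
      \<and> 2 \<le> X powr (e1 / 2) \<and> 1 \<le> X"
      and H: "X powr (2 * e + e1) \<le> H \<and> H \<le> X powr (1 - (real p + 1) * e - 2 * e1) / 2"
    define a where "a = 4 * H * X powr e"
    define l where "l = X powr (- e1 / 8)"
    define \<eta> where "\<eta> = X powr (- e1 / 2)"
    have X1: "1 \<le> X" using X by simp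
    have Xpos: "0 < X" using X1 by simp
    have Xe: "X0 \<le> X powr e" "1 \<le> X powr e" "E \<le> X powr e" using X X0 by auto
    have H1: "1 \<le> H" using H X1 e ge_one_powr_ge_zero[of X "2 * e + e1"] by linarith
    have "4 * H * 1 \<le> a" unfolding a_def using H1 Xe by (intro mult_left_mono) auto
    then have aH: "4 * H \<le> a" by simp
    have "2 * a = (2 * H) * (4 * X powr e)" by (simp add: a_def)
    also have "\<dots> \<le> X powr (1 - (real p + 1) * e - 2 * e1) * (4 * X powr e)"
      using H by (intro mult_right_mono) auto
    also have "\<dots> = 4 * X powr (1 - r - 2 * e1)" by (simp add: powr_add[symmetric] r_def algebra_simps)
    finally have a2: "2 * a \<le> 4 * X powr (1 - r - 2 * e1)" .
    also have "\<dots> \<le> X powr (r + 2 * e1) * X powr (1 - r - 2 * e1)" using X by (intro mult_right_mono) auto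
    also have "\<dots> = X" using X1 by (simp add: powr_add[symmetric])
    finally have aX: "2 * a \<le> X" .
    have a1: "4 \<le> a" using aH H1 by linarith
    have X8: "8 \<le> X" using a1 aX by linarith
    have HX: "H \<le> X" using aH aX H1 by linarith
    have l: "0 < l" "6 * real p * l \<le> 1"
    proof -
      show "0 < l" using Xpos by (simp add: l_def)
      have "6 * real p * l \<le> X powr (e1 / 8) * l" using X \<open>0 < l\<close> by (intro mult_right_mono) auto
      also have "\<dots> = 1" using Xpos by (simp add: l_def powr_add[symmetric])
      finally show "6 * real p * l \<le> 1" .
    qed
    have \<eta>: "0 < \<eta>" "\<eta> \<le> l" "\<eta> \<le> 1"
    proof -
      show "0 < \<eta>" using Xpos by (simp add: \<eta>_def)
      show "\<eta> \<le> l" unfolding \<eta>_def l_def using X1 e by (intro powr_mono) auto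
      show "\<eta> \<le> 1" unfolding \<eta>_def using X1 e powr_mono[of "- e1 / 2" 0 X] by simp
    qed
    have twoX: "(2 * X) powr t \<le> 2 * X powr t" if "0 \<le> t" "t \<le> 1" for t
    proof -
      have "(2 * X) powr t = 2 powr t * X powr t" using Xpos by (simp add: powr_mult)
      also have "\<dots> \<le> 2 powr 1 * X powr t" using that by (intro mult_right_mono powr_mono) auto
      finally show ?thesis by simp
    qed
    have H2: "2 * X powr e \<le> H"
    proof -
      have "2 * X powr e \<le> X powr (e1 / 2) * X powr e" using X by (intro mult_right_mono) auto
      also have "\<dots> = X powr (e1 / 2 + e)" by (simp add: powr_add)
      also have "\<dots> \<le> X powr (2 * e + e1)" using X1 e by (intro powr_mono) auto
      finally show ?thesis using H by linarith
    qed
    \<comment> \<open>The full strength of the lower bound for \<open>H\<close> is needed here: after the factor \<open>\<eta>\<close> an exponent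
      \<open>e1 / 2\<close> is left to spare for the constant.\<close>
    have W: "(2 * X) powr (2 * e) \<le> \<eta> * H"
    proof -
      have "(2 * X) powr (2 * e) \<le> 2 * X powr (2 * e)" using e by (intro twoX) auto
      also have "\<dots> \<le> X powr (e1 / 2) * X powr (2 * e)" using X by (intro mult_right_mono) auto
      also have "\<dots> = \<eta> * X powr (2 * e + e1)" unfolding \<eta>_def using Xpos by (simp add: powr_add[symmetric])
      also have "\<dots> \<le> \<eta> * H" using \<eta> H by (intro mult_left_mono) auto
      finally show ?thesis .
    qed
    define B where "B = 2 * C0 * X powr (1 - e1)"
    have B0: "0 \<le> B" using c by (simp add: B_def)
    define G where "G = (\<eta> * H) ^ (p + 1) * (CG * X powr (1 + 2 * s))"
    have G0: "0 \<le> G" unfolding G_def using \<eta> H1 A0 by simp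
    have asy: "\<bar>integral {1..Y} (\<lambda>x. (R (x + 1 / u * x) - R x) ^ (2 * p)) - c * Y ^ (p + 1) * (1 / u) ^ p * ln (u / E) ^ p\<bar>
        \<le> B * (1 / u) ^ p * Y ^ p"
      if u: "a / ((1 + \<eta>) * H) \<le> u" "u \<le> X / H" and Y: "Y = H * u \<or> Y = (1 + \<eta>) * H * u" for u Y
    proof -
      have pos: "0 < (1 + \<eta>) * H" "(1 + \<eta>) * H \<le> 2 * H" using \<eta> H1 by auto
      have "a / (2 * H) \<le> a / ((1 + \<eta>) * H)" using pos H1 a1 \<eta> by (intro divide_left_mono mult_pos_pos) auto
      then have u2: "2 * X powr e \<le> u" using u(1) H1 by (simp add: a_def)
      then have u0: "0 < u" using Xe by linarith
      have Hu: "H * u \<le> X" using u(2) H1 by (simp add: field_simps)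
      have YH: "H * u \<le> Y" using Y u0 H1 \<eta> by (auto simp: mult_right_mono mult_le_cancel_right1)
      have "(1 + \<eta>) * (H * u) \<le> 2 * X" using \<eta> Hu H1 u0 by (intro mult_mono) auto
      then have Y2: "Y \<le> 2 * X" using Y Hu X1 by (auto simp: mult.assoc)
      have "1 * u \<le> H * u" using H1 u0 by (intro mult_right_mono) auto
      then have YX0: "X0 \<le> Y" using YH u2 Xe by linarith
      have Y0: "0 < Y" using YX0 X0 by linarith
      have Ye: "Y powr e \<le> 2 * X powr e"
      proof -
        have "Y powr e \<le> (2 * X) powr e" using Y0 Y2 e by (intro powr_mono2) auto
        also have "\<dots> \<le> 2 * X powr e" using e by (intro twoX) auto
        finally show ?thesis .
      qed
      have d1: "Y powr (-1 + e) \<le> 1 / u"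
      proof -
        have "Y powr e * u \<le> H * u" using Ye H2 u0 by (intro mult_right_mono) auto
        then have "Y powr e * u \<le> Y" using YH by linarith
        then have "Y powr e / Y \<le> 1 / u" using u0 Y0 by (simp add: field_simps)
        then show ?thesis using Y0 by (simp add: powr_minus_one_add[symmetric] del: One_nat_def)
      qed
      have d2: "1 / u \<le> Y powr (- e)"
      proof -
        have "1 / u \<le> 1 / Y powr e" using Ye u2 Y0 u0 by (intro divide_left_mono mult_pos_pos) auto
        then show ?thesis by (simp add: powr_minus_divide)
      qed
      have "\<bar>integral {1..Y} (\<lambda>x. (R (x + 1 / u * x) - R x) ^ (2 * p)) - c * Y ^ (p + 1) * (1 / u) ^ p * ln (1 / (E * (1 / u))) ^ p\<bar>
        \<le> C0 * (1 / u) ^ p * Y powr (real p + 1 - e1)"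
        by (rule asymptotic[OF YX0 d1 d2])
      also have "1 / (E * (1 / u)) = u / E" by simp
      also have "Y powr (real p + 1 - e1) = Y ^ p * Y powr (1 - e1)"
        using Y0 powr_realpow[of Y p] powr_add[of Y "real p" "1 - e1"] by (simp add: add_diff_eq)
      also have "C0 * (1 / u) ^ p * (Y ^ p * Y powr (1 - e1)) \<le> C0 * (1 / u) ^ p * (Y ^ p * (2 * X powr (1 - e1)))"
      proof (intro mult_left_mono)
        have "Y powr (1 - e1) \<le> (2 * X) powr (1 - e1)" using Y0 Y2 e by (intro powr_mono2) auto
        also have "\<dots> \<le> 2 * X powr (1 - e1)" using e by (intro twoX) auto
        finally show "Y powr (1 - e1) \<le> 2 * X powr (1 - e1)" .
      qed (use c u0 Y0 in auto)
      also have "\<dots> = B * (1 / u) ^ p * Y ^ p" by (simp add: B_def)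
      finally show ?thesis .
    qed
    \<comment> \<open>The short shifts \<open>w \<le> \<eta> H\<close>: against \<open>x \<ge> a\<close> they are dilations by at most \<open>Y powr (-e)\<close>, so
      the sharp bound, without the loss \<open>Y powr (p e)\<close>, is available.\<close>
    have rem: "(\<integral>\<^sup>+w\<in>{0..\<eta> * H}. shift_moment R (2 * p) (a + H) (X + H) w \<partial>lborel) \<le> ennreal G"
    proof -
      define K' where "K' = 2 * K * X powr s"
      have K'0: "0 \<le> K'" using K by (simp add: K'_def)
      have Z: "X + H \<le> 2 * X" "1 \<le> X + H" using HX X1 H1 by auto
      have "(\<integral>\<^sup>+w\<in>{0..\<eta> * H}. shift_moment R (2 * p) (a + H) (X + H) w \<partial>lborel) \<le>
        ennreal ((\<eta> * H) ^ (p + 1) * (X + H) * (4 ^ p * (1 + ln (2 * (X + H))) ^ (2 * p) + K' * ln (X + H)))"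
      proof (rule remainder_bound[where e = e])
        have "(X + H) powr (2 * e) \<le> (2 * X) powr (2 * e)" using Z e by (intro powr_mono2) auto
        then show "(X + H) powr (2 * e) \<le> \<eta> * H" using W by linarith
        have "\<eta> * H \<le> 1 * H" using \<eta> H1 by (intro mult_right_mono) auto
        then show "\<eta> * H \<le> a + H" using a1 by linarith
        fix Y d assume Y: "a + H \<le> Y" "Y \<le> X + H" and d: "Y powr (-1 + e) \<le> d" "d \<le> \<eta> * H / (a + H)"
        have Y2: "Y \<le> 2 * X" using Y Z by linarith
        have Y0: "0 < Y" using Y a1 H1 by linarith
        have "1 * X powr e \<le> (4 * H) * X powr e" using H1 by (intro mult_right_mono) auto
        then have "X powr e \<le> a" by (simp only: a_def mult_1_left)
        then have YX0: "X0 \<le> Y" using Y Xe H1 by linarith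
        have d2: "d \<le> Y powr (-e)"
        proof -
          have "\<eta> * H / (a + H) \<le> H / a" using \<eta> H1 a1 by (intro frac_le) auto
          also have "\<dots> \<le> 1 / (2 * X powr e)" unfolding a_def using H1 Xpos by (simp add: field_simps)
          also have "\<dots> \<le> 1 / (2 * X) powr e" using twoX[of e] e Xpos by (intro divide_left_mono mult_pos_pos) auto
          also have "\<dots> \<le> 1 / Y powr e" using Y0 Y2 e by (intro divide_left_mono mult_pos_pos powr_mono2) auto
          finally show ?thesis using d by (simp add: powr_minus_divide)
        qed
        have d0: "0 \<le> d" using order_trans[OF powr_ge_zero d(1)] .
        have "dil_moment R (2 * p) Y d \<le> ennreal (K * d ^ p * Y ^ (p + 1) * Y powr s)"
          by (rule K(2)[OF YX0 d(1) d2])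
        also have "\<dots> \<le> ennreal (K * d ^ p * Y ^ (p + 1) * (2 * X powr s))"
        proof (intro ennreal_leI mult_left_mono)
          have "Y powr s \<le> (2 * X) powr s" using Y0 Y2 s by (intro powr_mono2) auto
          also have "\<dots> \<le> 2 * X powr s" using s by (intro twoX) auto
          finally show "Y powr s \<le> 2 * X powr s" .
        qed (use K d0 Y0 in auto)
        finally show "dil_moment R (2 * p) Y d \<le> ennreal (K' * d ^ p * Y ^ (p + 1))"
          by (simp add: K'_def ac_simps)
      qed (use e Z a1 aX K'0 in auto)
      also have "\<dots> \<le> ennreal G"
        unfolding G_def mult.assoc
      proof (intro ennreal_leI mult_left_mono)
        have "1 + ln (2 * (X + H)) \<le> 1 + ln (4 * X)" using Z by (intro add_left_mono ln_mono) auto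
        also have "\<dots> = 1 + ln 4 + ln X" using Xpos by (simp add: ln_mult)
        finally have "(1 + ln (2 * (X + H))) ^ (2 * p) \<le> (1 + ln 4 + ln X) ^ (2 * p)" using Z by (intro power_mono) auto
        also have "\<dots> \<le> C2 * X powr s" by (rule C2(2)[OF X1])
        also have "\<dots> \<le> C2 * X powr (2 * s)" using C2 X1 s by (intro mult_left_mono powr_mono) auto
        finally have b1: "(1 + ln (2 * (X + H))) ^ (2 * p) \<le> C2 * X powr (2 * s)" .
        have "ln (X + H) \<le> ln (2 * X)" using Z by (intro ln_mono) auto
        also have "\<dots> \<le> C3 * X powr s" using C3(2)[OF X1] Xpos by (simp add: ln_mult)
        finally have "K' * ln (X + H) \<le> K' * (C3 * X powr s)" using K'0 by (intro mult_left_mono)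
        also have "\<dots> = 2 * K * C3 * X powr (2 * s)" unfolding K'_def using powr_add[of X s s] by simp
        finally have b2: "K' * ln (X + H) \<le> 2 * K * C3 * X powr (2 * s)" .
        have S: "4 ^ p * (1 + ln (2 * (X + H))) ^ (2 * p) + K' * ln (X + H) \<le>
          4 ^ p * (C2 * X powr (2 * s)) + 2 * K * C3 * X powr (2 * s)"
          by (rule add_mono[OF mult_left_mono[OF b1] b2]) simp
        have S0: "0 \<le> 4 ^ p * (1 + ln (2 * (X + H))) ^ (2 * p) + K' * ln (X + H)"
          using Z K'0 by simp
        have "(X + H) * (4 ^ p * (1 + ln (2 * (X + H))) ^ (2 * p) + K' * ln (X + H)) \<le>
          (2 * X) * (4 ^ p * (C2 * X powr (2 * s)) + 2 * K * C3 * X powr (2 * s))"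
          by (rule mult_mono[OF Z(1) S _ S0]) (use Xpos in simp)
        also have "\<dots> = CG * (X powr 1 * X powr (2 * s))" unfolding CG_def using Xpos by (simp add: algebra_simps)
        also have "\<dots> = CG * X powr (1 + 2 * s)" by (simp add: powr_add)
        finally show "(X + H) * (4 ^ p * (1 + ln (2 * (X + H))) ^ (2 * p) + K' * ln (X + H)) \<le> CG * X powr (1 + 2 * s)" .
      qed (use \<eta> H1 in auto)
      finally show ?thesis .
    qed
    have "\<bar>integral {a..X} (\<lambda>x. (R (x + H) - R x) ^ (2 * p))
         - c * (real p + 1) * H ^ (p + 1) * integral {E..X / H} (\<lambda>x. ln (x / E) ^ p)\<bar> \<le>
       c * (real p + 1) * H ^ p * (a + \<eta> * X + 6 * real p * l * X) * ln X ^ p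
         + 2 / \<eta> * (4 * B * (2 * H) ^ p * ln X + 1 / l ^ (2 * p - 1) * G / H)"
    proof (rule principal_range[OF p E c(1) B0 G0 H1 \<eta>(1,2) l(2) _ aX asy rem])
      have "E * (2 * H) \<le> X powr e * (4 * H)" using Xe E H1 by (intro mult_mono) auto
      then show "2 * E * H \<le> a" by (simp add: a_def ac_simps)
    qed
    also have "\<dots> \<le> A1 * H ^ p * X powr (1 - e1 / 16) + A2 * H ^ p * X powr (1 - e1 / 16)"
    proof (intro add_mono)
      have "2 * a \<le> 4 * X powr (1 - e1 / 8)"
        using a2 X1 r e by (intro order_trans[OF a2]) (simp add: powr_mono)
      moreover have "\<eta> * X \<le> X powr (1 - e1 / 8)"
      proof -
        have "\<eta> * X = X powr (1 - e1 / 2)" unfolding \<eta>_def using Xpos powr_add[of X "- e1 / 2" 1] by simp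
        also have "\<dots> \<le> X powr (1 - e1 / 8)" using X1 e by (intro powr_mono) auto
        finally show ?thesis .
      qed
      moreover have lX: "l * X = X powr (1 - e1 / 8)" unfolding l_def using Xpos powr_add[of X "- e1 / 8" 1] by simp
      have "6 * real p * l * X = 6 * real p * X powr (1 - e1 / 8)" unfolding lX[symmetric] by simp
      ultimately have "a + \<eta> * X + 6 * real p * l * X \<le> (3 + 6 * real p) * X powr (1 - e1 / 8)"
        unfolding distrib_right by linarith
      moreover have "ln X ^ p \<le> C4 * X powr s" using C4(2)[OF X1] by simp
      ultimately have "(a + \<eta> * X + 6 * real p * l * X) * ln X ^ p \<le> ((3 + 6 * real p) * X powr (1 - e1 / 8)) * (C4 * X powr s)"
        using X1 by (intro mult_mono) auto
      also have "\<dots> = (3 + 6 * real p) * C4 * X powr (1 - e1 / 8 + s)" by (simp add: powr_add)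
      also have "\<dots> \<le> (3 + 6 * real p) * C4 * X powr (1 - e1 / 16)"
        using X1 C4 e by (intro mult_left_mono powr_mono) (auto simp: s_def)
      finally have "c * (real p + 1) * H ^ p * ((a + \<eta> * X + 6 * real p * l * X) * ln X ^ p) \<le>
         c * (real p + 1) * H ^ p * ((3 + 6 * real p) * C4 * X powr (1 - e1 / 16))"
        using c H1 by (intro mult_left_mono) auto
      then show "c * (real p + 1) * H ^ p * (a + \<eta> * X + 6 * real p * l * X) * ln X ^ p \<le> A1 * H ^ p * X powr (1 - e1 / 16)"
        by (simp add: A1_def ac_simps)
    next
      have "ln X \<le> ln 2 + ln X" by simp
      also have "\<dots> \<le> C3 * X powr s" using C3(2)[OF X1] by simp
      finally have lnX: "ln X \<le> C3 * X powr s" .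
      have inv\<eta>: "2 / \<eta> = 2 * X powr (e1 / 2)" unfolding \<eta>_def by (simp add: powr_minus_divide)
      have "2 / \<eta> * (4 * B * (2 * H) ^ p * ln X) \<le> 2 / \<eta> * (4 * B * (2 * H) ^ p * (C3 * X powr s))"
        using \<eta> B0 H1 lnX by (intro mult_left_mono) auto
      also have "\<dots> = 16 * C0 * 2 ^ p * C3 * H ^ p * (X powr (e1 / 2) * X powr (1 - e1) * X powr s)"
        unfolding inv\<eta> B_def by (simp add: power_mult_distrib)
      also have "X powr (e1 / 2) * X powr (1 - e1) * X powr s = X powr (1 - e1 / 2 + s)"
        by (simp add: powr_add[symmetric])
      also have "16 * C0 * 2 ^ p * C3 * H ^ p * X powr (1 - e1 / 2 + s) \<le> 16 * C0 * 2 ^ p * C3 * H ^ p * X powr (1 - e1 / 16)"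
        using X1 C3 c H1 e by (intro mult_left_mono powr_mono) (auto simp: s_def)
      finally have t1: "2 / \<eta> * (4 * B * (2 * H) ^ p * ln X) \<le> 16 * C0 * 2 ^ p * C3 * H ^ p * X powr (1 - e1 / 16)" .
      have "2 / \<eta> * (1 / l ^ (2 * p - 1) * G / H) = 2 * CG * H ^ p * (\<eta> ^ p * (1 / l ^ (2 * p - 1)) * X powr (1 + 2 * s))"
        unfolding G_def using \<eta> H1 by (simp add: power_mult_distrib field_simps)
      also have "\<eta> ^ p * (1 / l ^ (2 * p - 1)) * X powr (1 + 2 * s) = X powr (- (e1 / 2) * real p + e1 / 8 * real (2 * p - 1) + (1 + 2 * s))"
      proof -
        have "\<eta> ^ p = X powr (- (e1 / 2) * real p)" unfolding \<eta>_def using Xpos by (simp add: powr_power mult.commute)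
        moreover have "1 / l ^ (2 * p - 1) = X powr (e1 / 8 * real (2 * p - 1))"
          unfolding l_def using Xpos by (simp add: powr_power powr_minus_divide[symmetric] mult.commute)
        ultimately show ?thesis by (simp only: powr_add)
      qed
      also have "\<dots> \<le> X powr (1 - e1 / 16)"
      proof (intro powr_mono)
        have "real (2 * p - 1) = 2 * real p - 1" using p by (simp add: of_nat_diff)
        moreover have "0 \<le> e1 * real p" using e by simp
        ultimately show "- (e1 / 2) * real p + e1 / 8 * real (2 * p - 1) + (1 + 2 * s) \<le> 1 - e1 / 16"
          by (simp add: s_def algebra_simps)
      qed (use X1 in auto)
      finally have t2: "2 / \<eta> * (1 / l ^ (2 * p - 1) * G / H) \<le> 2 * CG * H ^ p * X powr (1 - e1 / 16)"
        using A0 H1 by (simp add: mult_left_mono)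
      show "2 / \<eta> * (4 * B * (2 * H) ^ p * ln X + 1 / l ^ (2 * p - 1) * G / H) \<le> A2 * H ^ p * X powr (1 - e1 / 16)"
        unfolding A2_def distrib_left distrib_right using t1 t2 by linarith
    qed
    also have "\<dots> = (A1 + A2) * H ^ p * X powr (1 - e1 / 16)" by (simp add: algebra_simps)
    finally show "\<bar>integral {4 * H * X powr e..X} (\<lambda>x. (R (x + H) - R x) ^ (2 * p))
         - c * (real p + 1) * H ^ (p + 1) * integral {E..X / H} (\<lambda>x. ln (x / E) ^ p)\<bar>
      \<le> (A1 + A2) * H ^ p * X powr (1 - e1 / 16)"
      unfolding a_def .
  qed
qed

text \<open>
  The initial range contributes only to the upper bound: the integrand is nonnegative, so the integral
  over \<open>[a, X]\<close> is already a lower bound.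
\<close>
theorem fixed_shift_asymptotics:
  shows "\<exists>C. \<forall>\<^sub>F X in at_top. \<forall>H. X powr (2 * e + e1) \<le> H \<and> 
      H \<le> X powr (1 - (real p + 1) * e - 2 * e1) / 2 \<longrightarrow>
      \<bar>integral {1..X} (\<lambda>x. (R (x + H) - R x) ^ (2 * p))
         - c * (real p + 1) * H ^ (p + 1) * integral {E..X / H} (\<lambda>x. ln (x / E) ^ p)\<bar>
      \<le> C * (H ^ p * X powr (1 - e1 / 16))"
proof -
  obtain C1 where C1: "0 \<le> C1" "\<forall>\<^sub>F X in at_top. \<forall>H. X powr (2 * e + e1) \<le> H \<and> 
      H \<le> X powr (1 - (real p + 1) * e - 2 * e1) / 2 \<longrightarrow>
      shift_moment R (2 * p) 1 (4 * H * X powr e) H \<le> ennreal (C1 * H ^ p * X powr (1 - e1))"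
    using initial_range by blast
  obtain C2 where C2: "0 \<le> C2" "\<forall>\<^sub>F X in at_top. \<forall>H. X powr (2 * e + e1) \<le> H \<and> 
      H \<le> X powr (1 - (real p + 1) * e - 2 * e1) / 2 \<longrightarrow>
      \<bar>integral {4 * H * X powr e..X} (\<lambda>x. (R (x + H) - R x) ^ (2 * p))
         - c * (real p + 1) * H ^ (p + 1) * integral {E..X / H} (\<lambda>x. ln (x / E) ^ p)\<bar>
      \<le> C2 * H ^ p * X powr (1 - e1 / 16)"
    using principal_asymptotic by blast
  show ?thesis
  proof (intro exI[of _ "C1 + C2"], use C1(2) C2(2) eventually_ge_at_top[of 1] in eventually_elim, intro allI impI)
    fix X H :: real
    assume 1: "\<forall>H. X powr (2 * e + e1) \<le> H \<and> 
      H \<le> X powr (1 - (real p + 1) * e - 2 * e1) / 2 \<longrightarrow>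
      shift_moment R (2 * p) 1 (4 * H * X powr e) H \<le> ennreal (C1 * H ^ p * X powr (1 - e1))"
      and 2: "\<forall>H. X powr (2 * e + e1) \<le> H \<and> 
      H \<le> X powr (1 - (real p + 1) * e - 2 * e1) / 2 \<longrightarrow>
      \<bar>integral {4 * H * X powr e..X} (\<lambda>x. (R (x + H) - R x) ^ (2 * p))
         - c * (real p + 1) * H ^ (p + 1) * integral {E..X / H} (\<lambda>x. ln (x / E) ^ p)\<bar>
      \<le> C2 * H ^ p * X powr (1 - e1 / 16)"
      and X: "1 \<le> X"
      and H: "X powr (2 * e + e1) \<le> H \<and> H \<le> X powr (1 - (real p + 1) * e - 2 * e1) / 2"
    define a where "a = 4 * H * X powr e"
    define I where "I x y = integral {x..y} (\<lambda>x. (R (x + H) - R x) ^ (2 * p))" for x y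
    have H1: "1 \<le> H" using H X e ge_one_powr_ge_zero[of X "2 * e + e1"] by linarith
    have a1: "1 \<le> a" using H1 X e mult_mono[of 1 "4 * H" 1 "X powr e"] by (simp add: a_def ge_one_powr_ge_zero)
    have I0: "0 \<le> I x y" for x y
      unfolding I_def by (cases "(\<lambda>x. (R (x + H) - R x) ^ (2 * p)) integrable_on {x..y}")
        (auto intro!: integral_nonneg simp: not_integrable_integral)
    have sm: "shift_moment R (2 * p) x y H = ennreal (I x y)" if "1 \<le> x" for x y
      unfolding I_def using that H1 by (intro shift_moment_eq_integral) auto
    have le: "C1 * H ^ p * X powr (1 - e1) \<le> C1 * H ^ p * X powr (1 - e1 / 16)"
      using C1 H1 X e by (intro mult_left_mono powr_mono) auto
    have "shift_moment R (2 * p) 1 a H \<le> ennreal (C1 * H ^ p * X powr (1 - e1))"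
      using 1 H unfolding a_def by blast
    then have "ennreal (I 1 a) \<le> ennreal (C1 * H ^ p * X powr (1 - e1))" by (simp add: sm)
    then have s1: "I 1 a \<le> C1 * H ^ p * X powr (1 - e1)"
      by (rule ennreal_le_iff[THEN iffD1, rotated]) (use C1 H1 in auto)
    have "ennreal (I 1 X) \<le> ennreal (I 1 a) + ennreal (I a X)"
      using shift_moment_split_le[OF measurable_R, of "2 * p" 1 X H a] sm a1 by simp
    then have "ennreal (I 1 X) \<le> ennreal (I 1 a + I a X)" using I0 by simp
    then have up: "I 1 X \<le> I 1 a + I a X" by (rule ennreal_le_iff[THEN iffD1, rotated]) (use I0 in simp)
    have "ennreal (I a X) \<le> ennreal (I 1 X)"
      using shift_moment_mono[of 1 a X X R "2 * p" H] sm a1 by simp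
    then have lo: "I a X \<le> I 1 X" by (rule ennreal_le_iff[THEN iffD1, rotated]) (use I0 in simp)
    have "\<bar>I a X - c * (real p + 1) * H ^ (p + 1) * integral {E..X / H} (\<lambda>x. ln (x / E) ^ p)\<bar>
      \<le> C2 * H ^ p * X powr (1 - e1 / 16)"
      using 2 H unfolding I_def a_def by blast
    then have "\<bar>I 1 X - c * (real p + 1) * H ^ (p + 1) * integral {E..X / H} (\<lambda>x. ln (x / E) ^ p)\<bar>
      \<le> C1 * H ^ p * X powr (1 - e1 / 16) + C2 * H ^ p * X powr (1 - e1 / 16)"
      using up lo s1 le C1 H1 by linarith
    then show "\<bar>integral {1..X} (\<lambda>x. (R (x + H) - R x) ^ (2 * p))
         - c * (real p + 1) * H ^ (p + 1) * integral {E..X / H} (\<lambda>x. ln (x / E) ^ p)\<bar>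
      \<le> (C1 + C2) * (H ^ p * X powr (1 - e1 / 16))"
      unfolding I_def by (simp add: algebra_simps)
  qed
qed

end

section \<open>The Chebyshev function\<close>

text \<open>
  The interval \<open>(x, x + w]\<close> contains at most \<open>w + 1\<close> integers.
\<close>
lemma chebyshev_psi_increment:
  assumes "0 \<le> x" "0 \<le> w" "1 \<le> x + w"
  shows "0 \<le> chebyshev_psi (x + w) - chebyshev_psi x"
    and "chebyshev_psi (x + w) - chebyshev_psi x \<le> (w + 1) * ln (x + w)"
proof -
  define S where "S y = {n::nat. 0 < n \<and> real n \<le> y}" for y :: real
  have fin: "finite (S y)" for y
    by (rule finite_subset[of _ "{..nat \<lfloor>y\<rfloor>}"]) (auto simp: S_def le_nat_floor)
  have sub: "S x \<subseteq> S (x + w)" using assms by (auto simp: S_def)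
  have diff: "chebyshev_psi (x + w) - chebyshev_psi x = (\<Sum>n\<in>S (x + w) - S x. mangoldt n)"
    unfolding chebyshev_psi_def S_def[symmetric] using sub fin by (subst sum_diff) auto
  show "0 \<le> chebyshev_psi (x + w) - chebyshev_psi x"
    unfolding diff by (intro sum_nonneg mangoldt_nonneg)
  have "S (x + w) - S x \<subseteq> {nat \<lfloor>x\<rfloor><..nat \<lfloor>x + w\<rfloor>}"
  proof
    fix n assume "n \<in> S (x + w) - S x"
    then have n: "0 < n" "real n \<le> x + w" "x < real n" by (auto simp: S_def)
    have "n \<le> nat \<lfloor>x + w\<rfloor>" using n by (simp add: le_nat_floor)
    moreover have "nat \<lfloor>x\<rfloor> < n" using n assms by linarith
    ultimately show "n \<in> {nat \<lfloor>x\<rfloor><..nat \<lfloor>x + w\<rfloor>}" by simp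
  qed
  then have "card (S (x + w) - S x) \<le> card {nat \<lfloor>x\<rfloor><..nat \<lfloor>x + w\<rfloor>}" by (intro card_mono) auto
  then have "real (card (S (x + w) - S x)) \<le> real (nat \<lfloor>x + w\<rfloor> - nat \<lfloor>x\<rfloor>)" by simp
  also have "\<dots> \<le> w + 1" using assms by linarith
  finally have card: "real (card (S (x + w) - S x)) \<le> w + 1" .
  have "(\<Sum>n\<in>S (x + w) - S x. mangoldt n :: real) \<le> (\<Sum>n\<in>S (x + w) - S x. ln (x + w))"
  proof (intro sum_mono)
    fix n assume "n \<in> S (x + w) - S x"
    then have n: "0 < n" "real n \<le> x + w" by (auto simp: S_def)
    then have "mangoldt n \<le> ln (real n)" by (intro mangoldt_le)
    also have "\<dots> \<le> ln (x + w)" using n by (intro ln_mono) auto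
    finally show "mangoldt n \<le> ln (x + w)" .
  qed
  also have "\<dots> \<le> (w + 1) * ln (x + w)" using card assms by (simp add: mult_right_mono)
  finally show "chebyshev_psi (x + w) - chebyshev_psi x \<le> (w + 1) * ln (x + w)" unfolding diff .
qed

lemma mono_chebyshev_psi: "mono chebyshev_psi"
proof (rule monoI)
  fix x y :: real assume "x \<le> y"
  have fin: "finite {n::nat. 0 < n \<and> real n \<le> y}"
    by (rule finite_subset[of _ "{..nat \<lfloor>y\<rfloor>}"]) (auto simp: le_nat_floor)
  show "chebyshev_psi x \<le> chebyshev_psi y"
    unfolding chebyshev_psi_def using \<open>x \<le> y\<close> by (intro sum_mono2 fin mangoldt_nonneg) auto
qed

definition psi_error :: "real \<Rightarrow> real" where
  "psi_error x = chebyshev_psi x - x"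

interpretation psi: log_growth psi_error
proof
  have [measurable]: "chebyshev_psi \<in> borel_measurable borel"
    by (rule borel_measurable_mono[OF mono_chebyshev_psi])
  show "psi_error \<in> borel_measurable borel" unfolding psi_error_def by measurable
  fix x w :: real assume xw: "1 \<le> x" "0 \<le> w"
  have "0 \<le> chebyshev_psi (x + w) - chebyshev_psi x"
    "chebyshev_psi (x + w) - chebyshev_psi x \<le> (w + 1) * ln (x + w)"
    using chebyshev_psi_increment[of x w] xw by auto
  moreover have "0 \<le> (w + 1) * ln (x + w)" using xw by (intro mult_nonneg_nonneg) auto
  ultimately show "\<bar>psi_error (x + w) - psi_error x\<bar> \<le> (w + 1) * (1 + ln (x + w))"
    using xw by (simp add: psi_error_def abs_le_iff distrib_left)
qed

text \<open>
  This makes \<open>ln (u / E_const) \<le> ln u\<close>, so that the main integrand is bounded by a power of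
  \<open>ln X\<close>.
\<close>
lemma E_const_ge_1: "1 \<le> E_const"
proof -
  have "(1::real) / 3 \<le> exp (-1)" using exp_le by (simp add: exp_minus field_simps)
  also have "\<dots> \<le> exp (euler_mascheroni - 1)" using euler_mascheroni_pos by simp
  finally have "2 * 3 * (1 / 3) \<le> 2 * pi * exp (euler_mascheroni - 1)"
    using pi_gt3 by (intro mult_mono) auto
  then show ?thesis by (simp add: E_const_def)
qed

theorem theorem4p1:
  fixes k :: nat
  assumes "Riemann_Hypothesis" and "k > 0" and "even k"
  shows "\<exists>\<epsilon>\<^sub>0 > 0. \<forall>\<epsilon> \<epsilon>\<^sub>1 :: real. \<epsilon>\<^sub>0 > \<epsilon> \<and> \<epsilon> > \<epsilon>\<^sub>1 \<and> \<epsilon>\<^sub>1 > 0 \<longrightarrow>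
    (\<exists>C X\<^sub>0. \<forall>X \<ge> X\<^sub>0. \<forall>\<delta>. X powr (-1 + \<epsilon>) \<le> \<delta> \<and> \<delta> \<le> X powr (-\<epsilon>) \<longrightarrow>
       \<bar>integral {1..X} (\<lambda>x. (chebyshev_psi (x + \<delta> * x) - chebyshev_psi x - \<delta> * x) ^ k)
          - real (gauss_moment k) / (real k / 2 + 1) * X ^ (k div 2 + 1) * \<delta> ^ (k div 2)
              * ln (1 / (E_const * \<delta>)) ^ (k div 2)\<bar>
         \<le> C * (\<delta> ^ (k div 2) * X powr (real k / 2 + 1 - \<epsilon>\<^sub>1)))
    \<longrightarrow>
    (\<exists>\<epsilon>\<^sub>2 > 0. \<exists>C X\<^sub>0. \<forall>X \<ge> X\<^sub>0. \<forall>h. X powr (2 * \<epsilon> + \<epsilon>\<^sub>1) \<le> h \<and>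
         h \<le> X powr (1 - (real k / 2 + 1) * \<epsilon> - 2 * \<epsilon>\<^sub>1) / 2 \<longrightarrow>
       \<bar>integral {1..X} (\<lambda>x. (chebyshev_psi (x + h) - chebyshev_psi x - h) ^ k)
          - real (gauss_moment k) * h ^ (k div 2 + 1)
              * integral {E_const..X / h} (\<lambda>x. ln (x / E_const) ^ (k div 2))\<bar>
         \<le> C * (h ^ (k div 2) * X powr (1 - \<epsilon>\<^sub>2)))"
proof (rule exI[of _ "1 / 4"], rule conjI, simp, intro allI impI)
  fix e e1 :: real
  assume e: "1 / 4 > e \<and> e > e1 \<and> e1 > 0"
  assume hyp: "\<exists>C X\<^sub>0. \<forall>X \<ge> X\<^sub>0. \<forall>\<delta>. X powr (-1 + e) \<le> \<delta> \<and> \<delta> \<le> X powr (-e) \<longrightarrow>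
       \<bar>integral {1..X} (\<lambda>x. (chebyshev_psi (x + \<delta> * x) - chebyshev_psi x - \<delta> * x) ^ k)
          - real (gauss_moment k) / (real k / 2 + 1) * X ^ (k div 2 + 1) * \<delta> ^ (k div 2)
              * ln (1 / (E_const * \<delta>)) ^ (k div 2)\<bar>
         \<le> C * (\<delta> ^ (k div 2) * X powr (real k / 2 + 1 - e1))"
  define p where "p = k div 2"
  define c where "c = real (gauss_moment k) / (real p + 1)"
  have kp: "k = 2 * p" "0 < p" using assms by (auto simp: p_def)
  have rk: "real k / 2 = real p" "k div 2 = p" using kp by auto
  from hyp obtain C X0 where CX0: "\<forall>X \<ge> X0. \<forall>\<delta>. X powr (-1 + e) \<le> \<delta> \<and> \<delta> \<le> X powr (-e) \<longrightarrow>
       \<bar>integral {1..X} (\<lambda>x. (chebyshev_psi (x + \<delta> * x) - chebyshev_psi x - \<delta> * x) ^ k)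
          - real (gauss_moment k) / (real k / 2 + 1) * X ^ (k div 2 + 1) * \<delta> ^ (k div 2)
              * ln (1 / (E_const * \<delta>)) ^ (k div 2)\<bar>
         \<le> C * (\<delta> ^ (k div 2) * X powr (real k / 2 + 1 - e1))"
    by (elim exE) (rule that)
  have CX: "\<bar>integral {1..X} (\<lambda>x. (chebyshev_psi (x + \<delta> * x) - chebyshev_psi x - \<delta> * x) ^ (2 * p))
          - c * X ^ (p + 1) * \<delta> ^ p * ln (1 / (E_const * \<delta>)) ^ p\<bar>
         \<le> C * (\<delta> ^ p * X powr (real p + 1 - e1))"
    if "X0 \<le> X" "X powr (-1 + e) \<le> \<delta>" "\<delta> \<le> X powr (-e)" for X \<delta>
    unfolding kp(1)[symmetric] c_def
    using CX0[rule_format, OF that(1) conjI[OF that(2,3)]] unfolding rk .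
  interpret dilation_asymptotics psi_error p e e1 c E_const "max C 0" "max X0 36"
  proof unfold_locales
    fix Y d assume Y: "max X0 36 \<le> Y" and d: "Y powr (-1 + e) \<le> d" "d \<le> Y powr (-e)"
    have "0 \<le> d" using order_trans[OF powr_ge_zero d(1)] .
    then have "C * (d ^ p * Y powr (real p + 1 - e1)) \<le> max C 0 * (d ^ p * Y powr (real p + 1 - e1))"
      by (intro mult_right_mono) auto
    moreover have "psi_error (x + d * x) - psi_error x = chebyshev_psi (x + d * x) - chebyshev_psi x - d * x" for x
      by (simp add: psi_error_def)
    ultimately show "\<bar>integral {1..Y} (\<lambda>x. (psi_error (x + d * x) - psi_error x) ^ (2 * p))
         - c * Y ^ (p + 1) * d ^ p * ln (1 / (E_const * d)) ^ p\<bar> \<le> max C 0 * d ^ p * Y powr (real p + 1 - e1)"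
      using CX[of Y d] Y d by (simp add: mult.assoc)
  qed (use e kp E_const_ge_1 in \<open>auto simp: c_def\<close>)
  obtain C' where "\<forall>\<^sub>F X in at_top. \<forall>H. X powr (2 * e + e1) \<le> H \<and> 
      H \<le> X powr (1 - (real p + 1) * e - 2 * e1) / 2 \<longrightarrow>
      \<bar>integral {1..X} (\<lambda>x. (psi_error (x + H) - psi_error x) ^ (2 * p))
         - c * (real p + 1) * H ^ (p + 1) * integral {E_const..X / H} (\<lambda>x. ln (x / E_const) ^ p)\<bar>
      \<le> C' * (H ^ p * X powr (1 - e1 / 16))"
    using fixed_shift_asymptotics by blast
  then obtain X1 where X1: "\<forall>X\<ge>X1. \<forall>H. X powr (2 * e + e1) \<le> H \<and> 
      H \<le> X powr (1 - (real p + 1) * e - 2 * e1) / 2 \<longrightarrow>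
      \<bar>integral {1..X} (\<lambda>x. (psi_error (x + H) - psi_error x) ^ (2 * p))
         - c * (real p + 1) * H ^ (p + 1) * integral {E_const..X / H} (\<lambda>x. ln (x / E_const) ^ p)\<bar>
      \<le> C' * (H ^ p * X powr (1 - e1 / 16))"
    unfolding eventually_at_top_linorder by blast
  have "psi_error (x + H) - psi_error x = chebyshev_psi (x + H) - chebyshev_psi x - H" for x H
    by (simp add: psi_error_def)
  moreover have "c * (real p + 1) = real (gauss_moment k)" by (simp add: c_def)
  ultimately have X2: "\<forall>X\<ge>X1. \<forall>H. X powr (2 * e + e1) \<le> H \<and> 
      H \<le> X powr (1 - (real p + 1) * e - 2 * e1) / 2 \<longrightarrow>
      \<bar>integral {1..X} (\<lambda>x. (chebyshev_psi (x + H) - chebyshev_psi x - H) ^ k)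
         - real (gauss_moment k) * H ^ (p + 1) * integral {E_const..X / H} (\<lambda>x. ln (x / E_const) ^ p)\<bar>
      \<le> C' * (H ^ p * X powr (1 - e1 / 16))"
    using X1 by (simp only: kp(1)[symmetric])
  show "\<exists>\<epsilon>\<^sub>2 > 0. \<exists>C X\<^sub>0. \<forall>X \<ge> X\<^sub>0. \<forall>h. X powr (2 * e + e1) \<le> h \<and>
         h \<le> X powr (1 - (real k / 2 + 1) * e - 2 * e1) / 2 \<longrightarrow>
       \<bar>integral {1..X} (\<lambda>x. (chebyshev_psi (x + h) - chebyshev_psi x - h) ^ k)
          - real (gauss_moment k) * h ^ (k div 2 + 1)
              * integral {E_const..X / h} (\<lambda>x. ln (x / E_const) ^ (k div 2))\<bar>
         \<le> C * (h ^ (k div 2) * X powr (1 - \<epsilon>\<^sub>2))"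
    unfolding rk
  proof (rule exI[of _ "e1 / 16"], rule conjI)
    show "0 < e1 / 16" using e by simp
  qed (rule exI[of _ C'], rule exI[of _ X1], rule X2)
qed

end
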